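(* Let $\boldsymbol{\lambda}$ be a bi-partition of $n$ and let $\boldsymbol{T}$ be a standard bi-tableau of shape $\boldsymbol{\lambda}$. Then the restriction to $H_{\boldsymbol{\lambda}}$ (in the variables $z_1,\dots,z_n$) of the rational function $\Phi_{\boldsymbol{T}}(z_1,\dots,z_n,w_1,\dots,w_n)$ is regular at $z_1=z_2=\dots=z_n$. Moreover, the value of this restriction at $z_1=z_2=\dots=z_n$ and $w_1=w_2=\dots=w_n=0$ is equal to $\frac{1}{2^n}F_{\boldsymbol{T}}$.
   Context: Group. $\mathbb{Z}_2\wr S_n$ is the hyperoctahedral group (Coxeter group of type $B_n$, of order $2^n n!$), generated by $s_1,\dots,s_{n-1},t$ with relations $s_i^2=1$, $t^2=1$, $s_is_{i+1}s_i=s_{i+1}s_is_{i+1}$, $s_is_j=s_js_i$ for $|i-j|>1$, $s_it=ts_i$ for $i=2,\dots,n-1$, and $ts_1ts_1=s_1ts_1t$. Combinatorics. A bi-partition $\boldsymbol{\lambda}=(\lambda^1,\lambda^2)$ of $n$ is a pair of partitions (possibly empty) with $|\lambda^1|+|\lambda^2|=n$. A standard bi-tableau $\boldsymbol{T}=(T_1,T_2)$ of shape $\boldsymbol{\lambda}$ is a filling of the nodes of the two Young diagrams with $1,\dots,n$, each used once, with entries strictly increasing along rows and down columns of each diagram. The content of the node in row $a$ and column $b$ of either diagram is $b-a$; $c_i=c_i(\boldsymbol{T})$ is the content of the node containing $i$. Put $\xi_1=1$, $\xi_2=-1$, and $p_i=\xi_k$ if $i$ lies in $T_k$. The $a$-th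 principal hook of a Young diagram is the hook of the diagonal node $(a,a)$, i.e. the set of nodes $(a,b)$ with $b\ge a$ and nodes $(b,a)$ with $b\ge a$. The subspace. $H_{\boldsymbol{\lambda}}$ (which depends on $\boldsymbol{T}$) is the set of $(z_1,\dots,z_n)\in\mathbb{C}^n$ such that $z_i=z_j$ whenever $i$ and $j$ lie in the same principal hook of the same component tableau ($T_1$ or $T_2$) of $\boldsymbol{T}$. The rational function. Let $t(p)=\frac12(1+pt)$. For $1\le m\le n-1$ and $i\neq j$, let $$S_m^{(j,i)}=s_m+\frac{\delta_{p_j,p_i}}{(z_j+c_j)-(z_i+c_i)},$$ with $\delta$ the Kronecker delta (when $p_j\ne p_i$ this means $S_m^{(j,i)}=s_m$). Let $\phi_1=t(p_1+w_1)$ and, for $k=2,\dots,n$, $$\phi_k=S_{k-1}^{(k,k-1)}S_{k-2}^{(k,k-2)}\cdots S_1^{(k,1)}\,t(p_k+w_k)\,s_1s_2\cdots s_{k-1}.$$ Then $$\Phi_{\boldsymbol{T}}(z_1,\dots,z_n,w_1,\dots,w_n)=\phi_n\phi_{n-1}\cdots\phi_1,$$ a rational function with values in $\mathbb{C}[\mathbb{Z}_2\wr S_n]$. "Regular at $z_1=\dots=z_n$" means that the restriction to $H_{\boldsymbol{\lambda}}$, as a rational function on this linear subspace, has no pole at any point with $z_1=\dots=z_n$ (each coefficient can be written as a quotient of polynomials whose denominator does not vanish there); its value there is the value of this extension. The diagonal matrix element. $V_{\boldsymbol{\lambda}}$ is the irreducible representation of $\mathbb{Z}_2\wr S_n$ with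 orthonormal basis $\{v_{\boldsymbol{T}}\}$ indexed by the standard bi-tableaux of shape $\boldsymbol{\lambda}$, with action as follows. Let $\boldsymbol{T}'=s_i\boldsymbol{T}$ be obtained from $\boldsymbol{T}$ by exchanging $i$ and $i+1$. If $i,i+1$ lie in the same component tableau, put $d_i(\boldsymbol{T})=(c_{i+1}(\boldsymbol{T})-c_i(\boldsymbol{T}))^{-1}$; then $s_iv_{\boldsymbol{T}}=d_i(\boldsymbol{T})v_{\boldsymbol{T}}+\sqrt{1-d_i(\boldsymbol{T})^2}\,v_{\boldsymbol{T}'}$ if $\boldsymbol{T}'$ is standard, and $s_iv_{\boldsymbol{T}}=d_i(\boldsymbol{T})v_{\boldsymbol{T}}$ otherwise. If $i,i+1$ lie in different component tableaux, $s_iv_{\boldsymbol{T}}=v_{\boldsymbol{T}'}$. Finally $tv_{\boldsymbol{T}}=v_{\boldsymbol{T}}$ if $1$ lies in $T_1$ and $tv_{\boldsymbol{T}}=-v_{\boldsymbol{T}}$ if $1$ lies in $T_2$. The diagonal matrix element is $$F_{\boldsymbol{T}}=\sum_{g\in\mathbb{Z}_2\wr S_n}\langle v_{\boldsymbol{T}},g v_{\boldsymbol{T}}\rangle\, g\in\mathbb{C}[\mathbb{Z}_2\wr S_n].$$ *)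

theory Defs
  imports
    Complex_Main
    "HOL-Library.FuncSet"
    "HOL-Library.Poly_Mapping"
    "HOL-Computational_Algebra.Fraction_Field"
    "HOL-Combinatorics.Permutations"
    "HOL-Algebra.Group_Action"
begin

section \<open>The hyperoctahedral group and its group algebra\<close>

text \<open>The wreath product of the group of order 2 with the symmetric group on n letters, realised as
  the group of signed permutations of \<open>{-n..n}\<close>.\<close>

definition hyperoctahedral :: "nat \<Rightarrow> (int \<Rightarrow> int) monoid" where
  "hyperoctahedral n =
    \<lparr>carrier = {g. g permutes {- int n..int n} \<and> (\<forall>x. g (- x) = - g x)}, mult = (\<circ>), one = id\<rparr>"

definition gen_s :: "nat \<Rightarrow> int \<Rightarrow> int" where
  "gen_s i = Transposition.transpose (int i) (int i + 1) \<circ>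
             Transposition.transpose (- int i) (- int i - 1)"

definition gen_t :: "int \<Rightarrow> int" where
  "gen_t = Transposition.transpose 1 (- 1)"

lemma group_hyperoctahedral: "group (hyperoctahedral n)"
proof (rule groupI)
  fix g assume g: "g \<in> carrier (hyperoctahedral n)"
  then have p: "g permutes {- int n..int n}" and o: "\<And>x. g (- x) = - g x"
    by (auto simp: hyperoctahedral_def)
  have "Hilbert_Choice.inv g (- x) = - Hilbert_Choice.inv g x" for x
    using permutes_inv_eq[OF p] o permutes_inverses(1)[OF p] by metis
  then have "Hilbert_Choice.inv g \<in> carrier (hyperoctahedral n)"
    using permutes_inv[OF p] by (simp add: hyperoctahedral_def)
  moreover have "Hilbert_Choice.inv g \<otimes>\<^bsub>hyperoctahedral n\<^esub> g = \<one>\<^bsub>hyperoctahedral n\<^esub>"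
    using permutes_inv_o(2)[OF p] by (simp add: hyperoctahedral_def)
  ultimately show "\<exists>h\<in>carrier (hyperoctahedral n).
      h \<otimes>\<^bsub>hyperoctahedral n\<^esub> g = \<one>\<^bsub>hyperoctahedral n\<^esub>" by blast
qed (auto simp: hyperoctahedral_def permutes_compose permutes_id comp_assoc)

lemma gens_in_hyperoctahedral:
  "1 \<le> i \<Longrightarrow> i < n \<Longrightarrow> gen_s i \<in> carrier (hyperoctahedral n)"
  "1 \<le> n \<Longrightarrow> gen_t \<in> carrier (hyperoctahedral n)"
proof -
  assume "1 \<le> i" "i < n"
  moreover from this have "gen_s i permutes {- int n..int n}"
    unfolding gen_s_def by (intro permutes_compose permutes_swap_id) auto
  ultimately show "gen_s i \<in> carrier (hyperoctahedral n)"
    by (auto simp: hyperoctahedral_def gen_s_def Transposition.transpose_def)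
next
  assume "1 \<le> n"
  moreover from this have "gen_t permutes {- int n..int n}"
    unfolding gen_t_def by (intro permutes_swap_id) auto
  ultimately show "gen_t \<in> carrier (hyperoctahedral n)"
    by (auto simp: hyperoctahedral_def gen_t_def Transposition.transpose_def)
qed

lemma gen_s_apply:
  "1 \<le> i \<Longrightarrow> gen_s i x =
    (if x = int i then x + 1 else if x = int i + 1 then x - 1
     else if x = - int i then x - 1 else if x = - int i - 1 then x + 1 else x)"
  by (simp add: gen_s_def Transposition.transpose_def)

lemma gen_t_apply: "gen_t x = (if x = 1 \<or> x = - 1 then - x else x)"
  by (simp add: gen_t_def Transposition.transpose_def)

lemma coxeter_relations:
  "1 \<le> i \<Longrightarrow> gen_s i \<circ> gen_s i = id"
  "gen_t \<circ> gen_t = id"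
  "1 \<le> i \<Longrightarrow> gen_s i \<circ> gen_s (i + 1) \<circ> gen_s i = gen_s (i + 1) \<circ> gen_s i \<circ> gen_s (i + 1)"
  "1 \<le> i \<Longrightarrow> i + 1 < j \<Longrightarrow> gen_s i \<circ> gen_s j = gen_s j \<circ> gen_s i"
  "2 \<le> i \<Longrightarrow> gen_s i \<circ> gen_t = gen_t \<circ> gen_s i"
  "gen_t \<circ> gen_s 1 \<circ> gen_t \<circ> gen_s 1 = gen_s 1 \<circ> gen_t \<circ> gen_s 1 \<circ> gen_t"
  by (simp_all add: fun_eq_iff gen_s_apply gen_t_apply)

text \<open>An element of the group algebra is given by its family of coefficients.\<close>

definition ga_of :: "'g \<Rightarrow> 'a::comm_ring_1 \<Rightarrow> 'g \<Rightarrow> 'a" where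
  "ga_of g c = (\<lambda>h. if h = g then c else 0)"

definition ga_add :: "('g \<Rightarrow> 'a::comm_ring_1) \<Rightarrow> ('g \<Rightarrow> 'a) \<Rightarrow> 'g \<Rightarrow> 'a" where
  "ga_add a b = (\<lambda>g. a g + b g)"

definition ga_mult ::
  "('g, 'm) monoid_scheme \<Rightarrow> ('g \<Rightarrow> 'a::comm_ring_1) \<Rightarrow> ('g \<Rightarrow> 'a) \<Rightarrow> 'g \<Rightarrow> 'a" where
  "ga_mult G a b =
    (\<lambda>g. \<Sum>(h, k)\<in>{(h, k). h \<in> carrier G \<and> k \<in> carrier G \<and> h \<otimes>\<^bsub>G\<^esub> k = g}. a h * b k)"

definition ga_prod ::
  "('g, 'm) monoid_scheme \<Rightarrow> ('g \<Rightarrow> 'a::comm_ring_1) list \<Rightarrow> 'g \<Rightarrow> 'a" where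
  "ga_prod G as = foldr (ga_mult G) as (ga_of \<one>\<^bsub>G\<^esub> 1)"

section \<open>Bi-partitions and standard bi-tableaux\<close>

type_synonym bipart = "nat list \<times> nat list"

text \<open>A triple \<open>(k, a, b)\<close> is the node in row \<open>a\<close> and column \<open>b\<close> (counted from 1) of the
  \<open>k\<close>-th component, \<open>k = 1, 2\<close>.\<close>

type_synonym node = "nat \<times> nat \<times> nat"
type_synonym bitableau = "node \<Rightarrow> nat"

definition is_partition :: "nat list \<Rightarrow> bool" where
  "is_partition p \<longleftrightarrow> sorted_wrt (\<ge>) p \<and> 0 \<notin> set p"

definition bipartition :: "nat \<Rightarrow> bipart \<Rightarrow> bool" where
  "bipartition n l \<longleftrightarrow>
    is_partition (fst l) \<and> is_partition (snd l) \<and> sum_list (fst l) + sum_list (snd l) = n"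

definition young_diagram :: "nat list \<Rightarrow> (nat \<times> nat) set" where
  "young_diagram p = {(a, b). 1 \<le> a \<and> a \<le> length p \<and> 1 \<le> b \<and> b \<le> p ! (a - 1)}"

definition nodes :: "bipart \<Rightarrow> node set" where
  "nodes l = {1} \<times> young_diagram (fst l) \<union> {2} \<times> young_diagram (snd l)"

definition standard_bitableaux :: "bipart \<Rightarrow> bitableau set" where
  "standard_bitableaux l =
    {T \<in> extensional (nodes l).
       bij_betw T (nodes l) {1..sum_list (fst l) + sum_list (snd l)} \<and>
       (\<forall>k a b b'. (k, a, b) \<in> nodes l \<and> (k, a, b') \<in> nodes l \<and> b < b' \<longrightarrow> T (k, a, b) < T (k, a, b')) \<and>
       (\<forall>k a a' b. (k, a, b) \<in> nodes l \<and> (k, a', b) \<in> nodes l \<and> a < a' \<longrightarrow> T (k, a, b) < T (k, a', b))}"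

definition node_of :: "bipart \<Rightarrow> bitableau \<Rightarrow> nat \<Rightarrow> node" where
  "node_of l T i = inv_into (nodes l) T i"

definition component :: "bipart \<Rightarrow> bitableau \<Rightarrow> nat \<Rightarrow> nat" where
  "component l T i = fst (node_of l T i)"

definition content :: "bipart \<Rightarrow> bitableau \<Rightarrow> nat \<Rightarrow> int" where
  "content l T i = (case node_of l T i of (k, a, b) \<Rightarrow> int b - int a)"

definition xi :: "nat \<Rightarrow> int" where
  "xi k = (if k = 1 then 1 else - 1)"

definition sgn_p :: "bipart \<Rightarrow> bitableau \<Rightarrow> nat \<Rightarrow> int" where
  "sgn_p l T i = xi (component l T i)"

definition principal_hook :: "bipart \<Rightarrow> nat \<Rightarrow> nat \<Rightarrow> node set" where
  "principal_hook l k a =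
    {(k, a, b) | b. a \<le> b \<and> (k, a, b) \<in> nodes l} \<union> {(k, b, a) | b. a \<le> b \<and> (k, b, a) \<in> nodes l}"

definition same_hook :: "bipart \<Rightarrow> bitableau \<Rightarrow> nat \<Rightarrow> nat \<Rightarrow> bool" where
  "same_hook l T i j \<longleftrightarrow>
    (\<exists>k a. node_of l T i \<in> principal_hook l k a \<and> node_of l T j \<in> principal_hook l k a)"

section \<open>Rational functions and restriction to a subspace\<close>

text \<open>\<open>ZV i\<close> and \<open>WV i\<close> stand for the variables \<open>z\<^sub>i\<close> and \<open>w\<^sub>i\<close>. The linear order on the
  variables serves only to make the polynomial ring an integral domain in the type class sense.\<close>

datatype var = ZV nat | WV nat

primrec var_code :: "var \<Rightarrow> nat" where
  "var_code (ZV i) = 2 * i"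
| "var_code (WV i) = 2 * i + 1"

lemma var_code_inject: "var_code u = var_code v \<longleftrightarrow> u = v"
  by (cases u; cases v) (simp_all, presburger+)

instantiation var :: linorder
begin

definition less_eq_var :: "var \<Rightarrow> var \<Rightarrow> bool" where
  "u \<le> v \<longleftrightarrow> var_code u \<le> var_code v"

definition less_var :: "var \<Rightarrow> var \<Rightarrow> bool" where
  "u < v \<longleftrightarrow> var_code u < var_code v"

instance
  by standard (auto simp: less_eq_var_def less_var_def var_code_inject[symmetric])

end

type_synonym mpoly = "(var \<Rightarrow>\<^sub>0 nat) \<Rightarrow>\<^sub>0 complex"
type_synonym ratfun = "mpoly fract"

definition mvar :: "var \<Rightarrow> mpoly" where
  "mvar v = Poly_Mapping.single (Poly_Mapping.single v 1) 1"

definition rvar :: "var \<Rightarrow> ratfun" where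
  "rvar v = Fract (mvar v) 1"

definition meval :: "mpoly \<Rightarrow> (var \<Rightarrow> complex) \<Rightarrow> complex" where
  "meval p x = (\<Sum>m\<in>Poly_Mapping.keys p.
     Poly_Mapping.lookup p m * (\<Prod>v\<in>Poly_Mapping.keys m. x v ^ Poly_Mapping.lookup m v))"

text \<open>The restriction of \<open>f\<close> to the linear subspace \<open>L\<close>, as a rational function on \<open>L\<close>, is regular
  at the point \<open>x\<close> with value \<open>c\<close>: writing \<open>f = P / Q\<close> with \<open>Q\<close> not vanishing identically
  on \<open>L\<close>, the restriction \<open>P|\<^sub>L / Q|\<^sub>L\<close> equals \<open>(N / D)|\<^sub>L\<close> with \<open>D x \<noteq> 0\<close>, and \<open>c = N x / D x\<close>. Since
  the polynomial functions on \<open>L\<close> form an integral domain, \<open>c\<close> does not depend on the choices.\<close>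

definition restriction_has_value ::
  "ratfun \<Rightarrow> (var \<Rightarrow> complex) set \<Rightarrow> (var \<Rightarrow> complex) \<Rightarrow> complex \<Rightarrow> bool" where
  "restriction_has_value f L x c \<longleftrightarrow>
    (\<exists>P Q N D. f = Fract P Q \<and> (\<exists>y\<in>L. meval Q y \<noteq> 0) \<and> meval D x \<noteq> 0 \<and>
       (\<forall>y\<in>L. meval P y * meval D y = meval N y * meval Q y) \<and>
       c = meval N x / meval D x)"

definition restriction_regular_at ::
  "ratfun \<Rightarrow> (var \<Rightarrow> complex) set \<Rightarrow> (var \<Rightarrow> complex) \<Rightarrow> bool" where
  "restriction_regular_at f L x \<longleftrightarrow> (\<exists>c. restriction_has_value f L x c)"

text \<open>The subspace of \<open>(z, w)\<close> with \<open>z\<close> in the hook subspace of \<open>T\<close> and \<open>w\<close> arbitrary. Coordinates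
  with indices outside \<open>1, \<dots>, n\<close> are unconstrained and play no role.\<close>

definition hook_subspace :: "nat \<Rightarrow> bipart \<Rightarrow> bitableau \<Rightarrow> (var \<Rightarrow> complex) set" where
  "hook_subspace n l T =
    {x. \<forall>i\<in>{1..n}. \<forall>j\<in>{1..n}. same_hook l T i j \<longrightarrow> x (ZV i) = x (ZV j)}"

section \<open>The function \<open>\<Phi>\<^sub>T\<close>\<close>

definition fus_t :: "ratfun \<Rightarrow> (int \<Rightarrow> int) \<Rightarrow> ratfun" where
  "fus_t p = ga_add (ga_of id (1 / 2)) (ga_of gen_t (p / 2))"

definition fus_S ::
  "bipart \<Rightarrow> bitableau \<Rightarrow> nat \<Rightarrow> nat \<Rightarrow> nat \<Rightarrow> (int \<Rightarrow> int) \<Rightarrow> ratfun" where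
  "fus_S l T m j i =
    ga_add (ga_of (gen_s m) 1)
      (ga_of id ((if sgn_p l T j = sgn_p l T i then 1 else 0) /
        ((rvar (ZV j) + of_int (content l T j)) - (rvar (ZV i) + of_int (content l T i)))))"

definition fus_phi :: "nat \<Rightarrow> bipart \<Rightarrow> bitableau \<Rightarrow> nat \<Rightarrow> (int \<Rightarrow> int) \<Rightarrow> ratfun" where
  "fus_phi n l T k =
    ga_prod (hyperoctahedral n)
      (map (\<lambda>m. fus_S l T m k m) (rev [1..<k])
       @ [fus_t (of_int (sgn_p l T k) + rvar (WV k))]
       @ map (\<lambda>m. ga_of (gen_s m) 1) [1..<k])"

definition fus_Phi :: "nat \<Rightarrow> bipart \<Rightarrow> bitableau \<Rightarrow> (int \<Rightarrow> int) \<Rightarrow> ratfun" where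
  "fus_Phi n l T = ga_prod (hyperoctahedral n) (map (fus_phi n l T) (rev [1..<n + 1]))"

section \<open>The representation \<open>V\<^sub>\<lambda>\<close> and diagonal matrix elements\<close>

text \<open>\<open>V\<^sub>\<lambda>\<close> is coordinatised by its orthonormal basis: a vector is the family of its coordinates
  with respect to the \<open>v\<^sub>T\<close>.\<close>

definition rep_space :: "bipart \<Rightarrow> (bitableau \<Rightarrow> complex) set" where
  "rep_space l = {u. \<forall>T. T \<notin> standard_bitableaux l \<longrightarrow> u T = 0}"

definition rep_inner :: "bipart \<Rightarrow> (bitableau \<Rightarrow> complex) \<Rightarrow> (bitableau \<Rightarrow> complex) \<Rightarrow> complex" where
  "rep_inner l u v = (\<Sum>T\<in>standard_bitableaux l. cnj (u T) * v T)"

definition basis_vec :: "bitableau \<Rightarrow> bitableau \<Rightarrow> complex" where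
  "basis_vec T = (\<lambda>S. if S = T then 1 else 0)"

definition exchange :: "bipart \<Rightarrow> nat \<Rightarrow> bitableau \<Rightarrow> bitableau" where
  "exchange l i T = restrict (Transposition.transpose i (i + 1) \<circ> T) (nodes l)"

definition axial_d :: "bipart \<Rightarrow> nat \<Rightarrow> bitableau \<Rightarrow> real" where
  "axial_d l i T = 1 / real_of_int (content l T (i + 1) - content l T i)"

definition young_orthogonal_rep ::
  "nat \<Rightarrow> bipart \<Rightarrow> ((int \<Rightarrow> int) \<Rightarrow> (bitableau \<Rightarrow> complex) \<Rightarrow> bitableau \<Rightarrow> complex) \<Rightarrow> bool" where
  "young_orthogonal_rep n l act \<longleftrightarrow>
    group_action (hyperoctahedral n) (rep_space l) act \<and>
    (\<forall>g\<in>carrier (hyperoctahedral n). \<forall>u\<in>rep_space l. \<forall>v\<in>rep_space l. \<forall>a b.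
       act g (\<lambda>T. a * u T + b * v T) = (\<lambda>T. a * act g u T + b * act g v T)) \<and>
    (\<forall>i T. 1 \<le> i \<and> i < n \<and> T \<in> standard_bitableaux l \<longrightarrow>
       act (gen_s i) (basis_vec T) =
         (if component l T i = component l T (i + 1) then
            if exchange l i T \<in> standard_bitableaux l then
              (\<lambda>S. complex_of_real (axial_d l i T) * basis_vec T S
                 + complex_of_real (sqrt (1 - (axial_d l i T)\<^sup>2)) * basis_vec (exchange l i T) S)
            else (\<lambda>S. complex_of_real (axial_d l i T) * basis_vec T S)
          else basis_vec (exchange l i T))) \<and>
    (\<forall>T. 1 \<le> n \<and> T \<in> standard_bitableaux l \<longrightarrow>
       act gen_t (basis_vec T) =
         (if component l T 1 = 1 then basis_vec T else (\<lambda>S. - basis_vec T S)))"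

definition diagonal_element ::
  "nat \<Rightarrow> bipart \<Rightarrow> ((int \<Rightarrow> int) \<Rightarrow> (bitableau \<Rightarrow> complex) \<Rightarrow> bitableau \<Rightarrow> complex) \<Rightarrow>
   bitableau \<Rightarrow> (int \<Rightarrow> int) \<Rightarrow> complex" where
  "diagonal_element n l act T =
    (\<lambda>g. if g \<in> carrier (hyperoctahedral n)
         then rep_inner l (basis_vec T) (act g (basis_vec T)) else 0)"

end

theory Submission
  imports Defs "HOL-Library.Product_Lexorder"
begin

text \<open>Moving the factors \<open>t(p\<^sub>k + w\<^sub>k)\<close> to the right turns \<open>\<Phi>\<^sub>T\<close> into a product \<open>R\<close> of factors
  \<open>1 + \<alpha>\<^sub>m\<^sub>k (m, k)\<close>, \<open>\<alpha>\<^sub>m\<^sub>k = \<delta> / (u\<^sub>k - u\<^sub>m)\<close>, \<open>u\<^sub>i = z\<^sub>i + c\<^sub>i\<close>, times a polynomial in the \<open>w\<^sub>k\<close>. If the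
  diagram is filled hook by hook, then a singular factor \<open>(m, k)\<close> is preceded by \<open>(m + 1, k)\<close> with \<open>m\<close>,
  \<open>m + 1\<close> neighbours in one hook; on the hook subspace \<open>R\<close> is fixed by \<open>s\<^sub>m\<close> up to sign, and this makes
  the two poles cancel. Every other tableau is reached by adjacent exchanges, under which \<open>R\<close> is
  conjugated by a regular factor (Yang-Baxter equation).

  The value is then computed along the path on which only \<open>z\<^sub>k\<close> moves: there \<open>\<phi>\<^sub>k(u) X\<close> is a multiple of
  \<open>(u - x\<^sub>k)\<^sup>-\<^sup>1 X\<close> for the Jucys-Murphy element \<open>x\<^sub>k\<close>, with a factor vanishing at \<open>u = c\<^sub>k\<close>. So the value \<open>E\<close>
  is a two-sided weight vector for the contents of \<open>T\<close>. Exchanging entries, \<open>E\<close> generates a left ideal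
  with a Young orthogonal basis \<open>e\<^sub>S\<close>, and the coefficient of the identity in \<open>e\<^sub>S\<close> vanishes for \<open>S \<noteq> T\<close>
  because the left and right weights of \<open>e\<^sub>S\<close> differ. Reading off this coefficient in \<open>h E\<close> gives the
  diagonal matrix element.\<close>

section \<open>The group algebra of signed permutations\<close>

text \<open>Regularity is claimed on the hook subspace, whereas the path on which only z_k moves
  leaves it, so agreement of the two limits has to be proved. Both are computed by one closed
  formula: in \<open>reg_fusR\<close> every singular factor is already cancelled against its
  partner, and the cancellation only uses that s_m acts by a sign on what stands to its right. On
  the hook subspace the sign comes from a coefficient 1 or -1 inside the product; on the path it
  comes from weights already established for smaller k. Cancellation and passage to the limit are
  therefore done once, the latter in a locale \<open>coef_limit\<close> whose notion of limit is a
  parameter. The path pushes u_k off the real axis: Jucys-Murphy elements are self-adjoint when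
  group elements are taken as orthonormal, so u - x_k is injective without any knowledge of the
  spectrum. The algebra is that of all signed permutations of the integers, so that one type serves
  every n; \<open>hyperoctahedral n\<close> and formal fractions are brought in only towards the
  end.\<close>

abbreviation (input) swap :: "'a \<Rightarrow> 'a \<Rightarrow> 'a \<Rightarrow> 'a" where "swap \<equiv> Transposition.transpose"
abbreviation (input) finv :: "('a \<Rightarrow> 'b) \<Rightarrow> 'b \<Rightarrow> 'a" where "finv \<equiv> Hilbert_Choice.inv"
abbreviation (input) keys :: "('a \<Rightarrow>\<^sub>0 'b::zero) \<Rightarrow> 'a set" where "keys \<equiv> Poly_Mapping.keys"
abbreviation (input) lookup :: "('a \<Rightarrow>\<^sub>0 'b::zero) \<Rightarrow> 'a \<Rightarrow> 'b" where "lookup \<equiv> Poly_Mapping.lookup"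

typedef sperm = "{g :: int \<Rightarrow> int. bij g \<and> (\<forall>x. g (- x) = - g x)}"
  morphisms app Sperm
  by (rule exI[of _ id]) simp

setup_lifting type_definition_sperm

text \<open>Composition is written additively because the convolution product of
  \<open>\<Rightarrow>\<^sub>0\<close> is formed over an additive structure of keys.
  \<open>group_add\<close> does not ask for commutativity, so the finitely supported functions on
  \<open>sperm\<close> form the noncommutative group algebra.\<close>

instantiation sperm :: group_add
begin

lift_definition zero_sperm :: sperm is id by simp
lift_definition plus_sperm :: "sperm \<Rightarrow> sperm \<Rightarrow> sperm" is "\<lambda>g h. g \<circ> h"
  by (auto simp: bij_comp)
lift_definition uminus_sperm :: "sperm \<Rightarrow> sperm" is "\<lambda>g. finv g"
proof -
  fix g :: "int \<Rightarrow> int" assume g: "bij g \<and> (\<forall>x. g (- x) = - g x)"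
  then have "finv g (- x) = - finv g x" for x
    by (metis bij_inv_eq_iff)
  with g show "bij (finv g) \<and> (\<forall>x. finv g (- x) = - finv g x)"
    by (simp add: bij_imp_bij_inv)
qed
definition minus_sperm :: "sperm \<Rightarrow> sperm \<Rightarrow> sperm" where "minus_sperm a b = a + (- b)"

instance
proof
  fix a b c :: sperm
  show "a + b + c = a + (b + c)" by transfer (simp add: comp_assoc)
  show "0 + a = a" by transfer simp
  show "a + 0 = a" by transfer simp
  show "- a + a = 0" by transfer (simp add: bij_def)
  show "a + - b = a - b" by (simp add: minus_sperm_def)
qed

end

lemma app_odd: "app g (- x) = - app g x"
  using app[of g] by simp

lemma app_plus [simp]: "app (g + h) x = app g (app h x)"
  by (simp add: plus_sperm.rep_eq)

lemma app_zero [simp]: "app 0 x = x"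
  by (simp add: zero_sperm.rep_eq)

lemma app_uminus_cancel [simp]: "app g (app (- g) x) = x" "app (- g) (app g x) = x"
  using app_plus[of g "- g" x] app_plus[of "- g" g x] by (simp_all del: app_plus)

lemma sperm_eqI: "(\<And>x. app g x = app h x) \<Longrightarrow> g = h"
  by (simp add: app_inject[symmetric] fun_eq_iff)

text \<open>If one letter were 0, both transpositions would move 0 and the composite would not be
  odd; hence the default \<open>id\<close>.\<close>

lift_definition swap_perm :: "nat \<Rightarrow> nat \<Rightarrow> sperm" is
  "\<lambda>a b. if a = 0 \<or> b = 0 then id else
     swap (int a) (int b) \<circ> swap (- int a) (- int b)"
  by (auto simp: bij_comp) (auto simp: Transposition.transpose_def)

lift_definition flip_perm :: "nat \<Rightarrow> sperm" is "\<lambda>a. swap (int a) (- int a)"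
  by (auto simp: Transposition.transpose_def)

lemma app_swap_perm: "a > 0 \<Longrightarrow> b > 0 \<Longrightarrow> app (swap_perm a b) x =
   (if x = int a then int b else if x = int b then int a
    else if x = - int a then - int b else if x = - int b then - int a else x)"
  by (auto simp: swap_perm.rep_eq Transposition.transpose_def)

lemma app_flip_perm: "app (flip_perm a) x = (if x = int a \<or> x = - int a then - x else x)"
  by (auto simp: flip_perm.rep_eq Transposition.transpose_def)

lemma app_swap_perm_int: "a > 0 \<Longrightarrow> b > 0 \<Longrightarrow> j > 0 \<Longrightarrow> app (swap_perm a b) (int j) = int (swap a b j)"
  by (simp add: app_swap_perm Transposition.transpose_def)

lemma sperm_eq_posI:
  assumes "\<And>j. j > 0 \<Longrightarrow> app g (int j) = app h (int j)"
  shows "g = h"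
proof (rule sperm_eqI)
  fix x
  have 0: "app g' 0 = 0" for g' using app_odd[of g' 0] by simp
  show "app g x = app h x"
  proof (cases x "0::int" rule: linorder_cases)
    case less
    then show ?thesis using assms[of "nat (- x)"] app_odd[of g x] app_odd[of h x] by simp
  qed (use assms[of "nat x"] 0 in simp_all)
qed

type_synonym galg = "sperm \<Rightarrow>\<^sub>0 complex"

abbreviation coef :: "galg \<Rightarrow> sperm \<Rightarrow> complex" where "coef \<equiv> lookup"
abbreviation gr :: "sperm \<Rightarrow> galg" where "gr g \<equiv> Poly_Mapping.single g 1"

lemma coef_single_mult:
  "lookup (Poly_Mapping.single h c * X) g = c * lookup X (- h + g)"
  for h :: "'g::group_add" and c :: "'c::comm_ring_1"
proof -
  have "(\<Sum>q. lookup X q when g = h + q) = lookup X (- h + g)" for h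
  proof -
    have "(g = h + q) = (- h + g = q)" for q
      by (metis add.assoc add.left_inverse add.right_inverse add_0)
    then show ?thesis by simp
  qed
  then show ?thesis
    by (simp add: lookup_mult lookup_single when_mult)
qed

lemma coef_mult_single:
  "lookup (X * Poly_Mapping.single h c) g = c * lookup X (g - h)"
  for h :: "'g::group_add" and c :: "'c::comm_ring_1"
proof -
  have "(\<Sum>q. c when h = q when g = l + q) = (c when g - h = l)" for l
  proof -
    have "(g = l + h) = (g - h = l)" by (metis add_diff_cancel diff_add_cancel)
    then have "(\<Sum>q. c when h = q when g = l + q) = (\<Sum>q. (c when g - h = l) when h = q)"
      by (intro Sum_any.cong) (auto simp: when_def)
    then show ?thesis by simp
  qed
  then show ?thesis
    by (simp add: lookup_mult lookup_single mult_when mult.commute)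
qed

definition smul :: "complex \<Rightarrow> galg \<Rightarrow> galg" (infixr \<open>\<cdot>\<close> 75) where
  "c \<cdot> X = Poly_Mapping.single 0 c * X"

lemma coef_smul [simp]: "coef (c \<cdot> X) g = c * coef X g"
  by (simp add: smul_def coef_single_mult)

interpretation av: vector_space smul
  by standard (auto intro!: poly_mapping_eqI simp: lookup_add algebra_simps)

lemma smul_mult_left [simp]: "(c \<cdot> X) * Y = c \<cdot> (X * Y)"
  by (simp add: smul_def mult.assoc)

lemma single_0_commute: "Poly_Mapping.single 0 c * X = X * Poly_Mapping.single 0 (c::complex)"
  for X :: galg
  by (rule poly_mapping_eqI) (simp add: coef_single_mult coef_mult_single)

lemma smul_mult_right [simp]: "X * (c \<cdot> Y) = c \<cdot> (X * Y)"
  by (metis smul_def mult.assoc single_0_commute)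

lemma gr_mult: "gr g * gr h = gr (g + h)"
  by (simp add: mult_single)

lemma coef_gr_mult [simp]: "coef (gr h * X) g = coef X (- h + g)"
  by (simp add: coef_single_mult)

lemma coef_mult_gr [simp]: "coef (X * gr h) g = coef X (g - h)"
  by (simp add: coef_mult_single)

lemma galg_expand: "X = (\<Sum>g\<in>keys X. coef X g \<cdot> gr g)"
  by (rule poly_mapping_eqI)
     (auto simp: lookup_sum lookup_single when_def in_keys_iff sum.delta' if_distrib cong: if_cong)

text \<open>The coefficient of the identity is a trace: gh = 1 exactly when hg = 1. Left and right
  weights of an element are compared through it.\<close>

lemma coef_0_commute: "coef (X * Y) 0 = coef (Y * X) 0"
proof -
  have 1: "coef (gr g * Y) 0 = coef (Y * gr g) 0" for g Y by simp
  have "coef (X * Y) 0 = (\<Sum>g\<in>keys X. coef X g * coef (gr g * Y) 0)"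
    by (subst galg_expand[of X]) (simp add: sum_distrib_right lookup_sum del: coef_gr_mult)
  also have "\<dots> = coef (Y * X) 0"
    by (subst (2) galg_expand[of X]) (simp add: sum_distrib_left lookup_sum 1 del: coef_gr_mult coef_mult_gr)
  finally show ?thesis .
qed

section \<open>Transpositions and sign changes in the group algebra\<close>

definition sg :: "nat \<Rightarrow> nat \<Rightarrow> galg" where "sg a b = gr (swap_perm a b)"
definition tau :: "nat \<Rightarrow> galg" where "tau a = gr (flip_perm a)"

lemma swap_perm_rels:
  "a > 0 \<Longrightarrow> b > 0 \<Longrightarrow> swap_perm a b = swap_perm b a"
  "a > 0 \<Longrightarrow> b > 0 \<Longrightarrow> swap_perm a b + swap_perm a b = 0"
  "a > 0 \<Longrightarrow> b > 0 \<Longrightarrow> c > 0 \<Longrightarrow> d > 0 \<Longrightarrow> {a, b} \<inter> {c, d} = {} \<Longrightarrow> swap_perm a b + swap_perm c d = swap_perm c d + swap_perm a b"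
  "a > 0 \<Longrightarrow> b > 0 \<Longrightarrow> c > 0 \<Longrightarrow> a \<noteq> c \<Longrightarrow> b \<noteq> c \<Longrightarrow> swap_perm a b + swap_perm b c = swap_perm a c + swap_perm a b"
  "flip_perm a + flip_perm a = 0"
  "flip_perm a + flip_perm b = flip_perm b + flip_perm a"
  "a > 0 \<Longrightarrow> b > 0 \<Longrightarrow> flip_perm a + swap_perm a b = swap_perm a b + flip_perm b"
  "a > 0 \<Longrightarrow> b > 0 \<Longrightarrow> c \<noteq> a \<Longrightarrow> c \<noteq> b \<Longrightarrow> flip_perm c + swap_perm a b = swap_perm a b + flip_perm c"
  by (rule sperm_eq_posI; force simp: app_swap_perm_int app_flip_perm app_odd Transposition.transpose_def)+

lemma sg_commute: "a > 0 \<Longrightarrow> b > 0 \<Longrightarrow> sg a b = sg b a"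
  using swap_perm_rels(1) by (simp add: sg_def)

lemma sg_sq: "a > 0 \<Longrightarrow> b > 0 \<Longrightarrow> sg a b * sg a b = 1"
  by (simp add: sg_def gr_mult swap_perm_rels)

lemma sg_disjoint: "a > 0 \<Longrightarrow> b > 0 \<Longrightarrow> c > 0 \<Longrightarrow> d > 0 \<Longrightarrow> {a, b} \<inter> {c, d} = {} \<Longrightarrow>
    sg a b * sg c d = sg c d * sg a b"
  using swap_perm_rels(3)[of a b c d] by (simp add: sg_def gr_mult)

lemma sg_conj: "a > 0 \<Longrightarrow> b > 0 \<Longrightarrow> c > 0 \<Longrightarrow> a \<noteq> c \<Longrightarrow> b \<noteq> c \<Longrightarrow>
    sg a b * sg b c = sg a c * sg a b"
  by (simp add: sg_def gr_mult swap_perm_rels(4)[of a b c])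

lemma tau_sq: "tau a * tau a = 1"
  by (simp add: tau_def gr_mult swap_perm_rels)

lemma tau_commute: "tau a * tau b = tau b * tau a"
  using swap_perm_rels(6)[of a b] by (simp add: tau_def gr_mult)

lemma tau_sg: "a > 0 \<Longrightarrow> b > 0 \<Longrightarrow> tau a * sg a b = sg a b * tau b"
  by (simp add: tau_def sg_def gr_mult swap_perm_rels(7))

lemma tau_sg2: "a > 0 \<Longrightarrow> b > 0 \<Longrightarrow> tau b * sg a b = sg a b * tau a"
  using tau_sg[of b a] sg_commute[of a b] by simp

lemma tau_sg_disjoint: "a > 0 \<Longrightarrow> b > 0 \<Longrightarrow> c \<noteq> a \<Longrightarrow> c \<noteq> b \<Longrightarrow> tau c * sg a b = sg a b * tau c"
  using swap_perm_rels(8)[of a b c] by (simp add: tau_def sg_def gr_mult)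

section \<open>The Yang-Baxter equation\<close>

lemmas galg_simps = distrib_left distrib_right left_diff_distrib right_diff_distrib
  av.scale_right_distrib av.scale_left_distrib av.scale_right_diff_distrib av.scale_left_diff_distrib

text \<open>The k-th factor of the fusion product once its generators s_1, ..., s_(k-1) and its sign
  factor have been moved out: only transpositions (m, k) remain, the largest m on the left. It is
  called row k below.\<close>

primrec phi :: "(nat \<Rightarrow> nat \<Rightarrow> complex) \<Rightarrow> nat \<Rightarrow> nat \<Rightarrow> galg" where
  "phi \<alpha> k 0 = 1"
| "phi \<alpha> k (Suc j) = (1 + \<alpha> (Suc j) k \<cdot> sg (Suc j) k) * phi \<alpha> k j"

primrec fusR :: "(nat \<Rightarrow> nat \<Rightarrow> complex) \<Rightarrow> nat \<Rightarrow> galg" where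
  "fusR \<alpha> 0 = 1"
| "fusR \<alpha> (Suc k) = phi \<alpha> (Suc k) k * fusR \<alpha> k"

text \<open>The identities between the numbers 1 / (u_j - u_i), in a form free of division. They
  survive when entries for letters of different components are replaced by 0, so that both
  components can be treated in one product.\<close>

definition yang_baxter :: "nat \<Rightarrow> (nat \<Rightarrow> nat \<Rightarrow> complex) \<Rightarrow> bool" where
  "yang_baxter N \<alpha> \<longleftrightarrow> (\<forall>i\<in>{1..N}. \<forall>j\<in>{1..N}. i \<noteq> j \<longrightarrow> \<alpha> j i = - \<alpha> i j \<and>
     (\<forall>k\<in>{1..N}. k \<noteq> i \<and> k \<noteq> j \<longrightarrow> \<alpha> i j * \<alpha> j k = \<alpha> i k * (\<alpha> i j + \<alpha> j k)))"

definition swap_alpha :: "nat \<Rightarrow> (nat \<Rightarrow> nat \<Rightarrow> complex) \<Rightarrow> nat \<Rightarrow> nat \<Rightarrow> complex" where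
  "swap_alpha i \<alpha> m k = \<alpha> (swap i (Suc i) m) (swap i (Suc i) k)"

lemma yang_baxter_antisym: "yang_baxter N \<alpha> \<Longrightarrow> i \<in> {1..N} \<Longrightarrow> j \<in> {1..N} \<Longrightarrow> i \<noteq> j \<Longrightarrow> \<alpha> j i = - \<alpha> i j"
  unfolding yang_baxter_def by blast

lemma yang_baxter_triple: "yang_baxter N \<alpha> \<Longrightarrow> i \<in> {1..N} \<Longrightarrow> j \<in> {1..N} \<Longrightarrow> k \<in> {1..N} \<Longrightarrow>
    i \<noteq> j \<Longrightarrow> k \<noteq> i \<Longrightarrow> k \<noteq> j \<Longrightarrow> \<alpha> i j * \<alpha> j k = \<alpha> i k * (\<alpha> i j + \<alpha> j k)"
  unfolding yang_baxter_def by blast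

lemma yang_baxter_swap_alpha:
  assumes "yang_baxter N \<alpha>" "1 \<le> i" "i < N"
  shows "yang_baxter N (swap_alpha i \<alpha>)"
proof -
  define s where "s = swap i (Suc i)"
  have s: "s m \<in> {1..N}" if "m \<in> {1..N}" for m
    using assms that by (auto simp: s_def Transposition.transpose_def)
  have s2: "s m \<noteq> s m'" if "m \<noteq> m'" for m m'
    using that by (auto simp: s_def Transposition.transpose_def)
  show ?thesis
    unfolding yang_baxter_def swap_alpha_def s_def[symmetric]
    by (intro ballI impI conjI yang_baxter_antisym[OF assms(1)] yang_baxter_triple[OF assms(1)] s s2) auto
qed

lemma mult_pass:
  fixes s :: "'a::semigroup_mult"
  assumes "s * A = A' * s'" "s' * B = B' * s''"
  shows "s * (A * B) = (A' * B') * s''"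
  by (metis assms mult.assoc)

text \<open>With s = (i, i+1), x = (i, k), y = (i+1, k) the two sides agree term by term except at x
  and y, and there the last hypothesis is exactly what is needed. In this form s + a moves through
  the pair and exchanges its coefficients.\<close>

lemma ybe_general:
  fixes s x y :: galg
  assumes "s * s = 1" "s * y = x * s" "s * x = y * s" "y * x = x * s" "b * c = a * (c - b)"
  shows "(s + a \<cdot> 1) * ((1 + b \<cdot> y) * (1 + c \<cdot> x)) = (1 + c \<cdot> y) * ((1 + b \<cdot> x) * (s + a \<cdot> 1))"
proof -
  have w: "s * (x * s) = y" using assms(1,3) by (metis mult.assoc mult.right_neutral)
  have w2: "y * (x * s) = x" using assms(1,4) by (metis mult.assoc mult.right_neutral)
  have e: "b * a * Y + (c * a * X + c * b * Y) = b * c * X + (a * c * Y + a * b * X)" for X Y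
    using assms(5) by algebra
  show ?thesis
    by (simp add: distrib_left distrib_right av.scale_right_distrib mult.assoc w w2 assms(2,3,4),
        rule poly_mapping_eqI, simp add: lookup_add e)
qed

text \<open>The order-reversing form for the same three transpositions; here the last hypothesis
  equates the coefficients of the two three-cycles x s and y s.\<close>

lemma ybe_general':
  fixes s x y :: galg
  assumes "s * s = 1" "s * y = x * s" "s * x = y * s" "y * x = x * s" "x * y = y * s" "c * b = a * (c - b)"
  shows "(1 + a \<cdot> s) * ((1 + b \<cdot> y) * (1 + c \<cdot> x)) = (1 + c \<cdot> x) * ((1 + b \<cdot> y) * (1 + a \<cdot> s))"
proof -
  have w: "s * (x * s) = y" using assms(1,3) by (metis mult.assoc mult.right_neutral)
  have w2: "x * (y * s) = y * (s * s)" using assms(5) by (metis mult.assoc)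
  have e: "b * a * U + (c * a * V + (c * b * U + c * (b * a) * Y))
      = b * c * V + (a * c * U + (a * b * V + a * (b * c) * Y))" for U V Y
    using assms(6) by algebra
  show ?thesis
    by (simp add: distrib_left distrib_right av.scale_right_distrib mult.assoc w w2 assms(1-5),
        rule poly_mapping_eqI, simp add: lookup_add e)
qed

lemma phi_cong: "(\<And>m. 1 \<le> m \<Longrightarrow> m \<le> j \<Longrightarrow> \<alpha> m k = \<beta> m k) \<Longrightarrow> phi \<alpha> k j = phi \<beta> k j"
  by (induction j) auto

lemma phi_commute:
  assumes "\<And>m. 1 \<le> m \<Longrightarrow> m \<le> j \<Longrightarrow> Y * sg m k = sg m k * Y"
  shows "Y * phi \<alpha> k j = phi \<alpha> k j * Y"
  using assms
proof (induction j)
  case (Suc j)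
  have "Y * phi \<alpha> k (Suc j) = (1 + \<alpha> (Suc j) k \<cdot> sg (Suc j) k) * (Y * phi \<alpha> k j)"
    using Suc.prems[of "Suc j"]
    by (simp add: distrib_left distrib_right mult.assoc[symmetric])
  then show ?case using Suc by (simp add: mult.assoc)
qed simp

lemma fusR_cong:
  "(\<And>m k. 1 \<le> m \<Longrightarrow> m < k \<Longrightarrow> k \<le> N \<Longrightarrow> \<alpha> m k = \<beta> m k) \<Longrightarrow> fusR \<alpha> N = fusR \<beta> N"
proof (induction N)
  case (Suc N)
  then have "phi \<alpha> (Suc N) N = phi \<beta> (Suc N) N" by (intro phi_cong) auto
  with Suc show ?case by simp
qed simp

lemma fusR_commute:
  assumes "\<And>m k. 1 \<le> m \<Longrightarrow> m < k \<Longrightarrow> k \<le> N \<Longrightarrow> Y * sg m k = sg m k * Y"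
  shows "Y * fusR \<alpha> N = fusR \<alpha> N * Y"
  using assms
proof (induction N)
  case (Suc N)
  have "Y * phi \<alpha> (Suc N) N = phi \<alpha> (Suc N) N * Y" by (rule phi_commute) (use Suc in auto)
  then show ?case unfolding fusR.simps by (rule mult_pass) (use Suc in simp)
qed simp

text \<open>Factors (m, k) with m different from i and i+1 commute with s_i, so the Yang-Baxter
  equation is needed only for the neighbouring pair; \<open>Suc i \<le> j\<close> ensures that the
  pair is complete.\<close>

lemma phi_intertwine:
  assumes "yang_baxter N \<alpha>" "1 \<le> i" "Suc i < k" "k \<le> N" "Suc i \<le> j" "j < k"
  shows "(sg i (Suc i) + \<alpha> (Suc i) i \<cdot> 1) * phi \<alpha> k j
       = phi (swap_alpha i \<alpha>) k j * (sg i (Suc i) + \<alpha> (Suc i) i \<cdot> 1)"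
  using assms(5,6)
proof (induction j)
  case (Suc j)
  let ?s = "sg i (Suc i)" and ?a = "\<alpha> (Suc i) i"
  show ?case
  proof (cases "j = i")
    case True
    obtain i0 where i: "i = Suc i0" using assms(2) by (cases i) auto
    have c: "?s * phi \<alpha> k i0 = phi \<alpha> k i0 * ?s"
      by (rule phi_commute) (use assms i in \<open>auto intro!: sg_disjoint\<close>)
    have c2: "phi \<alpha> k i0 = phi (swap_alpha i \<alpha>) k i0"
      by (rule phi_cong) (use assms i in \<open>auto simp: swap_alpha_def Transposition.transpose_def\<close>)
    have "(?s + ?a \<cdot> 1) * ((1 + \<alpha> (Suc i) k \<cdot> sg (Suc i) k) * (1 + \<alpha> i k \<cdot> sg i k))
       = (1 + \<alpha> i k \<cdot> sg (Suc i) k) * ((1 + \<alpha> (Suc i) k \<cdot> sg i k) * (?s + ?a \<cdot> 1))"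
    proof (rule ybe_general)
      show "?s * ?s = 1" using assms by (simp add: sg_sq)
      show h1: "?s * sg (Suc i) k = sg i k * ?s" using assms by (intro sg_conj) auto
      show "?s * sg i k = sg (Suc i) k * ?s"
        using assms sg_conj[of "Suc i" i k] sg_commute[of i "Suc i"] by simp
      show "sg (Suc i) k * sg i k = sg i k * ?s"
      proof -
        have "sg (Suc i) k * sg k i = sg (Suc i) i * sg (Suc i) k"
          using assms by (intro sg_conj) auto
        then show ?thesis
          using h1 sg_commute[of i k] sg_commute[of i "Suc i"] assms by simp
      qed
      show "\<alpha> (Suc i) k * \<alpha> i k = ?a * (\<alpha> i k - \<alpha> (Suc i) k)"
        using yang_baxter_triple[OF assms(1), of "Suc i" i k] assms by (simp add: algebra_simps)
    qed
    moreover have "swap_alpha i \<alpha> (Suc i) k = \<alpha> i k" "swap_alpha i \<alpha> i k = \<alpha> (Suc i) k"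
      using assms by (auto simp: swap_alpha_def Transposition.transpose_def)
    ultimately show ?thesis
      using True i c c2
      by (simp add: mult.assoc[symmetric]) (simp add: mult.assoc distrib_left distrib_right)
  next
    case False
    then have j: "Suc i \<le> j" "j < k" using Suc by auto
    have c: "?s * sg (Suc j) k = sg (Suc j) k * ?s"
      using assms j Suc.prems by (intro sg_disjoint) auto
    have "swap_alpha i \<alpha> (Suc j) k = \<alpha> (Suc j) k"
      using assms j by (auto simp: swap_alpha_def Transposition.transpose_def)
    moreover have "(?s + ?a \<cdot> 1) * (1 + \<alpha> (Suc j) k \<cdot> sg (Suc j) k)
        = (1 + \<alpha> (Suc j) k \<cdot> sg (Suc j) k) * (?s + ?a \<cdot> 1)"
      using c by (simp add: distrib_left distrib_right av.scale_right_distrib add_ac mult.commute)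
    ultimately show ?thesis
      unfolding phi.simps by (intro mult_pass[OF _ Suc.IH[OF j]]) simp
  qed
qed simp

lemma phi_shift_up:
  assumes "j < i"
  shows "sg i (Suc i) * phi \<alpha> i j = phi (swap_alpha i \<alpha>) (Suc i) j * sg i (Suc i)"
  using assms
proof (induction j)
  case (Suc j)
  have c: "sg i (Suc i) * sg (Suc j) i = sg (Suc j) (Suc i) * sg i (Suc i)"
    using Suc.prems sg_conj[of "Suc i" i "Suc j"] by (simp add: sg_commute)
  have "swap_alpha i \<alpha> (Suc j) (Suc i) = \<alpha> (Suc j) i"
    using Suc.prems by (simp add: swap_alpha_def Transposition.transpose_def)
  then have "sg i (Suc i) * (1 + \<alpha> (Suc j) i \<cdot> sg (Suc j) i) =
      (1 + swap_alpha i \<alpha> (Suc j) (Suc i) \<cdot> sg (Suc j) (Suc i)) * sg i (Suc i)"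
    using c by (simp add: distrib_left distrib_right)
  then show ?case unfolding phi.simps by (rule mult_pass) (use Suc in simp)
qed simp

lemma phi_shift_down:
  assumes "j < i"
  shows "sg i (Suc i) * phi \<alpha> (Suc i) j = phi (swap_alpha i \<alpha>) i j * sg i (Suc i)"
  using assms
proof (induction j)
  case (Suc j)
  have c: "sg i (Suc i) * sg (Suc j) (Suc i) = sg (Suc j) i * sg i (Suc i)"
    using Suc.prems sg_conj[of i "Suc i" "Suc j"] by (simp add: sg_commute)
  have "swap_alpha i \<alpha> (Suc j) i = \<alpha> (Suc j) (Suc i)"
    using Suc.prems by (simp add: swap_alpha_def Transposition.transpose_def)
  then have "sg i (Suc i) * (1 + \<alpha> (Suc j) (Suc i) \<cdot> sg (Suc j) (Suc i)) =
      (1 + swap_alpha i \<alpha> (Suc j) i \<cdot> sg (Suc j) i) * sg i (Suc i)"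
    using c by (simp add: distrib_left distrib_right)
  then show ?case unfolding phi.simps by (rule mult_pass) (use Suc in simp)
qed simp

text \<open>Rows i and i+1 are exchanged one index m at a time: the pair (m, i), (m, i+1) is
  reversed by the Yang-Baxter equation, and factors from different rows with different m have no
  letter in common.\<close>

lemma phi_exchange:
  assumes "yang_baxter N \<alpha>" "1 \<le> i" "i < N" "j < i"
  shows "(1 + \<alpha> i (Suc i) \<cdot> sg i (Suc i)) * (phi \<alpha> (Suc i) j * phi \<alpha> i j)
       = phi \<alpha> i j * (phi \<alpha> (Suc i) j * (1 + \<alpha> i (Suc i) \<cdot> sg i (Suc i)))"
  using assms(4)
proof (induction j)
  case (Suc j)
  let ?k = "Suc j" and ?s = "sg i (Suc i)"
  let ?x = "1 + \<alpha> ?k i \<cdot> sg ?k i" and ?y = "1 + \<alpha> ?k (Suc i) \<cdot> sg ?k (Suc i)"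
    and ?b = "1 + \<alpha> i (Suc i) \<cdot> sg i (Suc i)"
  have yx: "?b * (?y * ?x) = ?x * (?y * ?b)"
  proof (rule ybe_general')
    show "?s * ?s = 1" using assms by (simp add: sg_sq)
    show sy: "?s * sg ?k (Suc i) = sg ?k i * ?s"
      using Suc.prems sg_conj[of i "Suc i" "Suc j"] by (simp add: sg_commute)
    show sx: "?s * sg ?k i = sg ?k (Suc i) * ?s"
      using Suc.prems sg_conj[of "Suc i" i "Suc j"] by (simp add: sg_commute)
    show "sg ?k (Suc i) * sg ?k i = sg ?k i * ?s"
      using Suc.prems sg_conj[of "Suc i" ?k i] sy by (simp add: sg_commute)
    show "sg ?k i * sg ?k (Suc i) = sg ?k (Suc i) * ?s"
      using Suc.prems sg_conj[of i ?k "Suc i"] sx by (simp add: sg_commute)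
    show "\<alpha> ?k i * \<alpha> ?k (Suc i) = \<alpha> i (Suc i) * (\<alpha> ?k i - \<alpha> ?k (Suc i))"
      using yang_baxter_triple[OF assms(1), of ?k i "Suc i"] Suc.prems assms by (simp add: algebra_simps)
  qed
  have c: "sg ?k i * phi \<alpha> (Suc i) j = phi \<alpha> (Suc i) j * sg ?k i"
    by (rule phi_commute) (use Suc.prems in \<open>auto intro!: sg_disjoint\<close>)
  have c1: "?x * phi \<alpha> (Suc i) j = phi \<alpha> (Suc i) j * ?x"
    using c by (simp add: distrib_left distrib_right)
  have c': "sg ?k (Suc i) * phi \<alpha> i j = phi \<alpha> i j * sg ?k (Suc i)"
    by (rule phi_commute) (use Suc.prems in \<open>auto intro!: sg_disjoint\<close>)
  have c2: "?y * phi \<alpha> i j = phi \<alpha> i j * ?y"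
    using c' by (simp add: distrib_left distrib_right)
  have IH: "?b * (phi \<alpha> (Suc i) j * phi \<alpha> i j) = phi \<alpha> i j * (phi \<alpha> (Suc i) j * ?b)"
    using Suc by simp
  have "?b * (phi \<alpha> (Suc i) ?k * phi \<alpha> i ?k) = ?b * (?y * (phi \<alpha> (Suc i) j * ?x) * phi \<alpha> i j)"
    by (simp add: mult.assoc)
  also have "\<dots> = (?b * (?y * ?x)) * (phi \<alpha> (Suc i) j * phi \<alpha> i j)"
    by (simp only: c1[symmetric] mult.assoc)
  also have "\<dots> = ?x * (?y * (?b * (phi \<alpha> (Suc i) j * phi \<alpha> i j)))"
    by (simp only: yx mult.assoc)
  also have "\<dots> = ?x * ((?y * phi \<alpha> i j) * (phi \<alpha> (Suc i) j * ?b))"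
    by (simp only: IH mult.assoc)
  also have "\<dots> = phi \<alpha> i ?k * (phi \<alpha> (Suc i) ?k * ?b)"
    by (simp only: c2 mult.assoc phi.simps)
  finally show ?case .
qed simp

text \<open>Rows above i+1 are crossed by \<open>phi_intertwine\<close>. Row i+1 begins with 1 - a
  s_i, and (s_i + a)(1 - a s_i) = (1 - a^2) s_i, so what remains is conjugation of rows i and i+1 by
  s_i. The scalar 1 - a^2 vanishes only for a = 1 or a = -1.\<close>

theorem fusR_conj:
  assumes "yang_baxter N \<alpha>" "1 \<le> i" "i < k" "k \<le> N"
  defines "a \<equiv> \<alpha> (Suc i) i"
  shows "(sg i (Suc i) + a \<cdot> 1) * fusR \<alpha> k * (sg i (Suc i) + a \<cdot> 1) = (1 - a\<^sup>2) \<cdot> fusR (swap_alpha i \<alpha>) k"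
  using assms(3,4)
proof (induction k)
  case (Suc k)
  let ?s = "sg i (Suc i)" and ?\<beta> = "swap_alpha i \<alpha>"
  have ss: "?s * ?s = 1" using assms by (simp add: sg_sq)
  show ?case
  proof (cases "k = i")
    case True
    obtain j where i: "i = Suc j" using assms(2) by (cases i) auto
    have ab: "\<alpha> i (Suc i) = - a"
      using yang_baxter_antisym[OF assms(1), of "Suc i" i] assms Suc.prems True by simp
    have ba: "?\<beta> i (Suc i) = a" by (simp add: swap_alpha_def a_def)
    have 1: "(?s + a \<cdot> 1) * (1 + \<alpha> i (Suc i) \<cdot> ?s) = (1 - a\<^sup>2) \<cdot> ?s"
      by (simp add: galg_simps ab ss power2_eq_square)
    have 2: "?s * (?s + a \<cdot> 1) = 1 + a \<cdot> ?s" by (simp add: distrib_left ss)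
    have c: "?s * fusR \<alpha> j = fusR \<alpha> j * ?s"
      by (rule fusR_commute) (use i in \<open>auto intro!: sg_disjoint\<close>)
    have c1: "fusR \<alpha> j * (?s + a \<cdot> 1) = (?s + a \<cdot> 1) * fusR \<alpha> j"
      using c by (simp add: distrib_left distrib_right)
    have R: "fusR \<alpha> j = fusR ?\<beta> j"
      by (rule fusR_cong) (use i in \<open>auto simp: swap_alpha_def Transposition.transpose_def\<close>)
    have "(?s + a \<cdot> 1) * fusR \<alpha> (Suc i) * (?s + a \<cdot> 1)
        = ((?s + a \<cdot> 1) * (1 + \<alpha> i (Suc i) \<cdot> ?s)) * (phi \<alpha> (Suc i) j * (phi \<alpha> i j * (fusR \<alpha> j * (?s + a \<cdot> 1))))"
      using i by (simp add: mult.assoc)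
    also have "\<dots> = (1 - a\<^sup>2) \<cdot> ((?s * phi \<alpha> (Suc i) j) * (phi \<alpha> i j * ((?s + a \<cdot> 1) * fusR \<alpha> j)))"
      by (simp only: 1 c1 smul_mult_left mult.assoc)
    also have "\<dots> = (1 - a\<^sup>2) \<cdot> (phi ?\<beta> i j * ((?s * phi \<alpha> i j) * ((?s + a \<cdot> 1) * fusR \<alpha> j)))"
      using phi_shift_down[of j i \<alpha>] i by (simp only: mult.assoc lessI)
    also have "\<dots> = (1 - a\<^sup>2) \<cdot> (phi ?\<beta> i j * (phi ?\<beta> (Suc i) j * ((?s * (?s + a \<cdot> 1)) * fusR \<alpha> j)))"
      using phi_shift_up[of j i \<alpha>] i by (simp only: mult.assoc lessI)
    also have "\<dots> = (1 - a\<^sup>2) \<cdot> ((phi ?\<beta> i j * (phi ?\<beta> (Suc i) j * (1 + ?\<beta> i (Suc i) \<cdot> ?s))) * fusR \<alpha> j)"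
      by (simp only: 2 ba mult.assoc)
    \<comment> \<open>After conjugation row i stands to the left of row i+1, so the two rows are
      exchanged once more, now with the swapped coefficients.\<close>
    also have "phi ?\<beta> i j * (phi ?\<beta> (Suc i) j * (1 + ?\<beta> i (Suc i) \<cdot> ?s))
        = (1 + ?\<beta> i (Suc i) \<cdot> ?s) * (phi ?\<beta> (Suc i) j * phi ?\<beta> i j)"
      by (rule phi_exchange[OF yang_baxter_swap_alpha[OF assms(1,2)], symmetric]) (use assms Suc.prems True i in auto)
    also have "\<dots> * fusR \<alpha> j = fusR ?\<beta> (Suc i)"
      using i R by (simp add: mult.assoc)
    finally show ?thesis using True by simp
  next
    case False
    then have k: "i < k" "k \<le> N" using Suc.prems by auto
    have "(?s + a \<cdot> 1) * fusR \<alpha> (Suc k) * (?s + a \<cdot> 1)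
       = ((?s + a \<cdot> 1) * phi \<alpha> (Suc k) k) * fusR \<alpha> k * (?s + a \<cdot> 1)"
      by (simp add: mult.assoc)
    also have "(?s + a \<cdot> 1) * phi \<alpha> (Suc k) k = phi ?\<beta> (Suc k) k * (?s + a \<cdot> 1)"
      unfolding a_def by (rule phi_intertwine[OF assms(1,2)]) (use k Suc.prems in auto)
    finally show ?thesis using Suc.IH[OF k] by (simp add: mult.assoc)
  qed
qed simp

text \<open>Row i+1 begins with 1 + e s_i, on which s_i acts by e. Later rows are crossed by s_i -
  e, which then annihilates everything to their right.\<close>

lemma fusR_eigen:
  assumes "yang_baxter N \<alpha>" "1 \<le> i" "i < k" "k \<le> N" "\<alpha> i (Suc i) = e" "e * e = 1"
  shows "sg i (Suc i) * fusR \<alpha> k = e \<cdot> fusR \<alpha> k"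
  using assms(3,4)
proof (induction k)
  case (Suc k)
  let ?s = "sg i (Suc i)"
  show ?case
  proof (cases "k = i")
    case True
    obtain j where i: "i = Suc j" using assms(2) by (cases i) auto
    have "?s * (1 + e \<cdot> ?s) = e \<cdot> (1 + e \<cdot> ?s)"
      using assms by (simp add: distrib_left sg_sq av.scale_right_distrib add.commute)
    then show ?thesis
      using True i assms(5) by (simp add: mult.assoc[symmetric])
  next
    case False
    then have k: "i < k" "k \<le> N" using Suc.prems by auto
    have a: "\<alpha> (Suc i) i = - e" using yang_baxter_antisym[OF assms(1), of i "Suc i"] assms k by simp
    have "(?s + (- e) \<cdot> 1) * phi \<alpha> (Suc k) k = phi (swap_alpha i \<alpha>) (Suc k) k * (?s + (- e) \<cdot> 1)"
      using phi_intertwine[OF assms(1,2), of "Suc k" k] k Suc.prems a by simp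
    then have "(?s + (- e) \<cdot> 1) * fusR \<alpha> (Suc k) = phi (swap_alpha i \<alpha>) (Suc k) k * ((?s + (- e) \<cdot> 1) * fusR \<alpha> k)"
      by (simp add: mult.assoc[symmetric])
    also have "(?s + (- e) \<cdot> 1) * fusR \<alpha> k = 0"
      using Suc.IH[OF k] by (simp add: left_diff_distrib)
    finally show ?thesis by (simp add: left_diff_distrib)
  qed
qed simp

section \<open>Jucys-Murphy elements\<close>

text \<open>The projector (1 + tau_m tau_k) / 2 keeps the part on which the letters m and k carry
  the same sign. The sums \<open>jm k\<close> are the Jucys-Murphy elements of the hyperoctahedral
  group, halved so that their eigenvalues are contents and not twice the contents.\<close>

definition jm_summand :: "nat \<Rightarrow> nat \<Rightarrow> galg" where
  "jm_summand m k = (1 / 2) \<cdot> ((1 + tau m * tau k) * sg m k)"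

definition jm :: "nat \<Rightarrow> galg" where
  "jm k = (\<Sum>m\<in>{1..<k}. jm_summand m k)"

lemma sg_tau_transpose:
  assumes "a > 0" "b > 0"
  shows "sg a b * tau m = tau (swap a b m) * sg a b"
  using assms tau_sg[of a b] tau_sg2[of a b] tau_sg_disjoint[of a b m]
  by (auto simp: Transposition.transpose_def)

lemma sg_sg_transpose:
  assumes "a > 0" "b > 0" "m > 0" "k > 0" "k \<noteq> a" "k \<noteq> b" "m \<noteq> k"
  shows "sg a b * sg m k = sg (swap a b m) k * sg a b"
proof -
  consider "m = a" | "m = b" | "m \<noteq> a" "m \<noteq> b" by blast
  then show ?thesis
  proof cases
    case 1
    then show ?thesis using assms sg_conj[of b a k]
      by (cases "a = b") (auto simp: sg_commute Transposition.transpose_def)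
  next
    case 2
    then show ?thesis using assms sg_conj[of a b k] by (auto simp: Transposition.transpose_def)
  next
    case 3
    then show ?thesis using assms sg_disjoint[of a b m k] by (auto simp: Transposition.transpose_def)
  qed
qed

lemma sg_jm_summand:
  assumes "a > 0" "b > 0" "m > 0" "k > 0" "k \<noteq> a" "k \<noteq> b" "m \<noteq> k"
  shows "sg a b * jm_summand m k = jm_summand (swap a b m) k * sg a b"
proof -
  let ?m = "swap a b m"
  have k: "swap a b k = k" using assms by (simp add: Transposition.transpose_def)
  have "sg a b * ((1 + tau m * tau k) * sg m k) = ((1 + tau ?m * tau k) * sg ?m k) * sg a b"
  proof (rule mult_pass)
    show "sg a b * (1 + tau m * tau k) = (1 + tau ?m * tau k) * sg a b"
      using mult_pass[OF sg_tau_transpose[OF assms(1,2), of m] sg_tau_transpose[OF assms(1,2), of k]] k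
      by (simp add: distrib_left distrib_right)
    show "sg a b * sg m k = sg ?m k * sg a b" by (rule sg_sg_transpose) fact+
  qed
  then show ?thesis by (simp add: jm_summand_def)
qed

lemma jm_sg:
  assumes "1 \<le> a" "1 \<le> b" "a < k" "b < k"
  shows "jm k * sg a b = sg a b * jm k"
proof -
  let ?t = "swap a b"
  have "sg a b * jm k = (\<Sum>m\<in>{1..<k}. jm_summand (?t m) k * sg a b)"
    unfolding jm_def sum_distrib_left by (rule sum.cong) (use assms in \<open>auto intro!: sg_jm_summand\<close>)
  also have "\<dots> = (\<Sum>m\<in>{1..<k}. jm_summand m k * sg a b)"
  proof (rule sum.reindex_bij_betw[of ?t])
    have "?t ` {1..<k} \<subseteq> {1..<k}" using assms by (auto simp: Transposition.transpose_def)
    then show "bij_betw ?t {1..<k} {1..<k}"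
      by (intro bij_betw_imageI endo_inj_surj) auto
  qed
  finally show ?thesis by (simp add: jm_def sum_distrib_right)
qed

text \<open>Moving a sign change past (m, k) interchanges tau_m and tau_k, and the projector does
  not distinguish the two.\<close>

lemma jm_tau:
  assumes "1 \<le> k"
  shows "jm k * tau a = tau a * jm k"
proof -
  have "jm_summand m k * tau a = tau a * jm_summand m k" if m: "m \<in> {1..<k}" for m
  proof -
    let ?P = "1 + tau m * tau k"
    have t: "?P * tau x = tau x * ?P" for x
      by (simp add: distrib_left distrib_right) (metis mult.assoc tau_commute)
    have t2: "?P * tau m = ?P * tau k"
      using tau_commute[of k m] tau_sq
      by (simp add: distrib_right) (metis add.commute mult.assoc mult.right_neutral)
    have "sg m k * tau a = tau (swap m k a) * sg m k"
      using m by (intro sg_tau_transpose) auto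
    moreover have "?P * tau (swap m k a) = ?P * tau a"
      using t2 by (auto simp: Transposition.transpose_def)
    ultimately have "(?P * sg m k) * tau a = (?P * tau a) * sg m k"
      by (simp only: mult.assoc) (simp only: mult.assoc[symmetric])
    then have "(?P * sg m k) * tau a = tau a * (?P * sg m k)"
      by (simp only: t mult.assoc)
    then show ?thesis by (simp add: jm_summand_def)
  qed
  then show ?thesis by (simp add: jm_def sum_distrib_left sum_distrib_right)
qed

lemma jm_jm_less:
  assumes "1 \<le> m" "m < k"
  shows "jm m * jm k = jm k * jm m"
proof -
  have "jm_summand l m * jm k = jm k * jm_summand l m" if "l \<in> {1..<m}" for l
  proof -
    have s: "jm k * sg l m = sg l m * jm k" using that assms by (intro jm_sg) auto
    have t: "jm k * tau x = tau x * jm k" for x using assms by (intro jm_tau) simp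
    have intertwiner: "jm k * (tau l * tau m) = (tau l * tau m) * jm k"
      by (rule mult_pass) (rule t)+
    have "jm k * ((1 + tau l * tau m) * sg l m) = ((1 + tau l * tau m) * sg l m) * jm k"
      by (rule mult_pass[OF _ s]) (simp add: distrib_left distrib_right intertwiner)
    then show ?thesis by (simp add: jm_summand_def)
  qed
  then show ?thesis by (simp add: jm_def[of m] sum_distrib_left sum_distrib_right)
qed

lemma jm_jm: "1 \<le> m \<Longrightarrow> 1 \<le> k \<Longrightarrow> jm m * jm k = jm k * jm m"
  using jm_jm_less[of m k] jm_jm_less[of k m] by (cases m k rule: linorder_cases) auto

lemma jm_s_disjoint_less:
  assumes "1 \<le> m" "m < i"
  shows "jm m * sg i (Suc i) = sg i (Suc i) * jm m"
proof -
  have "sg i (Suc i) * jm_summand l m = jm_summand l m * sg i (Suc i)" if "l \<in> {1..<m}" for l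
    using sg_jm_summand[of i "Suc i" l m] assms that by (auto simp: Transposition.transpose_def)
  then show ?thesis by (simp add: jm_def sum_distrib_left sum_distrib_right)
qed

lemma jm_s_disjoint:
  assumes "1 \<le> m" "1 \<le> i" "m \<noteq> i" "m \<noteq> Suc i"
  shows "jm m * sg i (Suc i) = sg i (Suc i) * jm m"
  using assms jm_s_disjoint_less[of m i] jm_sg[of i "Suc i" m] by (cases "m < i") auto

text \<open>The exchange relation of a degenerate affine Hecke algebra: s_i carries the summands m <
  i of \<open>jm i\<close> into those of \<open>jm (Suc i)\<close>, and the extra summand i,
  multiplied by s_i, leaves the bare projector.\<close>

lemma jm_Suc_s:
  assumes "1 \<le> i"
  shows "jm (Suc i) * sg i (Suc i) = sg i (Suc i) * jm i + (1 / 2) \<cdot> (1 + tau i * tau (Suc i))"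
proof -
  let ?s = "sg i (Suc i)"
  have "jm_summand m (Suc i) * ?s = ?s * jm_summand m i" if m: "m \<in> {1..<i}" for m
  proof -
    have "?s * ((1 + tau m * tau i) * sg m i) = ((1 + tau m * tau (Suc i)) * sg m (Suc i)) * ?s"
    proof (rule mult_pass)
      have "?s * (tau m * tau i) = (tau m * tau (Suc i)) * ?s"
        by (rule mult_pass)
          (use m sg_tau_transpose[of i "Suc i" m] sg_tau_transpose[of i "Suc i" i] assms
           in \<open>auto simp: Transposition.transpose_def\<close>)
      then show "?s * (1 + tau m * tau i) = (1 + tau m * tau (Suc i)) * ?s"
        by (simp add: distrib_left distrib_right)
      show "?s * sg m i = sg m (Suc i) * ?s"
        using m sg_conj[of "Suc i" i m] by (simp add: sg_commute)
    qed
    then show ?thesis by (simp add: jm_summand_def)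
  qed
  then have "(\<Sum>m\<in>{1..<i}. jm_summand m (Suc i) * ?s) = (\<Sum>m\<in>{1..<i}. ?s * jm_summand m i)"
    by (intro sum.cong) auto
  moreover have "jm_summand i (Suc i) * ?s = (1 / 2) \<cdot> (1 + tau i * tau (Suc i))"
    using assms by (simp add: jm_summand_def mult.assoc sg_sq)
  moreover have "jm (Suc i) * ?s = (\<Sum>m\<in>{1..<i}. jm_summand m (Suc i) * ?s) + jm_summand i (Suc i) * ?s"
    using assms by (simp add: jm_def sum_distrib_right distrib_right)
  ultimately show ?thesis by (simp add: jm_def sum_distrib_left)
qed

lemma s_jm_Suc:
  assumes "1 \<le> i"
  shows "sg i (Suc i) * jm (Suc i) = jm i * sg i (Suc i) + (1 / 2) \<cdot> (1 + tau i * tau (Suc i))"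
proof -
  let ?s = "sg i (Suc i)"
  have ss: "?s * ?s = 1" using assms by (simp add: sg_sq)
  have "?s * (tau i * tau (Suc i)) = (tau (Suc i) * tau i) * ?s"
    by (rule mult_pass)
      (use sg_tau_transpose[of i "Suc i" "Suc i"] sg_tau_transpose[of i "Suc i" i] assms in simp_all)
  then have t: "?s * (tau i * tau (Suc i)) = (tau i * tau (Suc i)) * ?s" by (metis tau_commute)
  have "?s * jm (Suc i) = ?s * (jm (Suc i) * ?s) * ?s" by (simp add: mult.assoc ss)
  also have "\<dots> = (?s * ?s) * jm i * ?s + (1 / 2) \<cdot> (?s * (1 + tau i * tau (Suc i)) * ?s)"
    unfolding jm_Suc_s[OF assms] by (simp add: distrib_left distrib_right mult.assoc)
  also have "?s * (1 + tau i * tau (Suc i)) * ?s = 1 + tau i * tau (Suc i)"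
    using t ss by (simp add: distrib_left distrib_right mult.assoc)
  finally show ?thesis by (simp add: ss)
qed

subsection \<open>The invariant Hermitian form\<close>

text \<open>The form with orthonormal group elements, conjugate linear in the first argument. The
  group acts unitarily, so transpositions, sign changes and the Jucys-Murphy elements are
  self-adjoint.\<close>

definition herm :: "galg \<Rightarrow> galg \<Rightarrow> complex" where
  "herm X Y = (\<Sum>g\<in>keys X. cnj (coef X g) * coef Y g)"

lemma herm_superset:
  "finite A \<Longrightarrow> keys X \<subseteq> A \<Longrightarrow> herm X Y = (\<Sum>g\<in>A. cnj (coef X g) * coef Y g)"
  unfolding herm_def by (rule sum.mono_neutral_left) (auto simp: in_keys_iff)

lemma herm_cnj: "herm X Y = cnj (herm Y X)"
  using herm_superset[of "keys X \<union> keys Y" X Y]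
    herm_superset[of "keys X \<union> keys Y" Y X]
  by (simp add: mult.commute)

lemma herm_add_right: "herm X (Y + Z) = herm X Y + herm X Z"
  by (simp add: herm_def lookup_add distrib_left sum.distrib)

lemma herm_smul_right: "herm X (c \<cdot> Y) = c * herm X Y"
  by (simp add: herm_def sum_distrib_left mult_ac)

lemma herm_add_left: "herm (X + Y) Z = herm X Z + herm Y Z"
  by (metis herm_cnj herm_add_right complex_cnj_add)

lemma herm_smul_left: "herm (c \<cdot> X) Y = cnj c * herm X Y"
  by (metis herm_cnj herm_smul_right complex_cnj_mult)

lemma herm_sum_right: "herm X (\<Sum>i\<in>I. Y i) = (\<Sum>i\<in>I. herm X (Y i))"
  by (simp add: herm_def lookup_sum sum_distrib_left sum.swap[of _ I])

lemma herm_sum_left: "herm (\<Sum>i\<in>I. Y i) X = (\<Sum>i\<in>I. herm (Y i) X)"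
  by (metis (no_types, lifting) herm_cnj herm_sum_right cnj_sum sum.cong)

lemma herm_gr: "herm (gr h * X) Y = herm X (gr (- h) * Y)"
proof -
  have "keys (gr h * X) \<subseteq> (+) h ` keys X"
    using keys_mult[of "gr h" X] by auto
  then have "herm (gr h * X) Y = (\<Sum>g\<in>(+) h ` keys X. cnj (coef (gr h * X) g) * coef Y g)"
    by (intro herm_superset) auto
  also have "\<dots> = (\<Sum>g\<in>keys X. cnj (coef X g) * coef Y (h + g))"
    by (subst sum.reindex) (auto simp: inj_on_def add.assoc[symmetric])
  finally show ?thesis by (simp add: herm_def)
qed

lemma herm_eq_0: "herm X X = 0 \<Longrightarrow> X = 0"
proof -
  assume 0: "herm X X = 0"
  have "herm X X = of_real (\<Sum>g\<in>keys X. (cmod (coef X g))\<^sup>2)"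
    unfolding herm_def of_real_sum complex_norm_square by (simp add: mult.commute)
  with 0 have "(\<Sum>g\<in>keys X. (cmod (coef X g))\<^sup>2) = 0" by (metis of_real_eq_0_iff)
  then have "\<forall>g\<in>keys X. coef X g = 0" by (simp add: sum_nonneg_eq_0_iff)
  then show "X = 0" by (auto simp: in_keys_iff intro: poly_mapping_eqI)
qed

lemma herm_sg: "a > 0 \<Longrightarrow> b > 0 \<Longrightarrow> herm (sg a b * X) Y = herm X (sg a b * Y)"
  using herm_gr[of "swap_perm a b" X Y] swap_perm_rels(2)[of a b] by (simp add: sg_def minus_unique)

lemma herm_tau: "herm (tau a * X) Y = herm X (tau a * Y)"
  using herm_gr[of "flip_perm a" X Y] swap_perm_rels(5)[of a] by (simp add: tau_def minus_unique)

lemma herm_jm: "herm (jm k * X) Y = herm X (jm k * Y)"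
proof -
  have "herm (jm_summand m k * X) Y = herm X (jm_summand m k * Y)" if m: "m \<in> {1..<k}" for m
  proof -
    have e: "tau m * tau k * sg m k = sg m k * (tau k * tau m)"
    proof -
      have "tau m * tau k * sg m k = tau m * sg m k * tau m"
        using m tau_sg2[of m k] by (simp add: mult.assoc)
      also have "tau m * sg m k = sg m k * tau k" using m by (intro tau_sg) auto
      finally show ?thesis by (simp only: mult.assoc)
    qed
    have "herm (tau m * tau k * sg m k * X) Y = herm X (sg m k * (tau k * tau m) * Y)"
      using m by (simp add: mult.assoc herm_tau herm_sg)
    then have "herm (tau m * tau k * sg m k * X) Y = herm X (tau m * tau k * sg m k * Y)"
      by (simp only: e)
    moreover have "jm_summand m k = (1 / 2) \<cdot> sg m k + (1 / 2) \<cdot> (tau m * tau k * sg m k)"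
      by (simp add: jm_summand_def distrib_right av.scale_right_distrib)
    ultimately show ?thesis
      using m by (simp add: distrib_right herm_add_left herm_add_right herm_smul_left herm_smul_right herm_sg)
  qed
  then show ?thesis
    by (simp add: jm_def sum_distrib_right herm_sum_left herm_sum_right)
qed

text \<open>Self-adjoint operators have real eigenvalues. Applied to the difference of two candidate
  solutions of (u - x) Z = Y, this takes the place of inverting u - x.\<close>

lemma jm_nonreal_eigenvalue:
  assumes "jm k * X = u \<cdot> X" "Im u \<noteq> 0"
  shows "X = 0"
proof -
  have "u * herm X X = cnj u * herm X X"
    using herm_jm[of k X X] assms by (auto simp: herm_smul_left herm_smul_right)
  moreover have "u \<noteq> cnj u" using assms by (simp add: complex_eq_iff)
  ultimately show ?thesis using herm_eq_0 by simp
qed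

subsection \<open>Weight vectors\<close>

definition left_weight :: "nat \<Rightarrow> (nat \<Rightarrow> complex) \<Rightarrow> (nat \<Rightarrow> complex) \<Rightarrow> galg \<Rightarrow> bool" where
  "left_weight N p c X \<longleftrightarrow> (\<forall>m\<in>{1..N}. tau m * X = p m \<cdot> X \<and> jm m * X = c m \<cdot> X)"

definition right_weight :: "nat \<Rightarrow> (nat \<Rightarrow> complex) \<Rightarrow> (nat \<Rightarrow> complex) \<Rightarrow> galg \<Rightarrow> bool" where
  "right_weight N p c X \<longleftrightarrow> (\<forall>m\<in>{1..N}. X * tau m = p m \<cdot> X \<and> X * jm m = c m \<cdot> X)"

text \<open>On a weight vector with \<open>c (i + 1) - c i = \<plusminus> 1\<close> the squared norm of \<open>s\<^sub>i X - e X\<close> is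
  \<open>2 (1 - e\<^sup>2) \<parallel>X\<parallel>\<^sup>2 = 0\<close>; this replaces any analysis of the possible weights.\<close>

lemma left_weight_adjacent:
  assumes "tau i * X = q \<cdot> X" "tau (Suc i) * X = q \<cdot> X" "q * q = 1"
    and "jm i * X = c \<cdot> X" "jm (Suc i) * X = (c + e) \<cdot> X" "e = 1 \<or> e = - 1" "Im c = 0" "1 \<le> i"
  shows "sg i (Suc i) * X = e \<cdot> X"
proof -
  let ?s = "sg i (Suc i)" and ?N = "herm X X"
  have "tau i * tau (Suc i) * X = X" using assms(1,2,3) by (simp add: mult.assoc)
  then have r: "jm (Suc i) * (?s * X) = c \<cdot> (?s * X) + X"
    using arg_cong[OF jm_Suc_s[OF assms(8)], of "\<lambda>Z. Z * X"] assms(4)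
    by (simp add: distrib_right mult.assoc av.scale_right_distrib flip: av.scale_left_distrib)
  have "herm X (jm (Suc i) * (?s * X)) = (c + e) * herm X (?s * X)"
    using assms(5-7) by (simp add: herm_jm[symmetric] herm_smul_left) (auto simp: complex_eq_iff)
  then have "e * herm X (?s * X) = ?N"
    unfolding r by (simp add: herm_add_right herm_smul_right algebra_simps)
  then have sX: "herm X (?s * X) = e * ?N"
    using assms(6) by (elim disjE) (simp_all, metis minus_minus)
  have sX': "herm (?s * X) X = e * ?N" using sX assms(8) by (simp add: herm_sg)
  have ss: "herm (?s * X) (?s * X) = ?N"
    using assms(8) by (simp add: herm_sg mult.assoc[symmetric] sg_sq)
  have "herm (?s * X + (- e) \<cdot> X) (?s * X + (- e) \<cdot> X) = 0"
    unfolding herm_add_left herm_add_right herm_smul_left herm_smul_right sX sX' ss using assms(6) by auto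
  from herm_eq_0[OF this] show ?thesis by simp
qed

lemma tau_s_weight:
  assumes "tau (swap i (Suc i) m) * X = p \<cdot> X" "1 \<le> i"
  shows "tau m * (sg i (Suc i) * X) = p \<cdot> (sg i (Suc i) * X)"
proof -
  have "sg i (Suc i) * tau (swap i (Suc i) m) = tau m * sg i (Suc i)"
    using sg_tau_transpose[of i "Suc i" "swap i (Suc i) m"] assms(2) by simp
  then have "tau m * (sg i (Suc i) * X) = sg i (Suc i) * (tau (swap i (Suc i) m) * X)"
    by (simp only: mult.assoc[symmetric])
  then show ?thesis by (simp add: assms(1))
qed

text \<open>Young's intertwiner: a is chosen so as to cancel the correction term of the exchange
  relation. For different signs this term vanishes and s_i alone suffices. Fixing a through a
  product includes the fact that the two contents differ when the signs agree.\<close>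

lemma left_weight_intertwine:
  assumes X: "left_weight N p c X" and i: "1 \<le> i" "i < N" and p: "p i = 1 \<or> p i = - 1" "p (Suc i) = 1 \<or> p (Suc i) = - 1"
    and a: "a * (c i - c (Suc i)) = (if p i = p (Suc i) then 1 else 0)"
    and a0: "p i \<noteq> p (Suc i) \<Longrightarrow> a = 0"
  shows "left_weight N (\<lambda>m. p (swap i (Suc i) m)) (\<lambda>m. c (swap i (Suc i) m))
           ((sg i (Suc i) + a \<cdot> 1) * X)"
  unfolding left_weight_def
proof (intro ballI conjI)
  fix m assume m: "m \<in> {1..N}"
  let ?t = "swap i (Suc i)" and ?s = "sg i (Suc i)"
  have w: "tau l * X = p l \<cdot> X" "jm l * X = c l \<cdot> X" if "l \<in> {1..N}" for l
    using X that by (auto simp: left_weight_def)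
  have tm: "?t m \<in> {1..N}" using m i by (auto simp: Transposition.transpose_def)
  have pm: "a \<cdot> (tau m * X) = a \<cdot> (p (?t m) \<cdot> X)"
  proof (cases "p i = p (Suc i)")
    case True
    then have "p (?t m) = p m" by (auto simp: Transposition.transpose_def)
    then show ?thesis using w m by simp
  qed (use a0 in simp)
  show "tau m * ((?s + a \<cdot> 1) * X) = p (?t m) \<cdot> ((?s + a \<cdot> 1) * X)"
    using tau_s_weight[OF w(1)[OF tm] i(1)] pm by (simp add: galg_simps)
  \<comment> \<open>On a weight vector the projector is the Kronecker delta of the two
    signs.\<close>
  have pp: "(1 / 2) \<cdot> ((1 + tau i * tau (Suc i)) * X) = (if p i = p (Suc i) then 1 else 0) \<cdot> X"
    using w(1)[of i] w(1)[of "Suc i"] i p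
    by (auto simp: distrib_right mult.assoc av.scale_right_distrib simp flip: av.scale_left_distrib)
  consider "m = i" | "m = Suc i" | "m \<noteq> i" "m \<noteq> Suc i" by blast
  then show "jm m * ((?s + a \<cdot> 1) * X) = c (?t m) \<cdot> ((?s + a \<cdot> 1) * X)"
  proof cases
    case 1
    have e: "jm i * ?s * X + (1 / 2) \<cdot> ((1 + tau i * tau (Suc i)) * X) = ?s * (jm (Suc i) * X)"
      using arg_cong[OF s_jm_Suc[OF i(1)], of "\<lambda>Z. Z * X"] by (simp add: distrib_right mult.assoc)
    have "jm i * (?s * X) = c (Suc i) \<cdot> (?s * X) - (if p i = p (Suc i) then 1 else 0) \<cdot> X"
      using e w(2)[of "Suc i"] i unfolding pp by (simp add: mult.assoc eq_diff_eq)
    then have "jm i * ((?s + a \<cdot> 1) * X)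
        = c (Suc i) \<cdot> (?s * X) - (a * (c i - c (Suc i))) \<cdot> X + (a * c i) \<cdot> X"
      using w(2)[of i] i by (simp add: galg_simps a del: right_diff_distrib)
    then show ?thesis using 1 by (simp add: galg_simps)
  next
    case 2
    have "jm (Suc i) * (?s * X) = ?s * (jm i * X) + (1 / 2) \<cdot> ((1 + tau i * tau (Suc i)) * X)"
      using arg_cong[OF jm_Suc_s[OF i(1)], of "\<lambda>Z. Z * X"] by (simp add: distrib_right mult.assoc)
    then have "jm (Suc i) * (?s * X) = c i \<cdot> (?s * X) + (a * (c i - c (Suc i))) \<cdot> X"
      using w(2)[of i] i pp by (simp add: a)
    then have "jm (Suc i) * ((?s + a \<cdot> 1) * X)
        = c i \<cdot> (?s * X) + (a * (c i - c (Suc i))) \<cdot> X + (a * c (Suc i)) \<cdot> X"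
      using w(2)[of "Suc i"] i by (simp add: galg_simps del: right_diff_distrib)
    then show ?thesis using 2 by (simp add: galg_simps)
  next
    case 3
    then have "jm m * ?s = ?s * jm m" using m i by (intro jm_s_disjoint) auto
    then show ?thesis using 3 w(2)[OF m]
      by (simp add: galg_simps mult.assoc[symmetric] Transposition.transpose_def)
         (simp add: mult.assoc)
  qed
qed

text \<open>A factor with nonzero coefficient exchanges two letters of the same sign and so changes
  no sign weight; all other factors are 1.\<close>

lemma phi_weights:
  assumes "\<And>m. 1 \<le> m \<Longrightarrow> m \<le> j \<Longrightarrow> \<alpha> m k \<noteq> 0 \<Longrightarrow> p m = q"
    and "\<And>m. 1 \<le> m \<Longrightarrow> m \<noteq> k \<Longrightarrow> m \<le> N \<Longrightarrow> tau m * X = p m \<cdot> X" "tau k * X = q \<cdot> X" "j < k" "k \<le> Suc N"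
  shows "(\<forall>m. 1 \<le> m \<longrightarrow> m \<noteq> k \<longrightarrow> m \<le> N \<longrightarrow> tau m * (phi \<alpha> k j * X) = p m \<cdot> (phi \<alpha> k j * X)) \<and>
     tau k * (phi \<alpha> k j * X) = q \<cdot> (phi \<alpha> k j * X)"
  using assms(1,4)
proof (induction j)
  case (Suc j)
  let ?W = "phi \<alpha> k j * X" and ?a = "\<alpha> (Suc j) k" and ?g = "sg (Suc j) k"
  have IH: "tau m * ?W = p m \<cdot> ?W" if "1 \<le> m" "m \<noteq> k" "m \<le> N" for m using Suc that by simp
  have IHk: "tau k * ?W = q \<cdot> ?W" using Suc by simp
  show ?case
  proof (cases "?a = 0")
    case True
    then show ?thesis using IH IHk by simp
  next
    case False
    then have q: "p (Suc j) = q" using Suc.prems by simp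
    have jk: "Suc j < k" using Suc.prems by simp
    have W: "phi \<alpha> k (Suc j) * X = ?W + ?a \<cdot> (?g * ?W)"
      by (simp add: distrib_right mult.assoc)
    have pass: "tau m * (?g * ?W) = ?g * (tau m' * ?W)" if "tau m * ?g = ?g * tau m'" for m m'
      using that by (simp add: mult.assoc[symmetric])
    have "tau m * (?g * ?W) = p m \<cdot> (?g * ?W)" if m: "1 \<le> m" "m \<noteq> k" "m \<le> N" for m
    proof (cases "m = Suc j")
      case True
      then show ?thesis using pass[OF tau_sg] jk IHk q by simp
    next
      case False
      then show ?thesis using pass[OF tau_sg_disjoint] jk IH m by simp
    qed
    moreover have "tau k * (?g * ?W) = q \<cdot> (?g * ?W)"
      using pass[OF tau_sg2] jk IH[of "Suc j"] q assms(5) by simp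
    ultimately show ?thesis using IH IHk unfolding W by (simp add: galg_simps mult.commute)
  qed
qed (use assms in auto)


text \<open>The scalar f(u) in (u - x_k) phi_k(u) X = f(u) X. The leading u comes from k = 1, where
  x_1 = 0. Each earlier letter of the same sign contributes a double pole at its content and simple
  zeros at its content plus and minus 1.\<close>

definition resolvent_numerator :: "(nat \<Rightarrow> complex) \<Rightarrow> complex \<Rightarrow> (nat \<Rightarrow> complex) \<Rightarrow> nat \<Rightarrow> complex \<Rightarrow> complex" where
  "resolvent_numerator p q c k u = u * (\<Prod>m\<in>{1..<k}. if p m = q then 1 - 1 / (u - c m)\<^sup>2 else 1)"

abbreviation spec_alpha :: "(nat \<Rightarrow> complex) \<Rightarrow> complex \<Rightarrow> (nat \<Rightarrow> complex) \<Rightarrow> complex \<Rightarrow> nat \<Rightarrow> nat \<Rightarrow> complex" where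
  "spec_alpha p q c u \<equiv> \<lambda>m _. (if p m = q then 1 else 0) / (u - c m)"

lemma phi_Suc_conj:
  assumes "\<And>m k k'. \<alpha> m k = \<alpha> m k'" "j < k"
  shows "phi \<alpha> (Suc k) j = sg k (Suc k) * phi \<alpha> k j * sg k (Suc k)"
proof -
  have "phi \<alpha> k j = phi (swap_alpha k \<alpha>) k j"
    by (rule phi_cong) (use assms in \<open>auto simp: swap_alpha_def Transposition.transpose_def\<close>)
  then have "sg k (Suc k) * phi \<alpha> (Suc k) j = phi \<alpha> k j * sg k (Suc k)"
    using phi_shift_down[OF assms(2), of \<alpha>] by simp
  then have "sg k (Suc k) * (sg k (Suc k) * phi \<alpha> (Suc k) j) = sg k (Suc k) * phi \<alpha> k j * sg k (Suc k)"
    by (simp add: mult.assoc)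
  then show ?thesis using assms(2) by (simp add: mult.assoc[symmetric] sg_sq)
qed

text \<open>In other words \<open>\<phi>\<^sub>k(u) X\<close> is a scalar multiple of \<open>(u - x\<^sub>k)\<^sup>-\<^sup>1 X\<close>.\<close>

theorem phi_resolvent:
  assumes "1 \<le> k" "\<And>m. 1 \<le> m \<Longrightarrow> m < k \<Longrightarrow> tau m * X = p m \<cdot> X \<and> jm m * X = c m \<cdot> X"
    and "tau k * X = q \<cdot> X" "q = 1 \<or> q = - 1"
    and p: "\<And>m. 1 \<le> m \<Longrightarrow> m < k \<Longrightarrow> p m = 1 \<or> p m = - 1"
    and c: "\<And>m. 1 \<le> m \<Longrightarrow> m < k \<Longrightarrow> Im (c m) = 0" and u: "Im u \<noteq> 0"
  shows "jm k * (phi (spec_alpha p q c u) k (k - 1) * X)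
       = u \<cdot> (phi (spec_alpha p q c u) k (k - 1) * X) - resolvent_numerator p q c k u \<cdot> X"
  using assms(1-6)
proof (induction k arbitrary: X rule: nat_induct_at_least)
  case base
  show ?case by (simp add: jm_def resolvent_numerator_def)
next
  case (Suc k X)
  let ?A = "spec_alpha p q c u" and ?s = "sg k (Suc k)" and ?f = "resolvent_numerator p q c k u"
  have k: "1 \<le> k" using Suc.hyps by simp
  have ss: "?s * ?s = 1" using k by (simp add: sg_sq)
  have w: "tau m * X = p m \<cdot> X" "jm m * X = c m \<cdot> X" if "1 \<le> m" "m \<le> k" for m
    using Suc.prems(1) that by auto
  have q: "tau (Suc k) * X = q \<cdot> X" using Suc.prems by simp
  \<comment> \<open>Y need not be an eigenvector of \<open>jm k\<close>, but the induction
    hypothesis asks only for content weights below k. It is used for Y, whose k-th sign is q, and in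
    the case p k = q also for X itself.\<close>
  define Y where "Y = ?s * X"
  define Z where "Z = phi ?A k (k - 1) * Y"
  have sY: "?s * Y = X" by (simp add: Y_def mult.assoc[symmetric] ss)
  have Yw: "tau m * Y = p m \<cdot> Y" "jm m * Y = c m \<cdot> Y" if "1 \<le> m" "m < k" for m
  proof -
    show "tau m * Y = p m \<cdot> Y"
      unfolding Y_def using w that k by (intro tau_s_weight) (auto simp: Transposition.transpose_def)
    have "jm m * ?s = ?s * jm m" using that by (intro jm_s_disjoint) auto
    then have "jm m * Y = ?s * (jm m * X)" unfolding Y_def by (simp add: mult.assoc[symmetric])
    then show "jm m * Y = c m \<cdot> Y" using w that by (simp add: Y_def)
  qed
  have Yk: "tau k * Y = q \<cdot> Y" "tau (Suc k) * Y = p k \<cdot> Y"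
    unfolding Y_def using w q k by (auto intro!: tau_s_weight)
  have Z: "jm k * Z = u \<cdot> Z - ?f \<cdot> Y"
    unfolding Z_def by (rule Suc.IH) (use Yw Yk Suc.prems in auto)
  have Zw: "tau k * Z = q \<cdot> Z \<and> tau (Suc k) * Z = p k \<cdot> Z"
  proof -
    let ?p = "\<lambda>m. if m = Suc k then p k else p m"
    have "(\<forall>m. 1 \<le> m \<longrightarrow> m \<noteq> k \<longrightarrow> m \<le> Suc k \<longrightarrow> tau m * Z = ?p m \<cdot> Z) \<and> tau k * Z = q \<cdot> Z"
      unfolding Z_def
    proof (rule phi_weights)
      show "?p m = q" if "1 \<le> m" "m \<le> k - 1" "?A m k \<noteq> 0" for m
        using that k by (auto split: if_splits)
      show "tau m * Y = ?p m \<cdot> Y" if "1 \<le> m" "m \<noteq> k" "m \<le> Suc k" for m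
        using that Yw(1)[of m] Yk by (cases "m = Suc k") auto
    qed (use Yk k in auto)
    from conjunct1[OF this, rule_format, of "Suc k"] conjunct2[OF this]
    have "tau (Suc k) * Z = p k \<cdot> Z" "tau k * Z = q \<cdot> Z" by auto
    then show ?thesis by simp
  qed
  have pk: "p k = 1 \<or> p k = - 1" using Suc.prems k by auto
  have half: "(1 / 2) \<cdot> ((1 + tau k * tau (Suc k)) * W) = (if p k = q then 1 else 0) \<cdot> W"
    if "tau (Suc k) * W = b \<cdot> W" "tau k * W = b' \<cdot> W" "b * b' = p k * q" for W b b'
    using that pk Suc.prems(3)
    by (auto simp: distrib_right mult.assoc av.scale_right_distrib simp flip: av.scale_left_distrib)
  have step: "jm (Suc k) * (?s * W) = ?s * (jm k * W) + (1 / 2) \<cdot> ((1 + tau k * tau (Suc k)) * W)" for W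
    using arg_cong[OF jm_Suc_s[OF k], of "\<lambda>Z. Z * W"] by (simp add: distrib_right mult.assoc)
  have phiS: "phi ?A (Suc k) k * X = ?s * Z + ?A k k \<cdot> Z"
  proof -
    have "phi ?A (Suc k) k = (1 + ?A k k \<cdot> ?s) * phi ?A (Suc k) (k - 1)"
      using k phi.simps(2)[of ?A "Suc k" "k - 1"] by simp
    moreover have "phi ?A (Suc k) (k - 1) * X = ?s * Z"
      using phi_Suc_conj[of ?A "k - 1" k] k by (simp add: Z_def Y_def mult.assoc)
    ultimately have "phi ?A (Suc k) k * X = (1 + ?A k k \<cdot> ?s) * (?s * Z)" by (simp add: mult.assoc)
    also have "\<dots> = ?s * Z + ?A k k \<cdot> (?s * ?s * Z)"
      by (simp only: distrib_right smul_mult_left mult.assoc mult_1_left)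
    finally show ?thesis by (simp add: ss)
  qed
  have f: "resolvent_numerator p q c (Suc k) u = ?f * (if p k = q then 1 - 1 / (u - c k)\<^sup>2 else 1)"
    using k by (simp add: resolvent_numerator_def)
  have 1: "jm (Suc k) * (?s * Z) = u \<cdot> (?s * Z) - ?f \<cdot> X + (if p k = q then 1 else 0) \<cdot> Z"
    using step[of Z] half[of Z "p k" q] Zw Z sY by (simp add: right_diff_distrib)
  show ?case
  proof (cases "p k = q")
    case False
    then show ?thesis using phiS 1 f by simp
  next
    case True
    have uc: "u - c k \<noteq> 0" using u Suc.prems(5)[of k] k by (auto simp: complex_eq_iff)
    define b where "b = 1 / (u - c k)"
    have b: "b * (u - c k) = 1" using uc by (simp add: b_def)
    define V where "V = phi ?A k (k - 1) * X"
    have V: "jm k * V = u \<cdot> V - ?f \<cdot> X"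
      unfolding V_def by (rule Suc.IH) (use w True k Suc.prems in auto)
    \<comment> \<open>X has weight c k under \<open>jm k\<close>, so this difference would have the
      non-real eigenvalue u. Hence it is 0 and V is a multiple of X.\<close>
    have "jm k * ((u - c k) \<cdot> V - ?f \<cdot> X) = u \<cdot> ((u - c k) \<cdot> V - ?f \<cdot> X)"
      using V w(2)[of k] k
      by (simp add: right_diff_distrib av.scale_right_diff_distrib)
         (rule poly_mapping_eqI, simp add: lookup_minus algebra_simps)
    from jm_nonreal_eigenvalue[OF this u] have "(u - c k) \<cdot> V = ?f \<cdot> X" by simp
    then have "b \<cdot> ((u - c k) \<cdot> V) = b \<cdot> (?f \<cdot> X)" by simp
    then have V': "V = (b * ?f) \<cdot> X" using b by simp
    have "jm (Suc k) * phi ?A k (k - 1) = phi ?A k (k - 1) * jm (Suc k)"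
      by (rule phi_commute) (use k in \<open>auto intro!: jm_sg\<close>)
    then have "jm (Suc k) * Z = phi ?A k (k - 1) * (jm (Suc k) * Y)"
      by (simp add: Z_def mult.assoc[symmetric])
    also have "jm (Suc k) * Y = c k \<cdot> Y + X"
      using step[of X] half[of X q "p k"] w[of k] q k True by (simp add: Y_def)
    finally have 2: "jm (Suc k) * Z = c k \<cdot> Z + V" by (simp add: Z_def V_def distrib_left)
    have A: "?A k k = b" using True by (simp add: b_def)
    have e: "resolvent_numerator p q c (Suc k) u = ?f - b * b * ?f"
      using True f by (simp add: b_def power2_eq_square algebra_simps)
    have "jm (Suc k) * (?s * Z + b \<cdot> Z)
        = u \<cdot> (?s * Z) - ?f \<cdot> X + Z + b \<cdot> (c k \<cdot> Z + (b * ?f) \<cdot> X)"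
      using 1 2 True V' by (simp add: distrib_left)
    also have "\<dots> = u \<cdot> (?s * Z + b \<cdot> Z) - (?f - b * b * ?f) \<cdot> X"
    proof (rule poly_mapping_eqI)
      fix g
      have "coef Z g = b * (u - c k) * coef Z g" using b by simp
      then show "coef (u \<cdot> (?s * Z) - ?f \<cdot> X + Z + b \<cdot> (c k \<cdot> Z + (b * ?f) \<cdot> X)) g =
          coef (u \<cdot> (?s * Z + b \<cdot> Z) - (?f - b * b * ?f) \<cdot> X) g"
        by (simp add: lookup_add lookup_minus algebra_simps)
    qed
    finally show ?thesis unfolding diff_Suc_1 phiS A e .
  qed
qed

section \<open>Standard bi-tableaux\<close>

lemma young_diagram_down:
  assumes "is_partition p" "(a, b) \<in> young_diagram p" "1 \<le> a'" "a' \<le> a" "1 \<le> b'" "b' \<le> b"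
  shows "(a', b') \<in> young_diagram p"
proof -
  have "p ! (a - 1) \<le> p ! (a' - 1)"
  proof (cases "a' = a")
    case False
    then show ?thesis
      using assms by (auto simp: is_partition_def young_diagram_def sorted_wrt_iff_nth_less)
  qed simp
  then show ?thesis using assms by (auto simp: young_diagram_def)
qed

locale bipart =
  fixes n :: nat and l :: bipart
  assumes bip: "bipartition n l"
begin

abbreviation SYT where "SYT \<equiv> standard_bitableaux l"
abbreviation nd where "nd T i \<equiv> node_of l T i"
abbreviation cmp where "cmp T i \<equiv> component l T i"
abbreviation ct where "ct T i \<equiv> content l T i"

lemma nodes_pos: "(k, a, b) \<in> nodes l \<Longrightarrow> 1 \<le> a \<and> 1 \<le> b \<and> (k = 1 \<or> k = 2)"
  by (auto simp: nodes_def young_diagram_def)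

lemma nodes_down:
  "(k, a, b) \<in> nodes l \<Longrightarrow> 1 \<le> a' \<Longrightarrow> a' \<le> a \<Longrightarrow> 1 \<le> b' \<Longrightarrow> b' \<le> b \<Longrightarrow> (k, a', b') \<in> nodes l"
  using bip young_diagram_down unfolding bipartition_def nodes_def by blast

lemma T_bij: "T \<in> SYT \<Longrightarrow> bij_betw T (nodes l) {1..n}"
  using bip by (auto simp: standard_bitableaux_def bipartition_def)

lemma nd_in: "T \<in> SYT \<Longrightarrow> i \<in> {1..n} \<Longrightarrow> nd T i \<in> nodes l"
  unfolding node_of_def using T_bij bij_betw_imp_surj_on inv_into_into by metis

lemma T_nd: "T \<in> SYT \<Longrightarrow> i \<in> {1..n} \<Longrightarrow> T (nd T i) = i"
  unfolding node_of_def using T_bij bij_betw_inv_into_right by metis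

lemma nd_T: "T \<in> SYT \<Longrightarrow> x \<in> nodes l \<Longrightarrow> nd T (T x) = x"
  unfolding node_of_def using T_bij bij_betw_inv_into_left by metis

lemma T_in: "T \<in> SYT \<Longrightarrow> x \<in> nodes l \<Longrightarrow> T x \<in> {1..n}"
  using T_bij bij_betw_apply by metis

lemma nd_inj: "T \<in> SYT \<Longrightarrow> i \<in> {1..n} \<Longrightarrow> j \<in> {1..n} \<Longrightarrow> nd T i = nd T j \<Longrightarrow> i = j"
  using T_nd by metis

lemma T_row: "T \<in> SYT \<Longrightarrow> (k, a, b) \<in> nodes l \<Longrightarrow> (k, a, b') \<in> nodes l \<Longrightarrow> b < b' \<Longrightarrow> T (k, a, b) < T (k, a, b')"
  by (auto simp: standard_bitableaux_def)

lemma T_col: "T \<in> SYT \<Longrightarrow> (k, a, b) \<in> nodes l \<Longrightarrow> (k, a', b) \<in> nodes l \<Longrightarrow> a < a' \<Longrightarrow> T (k, a, b) < T (k, a', b)"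
  by (auto simp: standard_bitableaux_def)

lemma T_mono_le:
  assumes "T \<in> SYT" "(k, a', b') \<in> nodes l" "1 \<le> a" "a \<le> a'" "1 \<le> b" "b \<le> b'"
  shows "T (k, a, b) \<le> T (k, a', b')"
proof -
  have 1: "(k, a, b') \<in> nodes l" "(k, a, b) \<in> nodes l" using assms nodes_down nodes_pos by blast+
  have "T (k, a, b) \<le> T (k, a, b')"
    using T_row[OF assms(1) 1(2) 1(1)] assms by (cases "b = b'") auto
  also have "\<dots> \<le> T (k, a', b')"
    using T_col[OF assms(1) 1(1) assms(2)] assms by (cases "a = a'") auto
  finally show ?thesis .
qed

lemma T_mono:
  assumes "T \<in> SYT" "(k, a', b') \<in> nodes l" "1 \<le> a" "a \<le> a'" "1 \<le> b" "b \<le> b'" "(a, b) \<noteq> (a', b')"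
  shows "T (k, a, b) < T (k, a', b')"
proof -
  have "(k, a, b) \<in> nodes l" using assms nodes_down by blast
  then have "T (k, a, b) \<noteq> T (k, a', b')"
    using nd_T[OF assms(1)] assms(2,7) by (metis Pair_inject)
  then show ?thesis using T_mono_le[OF assms(1-6)] by simp
qed

lemma cmp_cases: "T \<in> SYT \<Longrightarrow> i \<in> {1..n} \<Longrightarrow> cmp T i = 1 \<or> cmp T i = 2"
  using nd_in[of T i] nodes_pos by (cases "nd T i") (auto simp: component_def)

lemma sgn_p_eq_iff:
  "T \<in> SYT \<Longrightarrow> i \<in> {1..n} \<Longrightarrow> j \<in> {1..n} \<Longrightarrow> sgn_p l T i = sgn_p l T j \<longleftrightarrow> cmp T i = cmp T j"
  using cmp_cases[of T i] cmp_cases[of T j] by (auto simp: sgn_p_def xi_def)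

lemma sgn_p_cases: "sgn_p l T i = 1 \<or> sgn_p l T i = - 1"
  by (simp add: sgn_p_def xi_def)

section \<open>Entries i and i + 1, and when they may be exchanged\<close>

definition same_line :: "bitableau \<Rightarrow> nat \<Rightarrow> bool" where
  "same_line T i \<longleftrightarrow> cmp T i = cmp T (Suc i) \<and>
     (fst (snd (nd T i)) = fst (snd (nd T (Suc i))) \<or> snd (snd (nd T i)) = snd (snd (nd T (Suc i))))"

lemma exchange_apply: "x \<in> nodes l \<Longrightarrow> exchange l i T x = swap i (Suc i) (T x)"
  by (simp add: exchange_def)

lemma transpose_in: "1 \<le> i \<Longrightarrow> i < n \<Longrightarrow> j \<in> {1..n} \<Longrightarrow> swap i (Suc i) j \<in> {1..n}"
  by (auto simp: Transposition.transpose_def)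

lemma exchange_std:
  assumes "T \<in> SYT" "1 \<le> i" "i < n" "\<not> same_line T i"
  shows "exchange l i T \<in> SYT"
proof -
  let ?t = "swap i (Suc i)" and ?E = "exchange l i T"
  have "?t ` {1..n} \<subseteq> {1..n}" using transpose_in[OF assms(2,3)] by blast
  then have "bij_betw ?t {1..n} {1..n}"
    by (intro bij_betw_imageI endo_inj_surj) auto
  then have "bij_betw (?t \<circ> T) (nodes l) {1..n}" using T_bij[OF assms(1)] bij_betw_trans by blast
  then have bij: "bij_betw ?E (nodes l) {1..n}"
    by (rule iffD1[OF bij_betw_cong, rotated]) (simp add: exchange_apply)
  have key: "?E x < ?E y"
    if "x \<in> nodes l" "y \<in> nodes l" "T x < T y" "fst x = fst y"
       "fst (snd x) = fst (snd y) \<or> snd (snd x) = snd (snd y)" for x y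
  proof -
    have "\<not> (T x = i \<and> T y = Suc i)"
      using assms(4) nd_T[OF assms(1) that(1)] nd_T[OF assms(1) that(2)] that(4,5)
      unfolding same_line_def component_def by metis
    then show ?thesis
      using that(1-3) by (auto simp: exchange_apply Transposition.transpose_def)
  qed
  have "?E (k, a, b) < ?E (k, a, b')"
    if "(k, a, b) \<in> nodes l" "(k, a, b') \<in> nodes l" "b < b'" for k a b b'
    using key[OF that(1,2)] T_row[OF assms(1) that] by simp
  moreover have "?E (k, a, b) < ?E (k, a', b)"
    if "(k, a, b) \<in> nodes l" "(k, a', b) \<in> nodes l" "a < a'" for k a a' b
    using key[OF that(1,2)] T_col[OF assms(1) that] by simp
  moreover have "?E \<in> extensional (nodes l)" by (simp add: exchange_def)
  ultimately show ?thesis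
    using bij bip unfolding standard_bitableaux_def bipartition_def by blast
qed

lemma nd_exchange:
  assumes "T \<in> SYT" "1 \<le> i" "i < n" "exchange l i T \<in> SYT" "j \<in> {1..n}"
  shows "nd (exchange l i T) j = nd T (swap i (Suc i) j)"
proof -
  let ?t = "swap i (Suc i)"
  have "?t j \<in> {1..n}" using transpose_in assms by blast
  then have x: "nd T (?t j) \<in> nodes l" "T (nd T (?t j)) = ?t j" using assms nd_in T_nd by auto
  then have "exchange l i T (nd T (?t j)) = j" by (simp add: exchange_apply)
  then show ?thesis using nd_T[OF assms(4) x(1)] by simp
qed

lemma exchange_exchange:
  assumes "T \<in> SYT"
  shows "exchange l i (exchange l i T) = T"
proof
  fix x
  have e: "T \<in> extensional (nodes l)" using assms by (simp add: standard_bitableaux_def)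
  show "exchange l i (exchange l i T) x = T x"
  proof (cases "x \<in> nodes l")
    case False
    then show ?thesis using extensional_arb[OF e False] by (simp add: exchange_def)
  qed (simp add: exchange_def)
qed

lemma adjacent_nodes:
  assumes "T \<in> SYT" "1 \<le> i" "i < n"
  obtains k a b k' a' b' where "nd T i = (k, a, b)" "nd T (Suc i) = (k', a', b')"
    "(k, a, b) \<in> nodes l" "(k', a', b') \<in> nodes l" "T (k, a, b) = i" "T (k', a', b') = Suc i"
proof -
  have "i \<in> {1..n}" "Suc i \<in> {1..n}" using assms by auto
  then show ?thesis
    using that nd_in[OF assms(1)] T_nd[OF assms(1)] by (metis prod_cases3)
qed

text \<open>A node strictly between the two in their row or column would need an entry strictly
  between i and i + 1.\<close>

lemma same_line_cases:
  assumes "T \<in> SYT" "1 \<le> i" "i < n" "same_line T i"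
  obtains k a b where "nd T i = (k, a, b)" "nd T (Suc i) = (k, a, Suc b)"
  | k a b where "nd T i = (k, a, b)" "nd T (Suc i) = (k, Suc a, b)"
proof -
  obtain k a b k' a' b' where N: "nd T i = (k, a, b)" "nd T (Suc i) = (k', a', b')"
    "(k, a, b) \<in> nodes l" "(k', a', b') \<in> nodes l" "T (k, a, b) = i" "T (k', a', b') = Suc i"
    using adjacent_nodes[OF assms(1-3)] by metis
  have pos: "1 \<le> a" "1 \<le> b" "1 \<le> a'" "1 \<le> b'" using N nodes_pos by blast+
  have k: "k' = k" using assms(4) N by (simp add: same_line_def component_def)
  have le: "\<not> (a' \<le> a \<and> b' \<le> b)"
    using T_mono_le[OF assms(1) N(3), of a' b'] N k pos by auto
  consider "a = a'" | "b = b'" using assms(4) N by (auto simp: same_line_def)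
  then show ?thesis
  proof cases
    case 1
    then have b: "b < b'" using le by auto
    have "b' = Suc b"
    proof (rule ccontr)
      assume "b' \<noteq> Suc b"
      then have lt: "Suc b < b'" using b by simp
      have m: "(k, a, Suc b) \<in> nodes l" using nodes_down[OF N(4), of a "Suc b"] 1 k pos lt by simp
      have "i < T (k, a, Suc b)" using T_row[OF assms(1) N(3) m] N by simp
      moreover have "T (k, a, Suc b) < Suc i" using T_row[OF assms(1) m, of b'] N lt 1 k by simp
      ultimately show False by simp
    qed
    then show ?thesis using that(1) N 1 k by simp
  next
    case 2
    then have a: "a < a'" using le by auto
    have "a' = Suc a"
    proof (rule ccontr)
      assume "a' \<noteq> Suc a"
      then have lt: "Suc a < a'" using a by simp
      have m: "(k, Suc a, b) \<in> nodes l" using nodes_down[OF N(4), of "Suc a" b] 2 k pos lt by simp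
      have "i < T (k, Suc a, b)" using T_col[OF assms(1) N(3) m] N by simp
      moreover have "T (k, Suc a, b) < Suc i" using T_col[OF assms(1) m, of a'] N lt 2 k by simp
      ultimately show False by simp
    qed
    then show ?thesis using that(2) N 2 k by simp
  qed
qed

lemma same_line_content:
  assumes "T \<in> SYT" "1 \<le> i" "i < n" "same_line T i"
  shows "ct T (Suc i) = ct T i + 1 \<or> ct T (Suc i) = ct T i - 1"
  by (rule same_line_cases[OF assms]) (auto simp: content_def)

text \<open>If the node of i + 1 were strictly below and to the right of that of i, the corner
  between them would need an entry strictly between i and i + 1. So one node lies above and to the
  right of the other, and each coordinate contributes at least 1 to the difference of
  contents.\<close>

lemma not_same_line_content:
  assumes "T \<in> SYT" "1 \<le> i" "i < n" "\<not> same_line T i" "cmp T i = cmp T (Suc i)"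
  shows "\<bar>ct T (Suc i) - ct T i\<bar> \<ge> 2"
proof -
  obtain k a b k' a' b' where N: "nd T i = (k, a, b)" "nd T (Suc i) = (k', a', b')"
    "(k, a, b) \<in> nodes l" "(k', a', b') \<in> nodes l" "T (k, a, b) = i" "T (k', a', b') = Suc i"
    using adjacent_nodes[OF assms(1-3)] by metis
  have pos: "1 \<le> a" "1 \<le> b" "1 \<le> a'" "1 \<le> b'" using N nodes_pos by blast+
  have k: "k' = k" using assms(5) N by (simp add: component_def)
  have le: "\<not> (a' \<le> a \<and> b' \<le> b)"
    using T_mono_le[OF assms(1) N(3), of a' b'] N k pos by auto
  have ne: "a \<noteq> a'" "b \<noteq> b'" using assms(4,5) N by (auto simp: same_line_def)
  have "\<not> (a < a' \<and> b < b')"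
  proof
    assume lt: "a < a' \<and> b < b'"
    have m: "(k, a', b) \<in> nodes l" using nodes_down[OF N(4), of a' b] k pos lt by simp
    have "i < T (k, a', b)" using T_col[OF assms(1) N(3) m] N lt by simp
    moreover have "T (k, a', b) < Suc i" using T_row[OF assms(1) m, of b'] N lt k by simp
    ultimately show False by simp
  qed
  then have "a < a' \<and> b' < b \<or> a' < a \<and> b < b'" using le ne by auto
  then show ?thesis using N by (auto simp: content_def)
qed

lemma exchange_std_iff:
  assumes "T \<in> SYT" "1 \<le> i" "i < n"
  shows "exchange l i T \<in> SYT \<longleftrightarrow> \<not> same_line T i"
proof
  assume E: "exchange l i T \<in> SYT"
  show "\<not> same_line T i"
  proof
    assume s: "same_line T i"
    obtain k a b k' a' b' where N: "nd T i = (k, a, b)" "nd T (Suc i) = (k', a', b')"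
      "(k, a, b) \<in> nodes l" "(k', a', b') \<in> nodes l" "T (k, a, b) = i" "T (k', a', b') = Suc i"
      using adjacent_nodes[OF assms(1-3)] by metis
    have pos: "1 \<le> a" "1 \<le> b" using N nodes_pos by blast+
    have "k' = k \<and> a \<le> a' \<and> b \<le> b'"
      by (rule same_line_cases[OF assms s]) (use N in auto)
    then have "exchange l i T (k, a, b) \<le> exchange l i T (k', a', b')"
      using T_mono_le[OF E, of k a' b' a b] N pos by simp
    then show False using N by (simp add: exchange_apply)
  qed
qed (use exchange_std assms in blast)

lemma cmp_exchange:
  assumes "T \<in> SYT" "1 \<le> i" "i < n" "exchange l i T \<in> SYT" "j \<in> {1..n}"
  shows "cmp (exchange l i T) j = cmp T (swap i (Suc i) j)"
    "ct (exchange l i T) j = ct T (swap i (Suc i) j)"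
    "sgn_p l (exchange l i T) j = sgn_p l T (swap i (Suc i) j)"
  using nd_exchange[OF assms] by (simp_all add: component_def content_def sgn_p_def)

text \<open>Nodes of one component with equal content lie on a diagonal and are comparable. If the
  nodes of i differed, the upper left one would hold a smaller entry in the other tableau, although
  both tableaux agree on all entries below i.\<close>

lemma weights_determine_tableau:
  assumes S: "S \<in> SYT" and T: "T \<in> SYT"
    and eq: "\<And>i. i \<in> {1..n} \<Longrightarrow> cmp S i = cmp T i \<and> ct S i = ct T i"
  shows "S = T"
proof -
  have gt: "nd S i = nd T i" if "i \<in> {1..n}" for i
    using that
  proof (induction i rule: less_induct)
    case (less i)
    have no: "\<not> (a < a')" if s: "S1 \<in> SYT" "T1 \<in> SYT" "nd S1 i = (k, a, b)" "nd T1 i = (k, a', b')"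
        "int b - int a = int b' - int a'" and h: "\<And>j. j < i \<Longrightarrow> j \<in> {1..n} \<Longrightarrow> nd S1 j = nd T1 j"
      for S1 T1 k a b a' b'
    proof
      assume a: "a < a'"
      then have b: "b < b'" using s by linarith
      have in1: "(k, a, b) \<in> nodes l" "S1 (k, a, b) = i" using s less.prems nd_in T_nd by metis+
      have in2: "(k, a', b') \<in> nodes l" "T1 (k, a', b') = i" using s less.prems nd_in T_nd by metis+
      have lt: "T1 (k, a, b) < i"
        using T_mono[OF s(2) in2(1), of a b] in1(1) nodes_pos[OF in1(1)] a b in2 by simp
      then have "nd S1 (T1 (k, a, b)) = (k, a, b)"
        using h nd_T[OF s(2) in1(1)] T_in[OF s(2) in1(1)] by simp
      then have "S1 (k, a, b) = T1 (k, a, b)" using T_nd[OF s(1)] T_in[OF s(2) in1(1)] by metis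
      then show False using lt in1 by simp
    qed
    obtain k a b where s: "nd S i = (k, a, b)" by (metis prod_cases3)
    obtain k' a' b' where t: "nd T i = (k', a', b')" by (metis prod_cases3)
    have k: "k' = k" "int b - int a = int b' - int a'"
      using eq[OF less.prems] s t by (auto simp: component_def content_def)
    have "\<not> a < a'" by (rule no[OF S T s]) (use t k less.IH in auto)
    moreover have "\<not> a' < a" by (rule no[OF T S, of k' a' b']) (use s t k less.IH in auto)
    ultimately show ?case using s t k by auto
  qed
  show ?thesis
  proof (rule extensionalityI[of _ "nodes l"])
    show "S \<in> extensional (nodes l)" "T \<in> extensional (nodes l)"
      using S T by (auto simp: standard_bitableaux_def)
    fix x assume x: "x \<in> nodes l"
    then have "nd S (T x) = x" using gt[OF T_in[OF T x]] nd_T[OF T x] by simp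
    then show "S x = T x" using T_nd[OF S T_in[OF T x]] by simp
  qed
qed

subsection \<open>Sorting by adjacent exchanges\<close>

definition linear_on_nodes :: "(node \<Rightarrow> nat) \<Rightarrow> bool" where
  "linear_on_nodes \<rho> \<longleftrightarrow> (\<forall>k a b a' b'. (k, a, b) \<in> nodes l \<and> (k, a', b') \<in> nodes l \<and> a \<le> a' \<and> b \<le> b' \<longrightarrow>
     \<rho> (k, a, b) \<le> \<rho> (k, a', b'))"

text \<open>With weights n - i the exchange of a descent lowers the sum by exactly the height of the
  descent. Two choices of \<rho> are used: \<open>rank\<close>, to reach hook order, and a tableau
  T, to reach T.\<close>

definition disorder :: "(node \<Rightarrow> nat) \<Rightarrow> bitableau \<Rightarrow> nat" where
  "disorder \<rho> T = (\<Sum>i\<in>{1..n}. (n - i) * \<rho> (nd T i))"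

lemma descent_exchange_std:
  assumes "linear_on_nodes \<rho>" "T \<in> SYT" "1 \<le> i" "i < n" "\<rho> (nd T (Suc i)) < \<rho> (nd T i)"
  shows "exchange l i T \<in> SYT"
proof (rule exchange_std[OF assms(2-4)])
  show "\<not> same_line T i"
  proof
    assume s: "same_line T i"
    have "nd T i \<in> nodes l" "nd T (Suc i) \<in> nodes l" using nd_in assms by auto
    then have "\<rho> (nd T i) \<le> \<rho> (nd T (Suc i))"
      using same_line_cases[OF assms(2-4) s] assms(1) unfolding linear_on_nodes_def
      by (metis le_Suc_eq order_refl)
    then show False using assms(5) by simp
  qed
qed

lemma disorder_exchange:
  assumes "T \<in> SYT" "1 \<le> i" "i < n" "exchange l i T \<in> SYT" "\<rho> (nd T (Suc i)) < \<rho> (nd T i)"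
  shows "disorder \<rho> (exchange l i T) < disorder \<rho> T"
proof -
  let ?E = "exchange l i T" and ?I = "{1..n} - {i, Suc i}"
  have split: "(\<Sum>j\<in>{1..n}. f j) = f i + f (Suc i) + (\<Sum>j\<in>?I. f j)" for f :: "nat \<Rightarrow> nat"
    using assms(2,3) by (simp add: sum.remove[of _ i] sum.remove[of _ "Suc i"] Diff_insert2[symmetric] insert_commute)
  have "(\<Sum>j\<in>?I. (n - j) * \<rho> (nd ?E j)) = (\<Sum>j\<in>?I. (n - j) * \<rho> (nd T j))"
    by (rule sum.cong) (use nd_exchange[OF assms(1-4)] in \<open>auto simp: Transposition.transpose_def\<close>)
  moreover have "nd ?E i = nd T (Suc i)" "nd ?E (Suc i) = nd T i"
    using nd_exchange[OF assms(1-4)] assms by auto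
  moreover have "n - i = Suc (n - Suc i)" using assms by simp
  ultimately show ?thesis
    using assms(5) unfolding disorder_def split by (simp add: algebra_simps)
qed

subsection \<open>Hook order\<close>

text \<open>Compared lexicographically: component, index of the principal hook, arm (with the
  corner) before leg, position along it.\<close>

fun key :: "node \<Rightarrow> nat \<times> nat \<times> nat \<times> nat" where
  "key (k, a, b) = (k, min a b, if b < a then 1 else 0, max a b)"

lemma key_inj: "key x = key y \<Longrightarrow> x = y"
  by (cases x; cases y) (auto split: if_splits simp: min_def max_def)

definition rank :: "node \<Rightarrow> nat" where
  "rank x = card {y \<in> nodes l. key y < key x}"

definition hook_ordered :: "bitableau \<Rightarrow> bool" where
  "hook_ordered T \<longleftrightarrow> (\<forall>i. 1 \<le> i \<and> i < n \<longrightarrow> rank (nd T i) \<le> rank (nd T (Suc i)))"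

lemma finite_nodes: "T \<in> SYT \<Longrightarrow> finite (nodes l)"
  using T_bij bij_betw_finite by blast

lemma rank_less:
  assumes "finite (nodes l)" "x \<in> nodes l" "key x < key y"
  shows "rank x < rank y"
  unfolding rank_def
  by (rule psubset_card_mono) (use assms in auto)

lemma linear_rank: "finite (nodes l) \<Longrightarrow> linear_on_nodes rank"
  unfolding linear_on_nodes_def rank_def
proof (intro allI impI card_mono)
  fix k a b a' b'
  assume "(k, a, b) \<in> nodes l \<and> (k, a', b') \<in> nodes l \<and> a \<le> a' \<and> b \<le> b'"
  then have "key (k, a, b) \<le> key (k, a', b')"
    by (auto simp: less_eq_prod_def less_prod_def min_def max_def)
  then show "{y \<in> nodes l. key y < key (k, a, b)} \<subseteq> {y \<in> nodes l. key y < key (k, a', b')}"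
    by auto
qed simp

lemma linear_tableau: "S \<in> SYT \<Longrightarrow> linear_on_nodes S"
  unfolding linear_on_nodes_def using T_mono_le nodes_pos by blast

lemma hook_ordered_key:
  assumes "T \<in> SYT" "hook_ordered T" "1 \<le> i" "i < j" "j \<le> n"
  shows "key (nd T i) < key (nd T j)"
  using assms(4,5)
proof (induction j)
  case (Suc j)
  have step: "key (nd T j) < key (nd T (Suc j))" if "1 \<le> j" "j < n"
  proof -
    have j: "j \<in> {1..n}" "Suc j \<in> {1..n}" using that by auto
    have "\<not> key (nd T (Suc j)) < key (nd T j)"
      using rank_less[OF finite_nodes[OF assms(1)] nd_in[OF assms(1) j(2)]] assms(2) that
      unfolding hook_ordered_def by (metis not_le)
    moreover have "key (nd T (Suc j)) \<noteq> key (nd T j)"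
      using key_inj nd_inj[OF assms(1) j] by (metis n_not_Suc_n)
    ultimately show ?thesis by (meson linorder_neqE)
  qed
  show ?case
  proof (cases "i = j")
    case False
    then show ?thesis using Suc step assms(3) by (auto intro: order.strict_trans)
  qed (use step Suc assms(3) in auto)
qed simp

lemma hook_ordered_next:
  assumes "T \<in> SYT" "hook_ordered T" "x \<in> nodes l" "y \<in> nodes l" "key x < key y"
    and "\<And>z. \<not> (key x < key z \<and> key z < key y)"
  shows "T y = Suc (T x)"
proof (rule ccontr)
  assume ne: "T y \<noteq> Suc (T x)"
  have xy: "T x \<in> {1..n}" "T y \<in> {1..n}" using T_in assms by auto
  have "\<not> T y \<le> T x"
    using hook_ordered_key[OF assms(1,2), of "T y" "T x"] nd_T[OF assms(1)] assms(3-5) xy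
    by (metis atLeastAtMost_iff leD le_neq_implies_less less_imp_le)
  then have "Suc (T x) < T y" using ne by simp
  then have "key (nd T (Suc (T x))) < key (nd T (T y))" "key (nd T (T x)) < key (nd T (Suc (T x)))"
    using hook_ordered_key[OF assms(1,2)] xy by auto
  then show False using assms(6) nd_T[OF assms(1)] assms(3,4) by metis
qed

text \<open>The node of m lies on the diagonal of the node of k, above and to the left. The next
  node along its hook, to the right on the arm and below on the leg, is still inside the rectangle
  spanned by the node of k; it is the immediate successor in hook order and so receives m +
  1.\<close>

lemma hook_ordered_singular:
  assumes T: "T \<in> SYT" "hook_ordered T" and k: "k \<le> n" "1 \<le> m" "m < k"
    and eq: "cmp T m = cmp T k" "ct T m = ct T k"
  shows "Suc m < k \<and> cmp T (Suc m) = cmp T m \<and> (ct T (Suc m) = ct T m + 1 \<or> ct T (Suc m) = ct T m - 1) \<and>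
    same_hook l T m (Suc m)"
proof -
  have in1: "m \<in> {1..n}" "k \<in> {1..n}" using k by auto
  obtain K a b where nm: "nd T m = (K, a, b)" by (metis prod_cases3)
  obtain K' A B where nk: "nd T k = (K', A, B)" by (metis prod_cases3)
  have K: "K' = K" "int b - int a = int B - int A"
    using eq nm nk by (auto simp: component_def content_def)
  have N: "(K, a, b) \<in> nodes l" "(K, A, B) \<in> nodes l" "T (K, a, b) = m" "T (K, A, B) = k"
    using nd_in[OF T(1)] T_nd[OF T(1)] in1 nm nk K by metis+
  have pos: "1 \<le> a" "1 \<le> b" "1 \<le> A" "1 \<le> B" using N nodes_pos by blast+
  have lt: "a < A" "b < B"
  proof -
    have "\<not> (A \<le> a \<and> B \<le> b)" using T_mono_le[OF T(1) N(1), of A B] N pos k by auto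
    then show "a < A" "b < B" using K by linarith+
  qed
  define y where "y = (if a \<le> b then (K, a, Suc b) else (K, Suc a, b))"
  have y: "y \<in> nodes l"
    using nodes_down[OF N(2), of a "Suc b"] nodes_down[OF N(2), of "Suc a" b] lt pos by (auto simp: y_def)
  have kxy: "key (K, a, b) < key y" by (auto simp: y_def less_prod_def)
  have btw: "\<not> (key (K, a, b) < key z \<and> key z < key y)" for z
    by (cases z) (auto simp: y_def less_prod_def min_def max_def split: if_splits)
  have Ty: "T y = Suc m" using hook_ordered_next[OF T N(1) y kxy btw] N by simp
  then have ndy: "nd T (Suc m) = y" using nd_T[OF T(1) y] by simp
  have "T y < k"
    using T_mono[OF T(1) N(2), of a "Suc b"] T_mono[OF T(1) N(2), of "Suc a" b] lt pos N K
    by (auto simp: y_def split: if_splits)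
  moreover have "cmp T (Suc m) = cmp T m" using ndy nm by (auto simp: component_def y_def)
  moreover have "ct T (Suc m) = ct T m + 1 \<or> ct T (Suc m) = ct T m - 1"
    using ndy nm by (auto simp: content_def y_def)
  moreover have "same_hook l T m (Suc m)"
    unfolding same_hook_def ndy nm using N(1) y
    by (intro exI[of _ K] exI[of _ "min a b"]) (auto simp: principal_hook_def y_def min_def)
  ultimately show ?thesis using Ty by simp
qed

subsection \<open>Counting neighbours on adjacent diagonals\<close>

text \<open>Right and lower neighbours embed N 0 into N 1 and N (- 1). Away from content 0 the
  diagonal starts at a border of the diagram, and one neighbour of its first node is not hit; this
  is the extra 1. The numbers give the orders of poles and zeros of
  \<open>resolvent_numerator\<close> at the content of k.\<close>

lemma diagonal_counts:
  assumes T: "T \<in> SYT" and k: "k \<in> {1..n}"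
  defines "N d \<equiv> {m \<in> {1..<k}. cmp T m = cmp T k \<and> ct T m = ct T k + d}"
  shows "card (N 0) \<le> card (N 1)" "card (N 0) \<le> card (N (- 1))"
    "ct T k \<noteq> 0 \<Longrightarrow> 2 * card (N 0) + 1 \<le> card (N 1) + card (N (- 1))"
proof -
  obtain K A B where nk: "nd T k = (K, A, B)" by (metis prod_cases3)
  have Nk: "(K, A, B) \<in> nodes l" "T (K, A, B) = k" using nd_in[OF T k] T_nd[OF T k] nk by auto
  have pk: "1 \<le> A" "1 \<le> B" using nodes_pos Nk by blast+
  have fin: "finite (N d)" for d by (simp add: N_def)
  define rt where "rt m = (case nd T m of (k', a, b) \<Rightarrow> T (k', a, Suc b))" for m
  define dn where "dn m = (case nd T m of (k', a, b) \<Rightarrow> T (k', Suc a, b))" for m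
  have mem: "T (K, a, b) \<in> N d"
    if "1 \<le> a" "a \<le> A" "1 \<le> b" "b \<le> B" "(a, b) \<noteq> (A, B)" "int b - int a = int B - int A + d" for a b d
  proof -
    have "(K, a, b) \<in> nodes l" using nodes_down[OF Nk(1)] that by blast
    moreover have "T (K, a, b) < k" using T_mono[OF T Nk(1)] that Nk by metis
    ultimately show ?thesis
      using nd_T[OF T] T_in[OF T] that nk by (force simp: N_def component_def content_def)
  qed
  have N0: "\<exists>a b. nd T m = (K, a, b) \<and> 1 \<le> a \<and> a < A \<and> 1 \<le> b \<and> b < B \<and> int b - int a = int B - int A"
    if m: "m \<in> N 0" for m
  proof -
    have m': "m \<in> {1..n}" "m < k" "cmp T m = cmp T k" "ct T m = ct T k" using m k by (auto simp: N_def)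
    obtain K' a b where nm: "nd T m = (K', a, b)" by (metis prod_cases3)
    have e: "K' = K" "int b - int a = int B - int A"
      using m' nm nk by (auto simp: component_def content_def)
    have Nm: "(K, a, b) \<in> nodes l" "T (K, a, b) = m" using nd_in[OF T m'(1)] T_nd[OF T m'(1)] nm e by auto
    have pos: "1 \<le> a" "1 \<le> b" using Nm nodes_pos by blast+
    have "\<not> (A \<le> a \<and> B \<le> b)" using T_mono_le[OF T Nm(1), of A B] Nm Nk pk m' by auto
    then show ?thesis using e pos nm by auto
  qed
  have rt: "rt m \<in> N 1" and dn: "dn m \<in> N (- 1)" if "m \<in> N 0" for m
    using N0[OF that] mem by (auto simp: rt_def dn_def)
  have node: "(K, a, b) \<in> nodes l" if "1 \<le> a" "a \<le> A" "1 \<le> b" "b \<le> B" for a b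
    using nodes_down[OF Nk(1)] that by blast
  have rt_nd: "\<exists>a b. nd T (rt m) = (K, a, Suc b) \<and> nd T m = (K, a, b) \<and> 1 \<le> b"
    and dn_nd: "\<exists>a b. nd T (dn m) = (K, Suc a, b) \<and> nd T m = (K, a, b) \<and> 1 \<le> a" if "m \<in> N 0" for m
    using N0[OF that] nd_T[OF T node] by (auto simp: rt_def dn_def)
  have inj: "m = m'" if "nd T m = nd T m'" "m \<in> N 0" "m' \<in> N 0" for m m'
    using nd_inj[OF T _ _ that(1)] that k by (auto simp: N_def)
  have irt: "inj_on rt (N 0)"
    by (rule inj_onI) (metis rt_nd inj Pair_inject Suc_inject)
  have idn: "inj_on dn (N 0)"
    by (rule inj_onI) (metis dn_nd inj Pair_inject Suc_inject)
  show 1: "card (N 0) \<le> card (N 1)" by (rule card_inj_on_le[OF irt]) (use rt fin in auto)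
  show 2: "card (N 0) \<le> card (N (- 1))" by (rule card_inj_on_le[OF idn]) (use dn fin in auto)
  show "2 * card (N 0) + 1 \<le> card (N 1) + card (N (- 1))" if c: "ct T k \<noteq> 0"
  proof (cases "A < B")
    case True
    \<comment> \<open>The node to the left of the top node of the diagonal through k; being in the
      first row, it lies below no node.\<close>
    define x where "x = T (K, 1, B - A)"
    have "x \<in> N (- 1)" unfolding x_def by (rule mem) (use True pk in auto)
    moreover have "x \<notin> dn ` N 0"
    proof
      assume "x \<in> dn ` N 0"
      then obtain m where "m \<in> N 0" "x = dn m" by auto
      then have "\<exists>a b. nd T x = (K, Suc a, b) \<and> 1 \<le> a" using dn_nd by blast
      moreover have "nd T x = (K, 1, B - A)" unfolding x_def by (rule nd_T[OF T node]) (use True pk in auto)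
      ultimately show False by auto
    qed
    ultimately have "insert x (dn ` N 0) \<subseteq> N (- 1)" "card (insert x (dn ` N 0)) = Suc (card (N 0))"
      using dn fin idn by (auto simp: card_image)
    then have "Suc (card (N 0)) \<le> card (N (- 1))" by (metis card_mono fin)
    then show ?thesis using 1 by simp
  next
    case False
    then have AB: "B < A" using c nk by (auto simp: content_def)
    define x where "x = T (K, A - B, 1)"
    have "x \<in> N 1" unfolding x_def by (rule mem) (use AB pk in auto)
    moreover have "x \<notin> rt ` N 0"
    proof
      assume "x \<in> rt ` N 0"
      then obtain m where "m \<in> N 0" "x = rt m" by auto
      then have "\<exists>a b. nd T x = (K, a, Suc b) \<and> 1 \<le> b" using rt_nd by blast
      moreover have "nd T x = (K, A - B, 1)" unfolding x_def by (rule nd_T[OF T node]) (use AB pk in auto)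
      ultimately show False by auto
    qed
    ultimately have "insert x (rt ` N 0) \<subseteq> N 1" "card (insert x (rt ` N 0)) = Suc (card (N 0))"
      using rt fin irt by (auto simp: card_image)
    then have "Suc (card (N 0)) \<le> card (N 1)" by (metis card_mono fin)
    then show ?thesis using 2 by simp
  qed
qed

end

section \<open>Coefficientwise limits\<close>

text \<open>\<open>reg f a\<close> abstracts regularity of f with value a. It is instantiated by
  one-sided limits in a real parameter and by rational functions near a point of a subspace.
  Equalities are asked for on D only, where no denominator vanishes.\<close>

locale coef_limit =
  fixes reg :: "('p \<Rightarrow> complex) \<Rightarrow> complex \<Rightarrow> bool" and D :: "'p set"
  assumes reg_const: "reg (\<lambda>_. a) a"
    and reg_add: "reg f a \<Longrightarrow> reg g b \<Longrightarrow> reg (\<lambda>y. f y + g y) (a + b)"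
    and reg_mult: "reg f a \<Longrightarrow> reg g b \<Longrightarrow> reg (\<lambda>y. f y * g y) (a * b)"
    and reg_cong: "(\<And>y. y \<in> D \<Longrightarrow> f y = g y) \<Longrightarrow> reg f a \<Longrightarrow> reg g a"
begin

definition regA :: "('p \<Rightarrow> galg) \<Rightarrow> galg \<Rightarrow> bool" where
  "regA F V \<longleftrightarrow> (\<forall>g. reg (\<lambda>y. coef (F y) g) (coef V g))"

lemma regA_const: "regA (\<lambda>_. X) X"
  by (simp add: regA_def reg_const)

lemma regA_add: "regA F V \<Longrightarrow> regA G W \<Longrightarrow> regA (\<lambda>y. F y + G y) (V + W)"
  by (simp add: regA_def lookup_add reg_add)

lemma regA_smul: "reg f a \<Longrightarrow> regA F V \<Longrightarrow> regA (\<lambda>y. f y \<cdot> F y) (a \<cdot> V)"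
  by (simp add: regA_def reg_mult)

lemma regA_diff:
  assumes "regA F V" "regA G W"
  shows "regA (\<lambda>y. F y - G y) (V - W)"
  using regA_add[OF assms(1) regA_smul[OF reg_const[of "- 1"] assms(2)]] by simp

lemma regA_gr_left: "regA F V \<Longrightarrow> regA (\<lambda>y. gr h * F y) (gr h * V)"
  by (simp add: regA_def)

lemma regA_gr_right: "regA F V \<Longrightarrow> regA (\<lambda>y. F y * gr h) (V * gr h)"
  by (simp add: regA_def)

lemma regA_sg_left: "regA F V \<Longrightarrow> regA (\<lambda>y. sg a b * F y) (sg a b * V)"
  unfolding sg_def by (rule regA_gr_left)

lemma regA_sg_right: "regA F V \<Longrightarrow> regA (\<lambda>y. F y * sg a b) (V * sg a b)"
  unfolding sg_def by (rule regA_gr_right)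

lemma regA_tau_left: "regA F V \<Longrightarrow> regA (\<lambda>y. tau a * F y) (tau a * V)"
  unfolding tau_def by (rule regA_gr_left)

lemma regA_tau_right: "regA F V \<Longrightarrow> regA (\<lambda>y. F y * tau a) (V * tau a)"
  unfolding tau_def by (rule regA_gr_right)

lemma regA_sum:
  assumes "\<And>i. i \<in> I \<Longrightarrow> regA (F i) (V i)"
  shows "regA (\<lambda>y. \<Sum>i\<in>I. F i y) (\<Sum>i\<in>I. V i)"
  using assms
  by (induction I rule: infinite_finite_induct) (auto intro: regA_const regA_add)

lemma regA_jm_left:
  assumes "regA F V"
  shows "regA (\<lambda>y. jm k * F y) (jm k * V)"
proof -
  have "regA (\<lambda>y. (1 / 2) \<cdot> (sg m k * F y + tau m * (tau k * (sg m k * F y))))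
     ((1 / 2) \<cdot> (sg m k * V + tau m * (tau k * (sg m k * V))))" for m
    by (intro regA_smul reg_const regA_add regA_sg_left regA_tau_left assms)
  then have "regA (\<lambda>y. jm_summand m k * F y) (jm_summand m k * V)" for m
    by (simp add: jm_summand_def distrib_right mult.assoc)
  then show ?thesis
    unfolding jm_def sum_distrib_right by (intro regA_sum)
qed

lemma regA_jm_right:
  assumes "regA F V"
  shows "regA (\<lambda>y. F y * jm k) (V * jm k)"
proof -
  have "regA (\<lambda>y. (1 / 2) \<cdot> (F y * sg m k + F y * tau m * tau k * sg m k))
     ((1 / 2) \<cdot> (V * sg m k + V * tau m * tau k * sg m k))" for m
    by (intro regA_smul reg_const regA_add regA_sg_right regA_tau_right assms)
  then have "regA (\<lambda>y. F y * jm_summand m k) (V * jm_summand m k)" for m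
    by (simp add: jm_summand_def distrib_left distrib_right mult.assoc)
  then show ?thesis
    unfolding jm_def sum_distrib_left by (intro regA_sum)
qed

lemma regA_cong: "(\<And>y. y \<in> D \<Longrightarrow> F y = G y) \<Longrightarrow> regA F V \<Longrightarrow> regA G V"
  unfolding regA_def by (metis (no_types, lifting) reg_cong)

end

section \<open>Cancelling the singular factors\<close>

text \<open>S marks the singular indices m. Their coefficients no longer occur: the factor m is
  dropped, and its transposition (m, k) joins the next factor with the coefficient of m + 1.\<close>

primrec reg_phi :: "(nat \<Rightarrow> bool) \<Rightarrow> (nat \<Rightarrow> nat \<Rightarrow> complex) \<Rightarrow> nat \<Rightarrow> nat \<Rightarrow> galg" where
  "reg_phi S \<alpha> k 0 = 1"
| "reg_phi S \<alpha> k (Suc j) =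
    (if S (Suc j) then 1
     else if S j then 1 + \<alpha> (Suc j) k \<cdot> (sg j k + sg (Suc j) k)
     else 1 + \<alpha> (Suc j) k \<cdot> sg (Suc j) k) * reg_phi S \<alpha> k j"

lemma (in coef_limit) regA_reg_phi:
  assumes "\<And>m. 1 \<le> m \<Longrightarrow> m \<le> j \<Longrightarrow> \<not> S m \<Longrightarrow> reg (\<lambda>y. \<alpha> y m k) (\<alpha>0 m k)" "regA F V"
  shows "regA (\<lambda>y. reg_phi S (\<alpha> y) k j * F y) (reg_phi S \<alpha>0 k j * V)"
  using assms(1)
proof (induction j)
  case (Suc j)
  note IH = Suc.IH[OF Suc.prems]
  have a: "reg (\<lambda>y. \<alpha> y (Suc j) k) (\<alpha>0 (Suc j) k)" if "\<not> S (Suc j)"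
    using Suc.prems that by simp
  consider "S (Suc j)" | "\<not> S (Suc j)" "S j" | "\<not> S (Suc j)" "\<not> S j" by blast
  then show ?case
  proof cases
    case 1
    then show ?thesis using IH by simp
  next
    case 2
    let ?P = "\<lambda>y. reg_phi S (\<alpha> y) k j * F y" and ?Q = "reg_phi S \<alpha>0 k j * V"
    have "regA (\<lambda>y. ?P y + \<alpha> y (Suc j) k \<cdot> (sg j k * ?P y + sg (Suc j) k * ?P y))
       (?Q + \<alpha>0 (Suc j) k \<cdot> (sg j k * ?Q + sg (Suc j) k * ?Q))"
      by (intro regA_add regA_smul regA_sg_left IH a) (use 2 in auto)
    then show ?thesis using 2 by (simp add: distrib_right mult.assoc)
  next
    case 3
    let ?P = "\<lambda>y. reg_phi S (\<alpha> y) k j * F y" and ?Q = "reg_phi S \<alpha>0 k j * V"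
    have "regA (\<lambda>y. ?P y + \<alpha> y (Suc j) k \<cdot> (sg (Suc j) k * ?P y))
       (?Q + \<alpha>0 (Suc j) k \<cdot> (sg (Suc j) k * ?Q))"
      by (intro regA_add regA_smul regA_sg_left IH a) (use 3 in auto)
    then show ?thesis using 3 by (simp add: distrib_right mult.assoc)
  qed
qed (use assms in simp)

lemma sg_sg_Suc:
  assumes "1 \<le> i" "Suc i < k"
  shows "sg (Suc i) k * sg i k = sg i k * sg i (Suc i)"
proof -
  have "sg (Suc i) k * sg k i = sg (Suc i) i * sg (Suc i) k" using assms by (intro sg_conj) auto
  moreover have "sg i (Suc i) * sg (Suc i) k = sg i k * sg i (Suc i)" using assms by (intro sg_conj) auto
  ultimately show ?thesis using sg_commute[of i k] sg_commute[of i "Suc i"] assms by simp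
qed

text \<open>The poles of the two factors with indices \<open>m\<close> and \<open>m + 1\<close> cancel on vectors
  with \<open>s\<^sub>m X = e X\<close>, because \<open>(m + 1, k) (m, k) = (m, k) s\<^sub>m\<close>.\<close>

lemma phi_eq_reg_phi:
  assumes S: "\<And>m. S m \<Longrightarrow> m < k \<Longrightarrow> 1 \<le> m \<and> Suc m < k \<and> \<not> S (Suc m) \<and> sg m (Suc m) * X = e m \<cdot> X \<and>
      \<alpha> m k + e m * \<alpha> m k * \<alpha> (Suc m) k = \<alpha> (Suc m) k"
    and "j < k"
  shows "phi \<alpha> k (if S j then j - 1 else j) * X = reg_phi S \<alpha> k j * X"
  using assms(2)
proof (induction j)
  case 0
  then show ?case by simp
next
  case (Suc j)
  have IH: "phi \<alpha> k (if S j then j - 1 else j) * X = reg_phi S \<alpha> k j * X" using Suc by simp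
  consider "S (Suc j)" | "\<not> S (Suc j)" "S j" | "\<not> S (Suc j)" "\<not> S j" by blast
  then show ?case
  proof cases
    case 1
    \<comment> \<open>At a singular index the product on the left stays one factor behind; that
      factor is multiplied in at the next index, together with its partner.\<close>
    then have "\<not> S j" using S[of j] Suc.prems by auto
    then show ?thesis using 1 IH by simp
  next
    case 2
    have c: "1 \<le> j" "Suc j < k" "sg j (Suc j) * X = e j \<cdot> X"
      "\<alpha> j k + e j * \<alpha> j k * \<alpha> (Suc j) k = \<alpha> (Suc j) k"
      using S[OF 2(2)] Suc.prems by auto
    define W where "W = phi \<alpha> k (j - 1) * X"
    have com: "sg j (Suc j) * phi \<alpha> k (j - 1) = phi \<alpha> k (j - 1) * sg j (Suc j)"
      by (rule phi_commute) (use c in \<open>auto intro!: sg_disjoint\<close>)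
    have "sg j (Suc j) * W = phi \<alpha> k (j - 1) * (sg j (Suc j) * X)"
      unfolding W_def by (simp only: com mult.assoc[symmetric])
    then have sW: "sg j (Suc j) * W = e j \<cdot> W" using c by (simp add: W_def)
    have ssW: "sg (Suc j) k * (sg j k * W) = e j \<cdot> (sg j k * W)"
      using sg_sg_Suc[OF c(1,2)] sW by (simp add: mult.assoc[symmetric]) (simp add: mult.assoc)
    have "phi \<alpha> k j = (1 + \<alpha> j k \<cdot> sg j k) * phi \<alpha> k (j - 1)"
      using c(1) phi.simps(2)[of \<alpha> k "j - 1"] by simp
    then have "phi \<alpha> k (Suc j) * X = (1 + \<alpha> (Suc j) k \<cdot> sg (Suc j) k) * ((1 + \<alpha> j k \<cdot> sg j k) * W)"
      by (simp add: W_def mult.assoc)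
    also have "\<dots> = W + \<alpha> (Suc j) k \<cdot> (sg (Suc j) k * W)
        + (\<alpha> j k + e j * \<alpha> j k * \<alpha> (Suc j) k) \<cdot> (sg j k * W)"
      by (simp add: galg_simps mult.assoc ssW mult_ac)
    also have "\<dots> = (1 + \<alpha> (Suc j) k \<cdot> (sg j k + sg (Suc j) k)) * W"
      unfolding c(4) by (simp add: galg_simps)
    also have "W = reg_phi S \<alpha> k j * X" using IH 2 by (simp add: W_def)
    finally show ?thesis using 2 by (simp add: mult.assoc)
  next
    case 3
    then show ?thesis using IH by (simp add: mult.assoc)
  qed
qed

section \<open>The idempotent of the sign changes\<close>

definition sign_proj :: "complex \<Rightarrow> nat \<Rightarrow> galg" where
  "sign_proj q k = (1 / 2) \<cdot> (1 + q \<cdot> tau k)"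

text \<open>For signs q this is the projector onto the sign pattern q. For q = p + w it is the
  factor of the fusion product that carries the variables w.\<close>

primrec sign_idem :: "(nat \<Rightarrow> complex) \<Rightarrow> nat \<Rightarrow> galg" where
  "sign_idem q 0 = 1"
| "sign_idem q (Suc k) = sign_proj (q (Suc k)) (Suc k) * sign_idem q k"

lemma sign_idem_cong: "(\<And>m. 1 \<le> m \<Longrightarrow> m \<le> k \<Longrightarrow> q m = q' m) \<Longrightarrow> sign_idem q k = sign_idem q' k"
  by (induction k) auto

lemma sign_idem_commute:
  assumes "\<And>m. 1 \<le> m \<Longrightarrow> m \<le> k \<Longrightarrow> Y * tau m = tau m * Y"
  shows "Y * sign_idem q k = sign_idem q k * Y"
  using assms
proof (induction k)
  case (Suc k)
  have "Y * sign_proj (q (Suc k)) (Suc k) = sign_proj (q (Suc k)) (Suc k) * Y"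
    using Suc.prems[of "Suc k"] by (simp add: sign_proj_def galg_simps)
  then show ?case unfolding sign_idem.simps by (rule mult_pass) (use Suc in simp)
qed simp

lemma tau_sign_idem:
  assumes "1 \<le> m" "m \<le> k" "q m = 1 \<or> q m = - 1"
  shows "tau m * sign_idem q k = q m \<cdot> sign_idem q k"
  using assms(2)
proof (induction k)
  case (Suc k)
  show ?case
  proof (cases "m = Suc k")
    case True
    have "tau m * sign_proj (q m) m = q m \<cdot> sign_proj (q m) m"
      using assms(3) by (auto simp: sign_proj_def galg_simps tau_sq)
    then show ?thesis using True by (simp add: mult.assoc[symmetric])
  next
    case False
    have "tau m * sign_proj (q (Suc k)) (Suc k) = sign_proj (q (Suc k)) (Suc k) * tau m"
      by (simp add: sign_proj_def galg_simps tau_commute)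
    then have "tau m * sign_idem q (Suc k) = sign_proj (q (Suc k)) (Suc k) * (tau m * sign_idem q k)"
      by (simp add: mult.assoc[symmetric])
    then show ?thesis using Suc False by simp
  qed
qed (use assms in simp)

lemma sign_idem_tau:
  assumes "1 \<le> m" "m \<le> k" "q m = 1 \<or> q m = - 1"
  shows "sign_idem q k * tau m = q m \<cdot> sign_idem q k"
  using tau_sign_idem[of m k q] sign_idem_commute[of k "tau m" q] assms tau_commute by simp

lemma s_sign_idem:
  assumes "1 \<le> i" "i < k"
  shows "sg i (Suc i) * sign_idem q k = sign_idem (\<lambda>m. q (swap i (Suc i) m)) k * sg i (Suc i)"
  using assms(2)
proof (induction k)
  case (Suc k)
  let ?s = "sg i (Suc i)" and ?q = "\<lambda>m. q (swap i (Suc i) m)"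
  have st: "?s * sign_proj x m = sign_proj x (swap i (Suc i) m) * ?s" for x m
    using sg_tau_transpose[of i "Suc i" m] assms(1) by (simp add: sign_proj_def galg_simps)
  show ?case
  proof (cases "k = i")
    case True
    obtain j where i: "i = Suc j" using assms(1) by (cases i) auto
    have c: "?s * sign_idem q j = sign_idem q j * ?s"
      by (rule sign_idem_commute) (use i tau_sg_disjoint in \<open>auto simp: tau_sg_disjoint\<close>)
    have P: "sign_idem q j = sign_idem ?q j" by (rule sign_idem_cong) (use i in \<open>auto simp: Transposition.transpose_def\<close>)
    have c': "?s * sign_idem ?q j = sign_idem ?q j * ?s" using c P by simp
    have tc: "sign_proj x a * sign_proj y b = sign_proj y b * sign_proj x a" for x y a b
      by (simp add: sign_proj_def galg_simps tau_commute[of a b] add_ac mult.commute)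
    have "?s * sign_idem q (Suc i) = (?s * sign_proj (q (Suc i)) (Suc i)) * (sign_proj (q i) i * sign_idem q j)"
      using i by (simp add: mult.assoc)
    also have "\<dots> = sign_proj (q (Suc i)) i * ((?s * sign_proj (q i) i) * sign_idem q j)"
      using st[of "q (Suc i)" "Suc i"] by (simp add: mult.assoc)
    also have "\<dots> = (sign_proj (q (Suc i)) i * sign_proj (q i) (Suc i)) * (?s * sign_idem q j)"
      using st[of "q i" i] by (simp add: mult.assoc)
    also have "\<dots> = sign_proj (q i) (Suc i) * (sign_proj (q (Suc i)) i * sign_idem ?q j) * ?s"
      unfolding P c' by (subst tc) (simp add: mult.assoc)
    finally show ?thesis using True i by simp
  next
    case False
    then have "?s * sign_proj (q (Suc k)) (Suc k) = sign_proj (?q (Suc k)) (Suc k) * ?s"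
      using st[of "q (Suc k)" "Suc k"] Suc.prems by (simp add: Transposition.transpose_def)
    then show ?thesis unfolding sign_idem.simps by (rule mult_pass) (use Suc False in simp)
  qed
qed simp

section \<open>The coefficient of the identity\<close>

text \<open>Sign changes above k have to be allowed, because the sign projector of all n letters
  stands on the right from the start of the induction on k.\<close>

definition fixes_above :: "nat \<Rightarrow> galg \<Rightarrow> bool" where
  "fixes_above k X \<longleftrightarrow> (\<forall>g j. coef X g \<noteq> 0 \<longrightarrow> k < j \<longrightarrow> \<bar>app g (int j)\<bar> = int j)"

lemma fixes_above_add: "fixes_above k X \<Longrightarrow> fixes_above k Y \<Longrightarrow> fixes_above k (X + Y)"
  unfolding fixes_above_def lookup_add by (metis add_0)

lemma fixes_above_smul: "fixes_above k X \<Longrightarrow> fixes_above k (c \<cdot> X)"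
  unfolding fixes_above_def by simp

lemma uminus_swap_perm: "a > 0 \<Longrightarrow> b > 0 \<Longrightarrow> - swap_perm a b = swap_perm a b"
  using swap_perm_rels(2) minus_unique by metis

lemma coef_sg_mult: "a > 0 \<Longrightarrow> b > 0 \<Longrightarrow> coef (sg a b * X) g = coef X (swap_perm a b + g)"
  by (simp add: sg_def uminus_swap_perm)

lemma app_swap_perm_abs:
  assumes "a > 0" "b > 0"
  shows "\<bar>app (swap_perm a b) x\<bar> = (if \<bar>x\<bar> = int a then int b else if \<bar>x\<bar> = int b then int a else \<bar>x\<bar>)"
  using assms by (auto simp: app_swap_perm)

lemma fixes_above_sg:
  assumes "fixes_above k X" "1 \<le> a" "a \<le> k" "1 \<le> b" "b \<le> k"
  shows "fixes_above k (sg a b * X)"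
  unfolding fixes_above_def
proof (intro allI impI)
  fix g j assume h: "coef (sg a b * X) g \<noteq> 0" "k < j"
  then have "coef X (swap_perm a b + g) \<noteq> 0" using assms by (simp add: coef_sg_mult)
  then have "\<bar>app (swap_perm a b + g) (int j)\<bar> = int j"
    using assms(1) h(2) unfolding fixes_above_def by blast
  then show "\<bar>app g (int j)\<bar> = int j"
    using h(2) assms(2-5) by (auto simp: app_swap_perm_abs split: if_splits)
qed

lemma fixes_above_reg_phi:
  assumes "fixes_above k X" "j < k" "\<not> S 0"
  shows "fixes_above k (reg_phi S \<alpha> k j * X)"
  using assms(2)
proof (induction j)
  case (Suc j)
  have "1 \<le> j" if "S j" using that assms(3) by (cases j) auto
  then show ?case
    using Suc by (auto simp: distrib_right mult.assoc intro!: fixes_above_add fixes_above_smul fixes_above_sg)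
qed (use assms in simp)

text \<open>Elements of the support that do not fix k up to sign send it to a letter of size at most
  j, which the next factor (j + 1, k) leaves alone. So nothing returns to fixing k, and coefficients
  at elements fixing k up to sign never change.\<close>

lemma coef_phi:
  assumes "fixes_above (k - 1) X" "j < k"
  shows "(\<forall>g. coef (phi \<alpha> k j * X) g \<noteq> 0 \<longrightarrow> \<bar>app g (int k)\<bar> = int k \<or> \<bar>app g (int k)\<bar> \<le> int j) \<and>
    (\<forall>g. \<bar>app g (int k)\<bar> = int k \<longrightarrow> coef (phi \<alpha> k j * X) g = coef X g)"
  using assms(2)
proof (induction j)
  case 0
  then show ?case using assms unfolding fixes_above_def by auto
next
  case (Suc j)
  let ?W = "phi \<alpha> k j * X"
  have IH: "\<And>g. coef ?W g \<noteq> 0 \<Longrightarrow> \<bar>app g (int k)\<bar> = int k \<or> \<bar>app g (int k)\<bar> \<le> int j"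
    "\<And>g. \<bar>app g (int k)\<bar> = int k \<Longrightarrow> coef ?W g = coef X g" using Suc by auto
  have c: "coef (phi \<alpha> k (Suc j) * X) g = coef ?W g + \<alpha> (Suc j) k * coef ?W (swap_perm (Suc j) k + g)" for g
    using Suc.prems by (simp add: distrib_right mult.assoc lookup_add coef_sg_mult)
  have t: "\<bar>app (swap_perm (Suc j) k + g) (int k)\<bar> = (if \<bar>app g (int k)\<bar> = int (Suc j) then int k
      else if \<bar>app g (int k)\<bar> = int k then int (Suc j) else \<bar>app g (int k)\<bar>)" for g
    using Suc.prems by (simp add: app_swap_perm_abs)
  have z: "coef ?W (swap_perm (Suc j) k + g) = 0" if "\<bar>app g (int k)\<bar> = int k" for g
  proof (rule ccontr)
    assume "coef ?W (swap_perm (Suc j) k + g) \<noteq> 0"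
    from IH(1)[OF this] show False using t[of g] that Suc.prems by auto
  qed
  have "\<bar>app g (int k)\<bar> = int k \<or> \<bar>app g (int k)\<bar> \<le> int (Suc j)"
    if "coef (phi \<alpha> k (Suc j) * X) g \<noteq> 0" for g
  proof -
    have "coef ?W g \<noteq> 0 \<or> coef ?W (swap_perm (Suc j) k + g) \<noteq> 0" using that c by auto
    then show ?thesis using IH(1)[of g] IH(1)[of "swap_perm (Suc j) k + g"] t[of g] by (auto split: if_splits)
  qed
  then show ?case using c z IH(2) by auto
qed

lemma coef_phi_0:
  assumes "fixes_above (k - 1) X" "1 \<le> k"
  shows "coef (phi \<alpha> k (k - 1) * X) 0 = coef X 0"
  using coef_phi[OF assms(1), of "k - 1" \<alpha>] assms(2) by simp

lemma sign_idem_support: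
  "(\<forall>g. coef (sign_idem q k) g \<noteq> 0 \<longrightarrow> (\<forall>j. \<bar>app g (int j)\<bar> = int j \<and> (k < j \<longrightarrow> app g (int j) = int j))) \<and>
   coef (sign_idem q k) 0 = 1 / 2 ^ k"
proof (induction k)
  case 0
  show ?case by (auto simp: lookup_one when_def)
next
  case (Suc k)
  have fm: "- flip_perm (Suc k) = flip_perm (Suc k)" using swap_perm_rels(5) minus_unique by metis
  have c: "coef (sign_idem q (Suc k)) g = (1 / 2) * (coef (sign_idem q k) g + q (Suc k) * coef (sign_idem q k) (flip_perm (Suc k) + g))" for g
    by (simp add: sign_proj_def distrib_right lookup_add tau_def fm)
  have f: "app (flip_perm (Suc k) + g) (int j) = (if \<bar>app g (int j)\<bar> = int (Suc k) then - app g (int j) else app g (int j))"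
    for g j by (auto simp: app_flip_perm)
  have "coef (sign_idem q k) (flip_perm (Suc k)) = 0"
  proof (rule ccontr)
    assume "coef (sign_idem q k) (flip_perm (Suc k)) \<noteq> 0"
    then have "app (flip_perm (Suc k)) (int (Suc k)) = int (Suc k)" using Suc by blast
    then show False by (simp add: app_flip_perm)
  qed
  then have "coef (sign_idem q (Suc k)) 0 = 1 / 2 ^ Suc k" using Suc c[of 0] by simp
  moreover have "\<bar>app g (int j)\<bar> = int j \<and> (Suc k < j \<longrightarrow> app g (int j) = int j)"
    if "coef (sign_idem q (Suc k)) g \<noteq> 0" for g j
  proof -
    have "coef (sign_idem q k) g \<noteq> 0 \<or> coef (sign_idem q k) (flip_perm (Suc k) + g) \<noteq> 0" using that c[of g] by auto
    then show ?thesis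
    proof
      assume "coef (sign_idem q k) g \<noteq> 0"
      then show ?thesis using Suc by auto
    next
      assume "coef (sign_idem q k) (flip_perm (Suc k) + g) \<noteq> 0"
      then have "\<bar>app (flip_perm (Suc k) + g) (int j)\<bar> = int j \<and> (k < j \<longrightarrow> app (flip_perm (Suc k) + g) (int j) = int j)"
        using Suc by blast
      then show ?thesis unfolding f by (auto split: if_splits)
    qed
  qed
  ultimately show ?case by blast
qed

section \<open>The anti-involution\<close>

text \<open>Inversion is extended linearly and not conjugate linearly, so that left weights become
  right weights with the same values.\<close>

definition star :: "galg \<Rightarrow> galg" where
  "star X = (\<Sum>g\<in>keys X. Poly_Mapping.single (- g) (coef X g))"

lemma coef_star [simp]: "coef (star X) g = coef X (- g)"
proof -
  have "coef (star X) g = (\<Sum>h\<in>keys X. if h = - g then coef X h else 0)"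
    unfolding star_def lookup_sum
    by (rule sum.cong) (auto simp: lookup_single when_def)
  then show ?thesis by (simp add: in_keys_iff)
qed

lemma star_star: "star (star X) = X"
  by (rule poly_mapping_eqI) simp

lemma star_add: "star (X + Y) = star X + star Y"
  by (rule poly_mapping_eqI) (simp add: lookup_add)

lemma star_smul: "star (c \<cdot> X) = c \<cdot> star X"
  by (rule poly_mapping_eqI) simp

lemma star_gr: "star (gr g) = gr (- g)"
  by (rule poly_mapping_eqI) (auto simp: lookup_single when_def)

lemma star_sum: "star (\<Sum>i\<in>I. f i) = (\<Sum>i\<in>I. star (f i))"
  by (rule poly_mapping_eqI) (simp add: lookup_sum)

lemma star_mult: "star (X * Y) = star Y * star X"
proof -
  have 1: "star (gr g * Y) = star Y * gr (- g)" for g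
    by (rule poly_mapping_eqI) (simp add: minus_add)
  show ?thesis
    by (subst galg_expand[of X], subst (2) galg_expand[of X])
       (simp add: sum_distrib_left sum_distrib_right star_sum star_smul 1 star_gr)
qed

lemma star_1: "star 1 = 1"
  using star_gr[of 0] by simp

lemma star_sg: "a > 0 \<Longrightarrow> b > 0 \<Longrightarrow> star (sg a b) = sg a b"
  by (simp add: sg_def star_gr uminus_swap_perm)

lemma star_tau: "star (tau a) = tau a"
  using swap_perm_rels(5) minus_unique by (metis tau_def star_gr)

lemma star_jm: "star (jm k) = jm k"
proof -
  have "star (jm_summand m k) = jm_summand m k" if m: "m \<in> {1..<k}" for m
  proof -
    have e: "sg m k * (1 + tau k * tau m) = (1 + tau m * tau k) * sg m k"
      using m tau_sg[of m k] tau_sg2[of m k]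
      by (simp add: distrib_left distrib_right) (metis mult.assoc)
    have "star (jm_summand m k) = (1 / 2) \<cdot> (sg m k * (1 + tau k * tau m))"
      using m by (simp add: jm_summand_def star_smul star_mult star_add star_1 star_sg star_tau)
    then show ?thesis by (simp add: jm_summand_def e)
  qed
  then show ?thesis by (simp add: jm_def star_sum)
qed

lemma right_weight_iff_star: "right_weight N p c X \<longleftrightarrow> left_weight N p c (star X)"
proof -
  have "X * Y = a \<cdot> X \<longleftrightarrow> star Y * star X = a \<cdot> star X" for Y a
    by (metis star_mult star_smul star_star)
  then show ?thesis by (simp add: right_weight_def left_weight_def star_tau star_jm)
qed

lemma left_weight_mult_right: "left_weight N p c X \<Longrightarrow> left_weight N p c (X * Y)"
  by (auto simp: left_weight_def mult.assoc[symmetric])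

lemma right_weight_mult_left: "right_weight N p c X \<Longrightarrow> right_weight N p c (Y * X)"
  by (auto simp: right_weight_def mult.assoc)

lemma left_weight_smul: "left_weight N p c X \<Longrightarrow> left_weight N p c (a \<cdot> X)"
  by (auto simp: left_weight_def mult.commute)

lemma right_weight_smul: "right_weight N p c X \<Longrightarrow> right_weight N p c (a \<cdot> X)"
  by (auto simp: right_weight_def mult.commute)

lemma right_weight_intertwine:
  assumes X: "right_weight N p c X" and i: "1 \<le> i" "i < N" and p: "p i = 1 \<or> p i = - 1" "p (Suc i) = 1 \<or> p (Suc i) = - 1"
    and a: "a * (c i - c (Suc i)) = (if p i = p (Suc i) then 1 else 0)"
    and a0: "p i \<noteq> p (Suc i) \<Longrightarrow> a = 0"
  shows "right_weight N (\<lambda>m. p (swap i (Suc i) m)) (\<lambda>m. c (swap i (Suc i) m))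
           (X * (sg i (Suc i) + a \<cdot> 1))"
  using left_weight_intertwine[of N p c "star X" i a] assms
  by (simp add: right_weight_iff_star star_mult star_add star_smul star_sg star_1)

text \<open>The trace of jm (i + 1) s_i X is evaluated once by the exchange relation and once by
  moving jm (i + 1) cyclically to the right of X.\<close>

lemma coef_s_weight:
  assumes "left_weight N p c X" "right_weight N p c X" "1 \<le> i" "i < N" "p i = p (Suc i)" "p i * p i = 1"
  shows "(c (Suc i) - c i) * coef (sg i (Suc i) * X) 0 = coef X 0"
proof -
  let ?s = "sg i (Suc i)"
  have w: "tau m * X = p m \<cdot> X" "jm m * X = c m \<cdot> X" "X * jm m = c m \<cdot> X" if "m \<in> {i, Suc i}" for m
    using assms that by (auto simp: left_weight_def right_weight_def)
  have "jm (Suc i) * (?s * X) = c i \<cdot> (?s * X) + X"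
    using arg_cong[OF jm_Suc_s[OF assms(3)], of "\<lambda>Z. Z * X"] w[of i] w[of "Suc i"] assms(5,6)
    by (simp add: distrib_right mult.assoc av.scale_right_distrib flip: av.scale_left_distrib)
  then have "coef (jm (Suc i) * (?s * X)) 0 = c i * coef (?s * X) 0 + coef X 0"
    by (simp add: lookup_add)
  moreover have "coef (jm (Suc i) * (?s * X)) 0 = c (Suc i) * coef (?s * X) 0"
    by (subst coef_0_commute) (simp add: mult.assoc w)
  ultimately show ?thesis by (simp add: algebra_simps)
qed

section \<open>The value of the fusion product\<close>

lemma reg_phi_commute:
  assumes "\<And>m. 1 \<le> m \<Longrightarrow> m \<le> j \<Longrightarrow> Y * sg m k = sg m k * Y" "\<not> S 0"
  shows "Y * reg_phi S \<alpha> k j = reg_phi S \<alpha> k j * Y"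
  using assms(1)
proof (induction j)
  case (Suc j)
  have 1: "Y * sg (Suc j) k = sg (Suc j) k * Y" using Suc.prems by simp
  have 2: "Y * sg j k = sg j k * Y" if "S j"
    using Suc.prems[of j] that assms(2) by (cases j) auto
  have "Y * (if S (Suc j) then 1 else if S j then 1 + \<alpha> (Suc j) k \<cdot> (sg j k + sg (Suc j) k)
     else 1 + \<alpha> (Suc j) k \<cdot> sg (Suc j) k) = (if S (Suc j) then 1
     else if S j then 1 + \<alpha> (Suc j) k \<cdot> (sg j k + sg (Suc j) k)
     else 1 + \<alpha> (Suc j) k \<cdot> sg (Suc j) k) * Y"
    using 1 2 by (simp add: galg_simps)
  then show ?case unfolding reg_phi.simps by (rule mult_pass) (use Suc in simp)
qed simp

text \<open>The instance for the path: a parameter \<epsilon> > 0 tending to 0 displaces a single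
  content.\<close>

interpretation lim: coef_limit "\<lambda>f c. (f \<longlongrightarrow> c) (at_right (0::real))" "{0<..}"
proof
  fix f g :: "real \<Rightarrow> complex" and a
  assume "\<And>y. y \<in> {0<..} \<Longrightarrow> f y = g y" "(f \<longlongrightarrow> a) (at_right 0)"
  then show "(g \<longlongrightarrow> a) (at_right 0)"
    by (elim Lim_transform_eventually) (auto simp: eventually_at_right_less intro: eventually_mono[OF eventually_at_right_less])
qed (auto intro: tendsto_intros)

lemma lim_regA_unique: "lim.regA F V \<Longrightarrow> lim.regA F W \<Longrightarrow> V = W"
  unfolding lim.regA_def by (intro poly_mapping_eqI) (metis tendsto_unique trivial_limit_at_right_real)

context bipart
begin

definition pT :: "bitableau \<Rightarrow> nat \<Rightarrow> complex" where "pT T m = complex_of_int (sgn_p l T m)"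
definition cT :: "bitableau \<Rightarrow> nat \<Rightarrow> complex" where "cT T m = complex_of_int (ct T m)"

definition alT :: "bitableau \<Rightarrow> (nat \<Rightarrow> complex) \<Rightarrow> nat \<Rightarrow> nat \<Rightarrow> complex" where
  "alT T u m k = (if pT T m = pT T k then 1 else 0) / (u k - u m)"

definition sing :: "bitableau \<Rightarrow> nat \<Rightarrow> nat \<Rightarrow> bool" where
  "sing T k m \<longleftrightarrow> 1 \<le> m \<and> m < k \<and> pT T m = pT T k \<and> cT T m = cT T k"

text \<open>The value of the fusion product for a hook-ordered tableau. The common value of the z_i
  drops out of all differences, so only contents enter.\<close>

primrec reg_fusR :: "bitableau \<Rightarrow> nat \<Rightarrow> galg" where
  "reg_fusR T 0 = 1"
| "reg_fusR T (Suc k) = reg_phi (sing T (Suc k)) (alT T (cT T)) (Suc k) k * reg_fusR T k"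

lemma pT_cases: "pT T m = 1 \<or> pT T m = - 1"
  using sgn_p_cases[of T m] by (auto simp: pT_def)

lemma pT_sq: "pT T m * pT T m = 1"
  using pT_cases[of T m] by auto

lemma pT_eq_iff: "T \<in> SYT \<Longrightarrow> i \<in> {1..n} \<Longrightarrow> j \<in> {1..n} \<Longrightarrow> pT T i = pT T j \<longleftrightarrow> cmp T i = cmp T j"
  using sgn_p_eq_iff by (simp add: pT_def)

lemma cT_eq_iff: "cT T i = cT T j \<longleftrightarrow> ct T i = ct T j"
  by (simp add: cT_def)

lemma yang_baxter_alT:
  assumes "\<And>i j. i \<in> {1..n} \<Longrightarrow> j \<in> {1..n} \<Longrightarrow> i \<noteq> j \<Longrightarrow> pT T i = pT T j \<Longrightarrow> u i \<noteq> u j"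
  shows "yang_baxter n (alT T u)"
proof -
  have 1: "alT T u j i = - alT T u i j" for i j
    by (simp add: alT_def) (metis minus_diff_eq minus_divide_right)
  have 2: "alT T u i j * alT T u j k = alT T u i k * (alT T u i j + alT T u j k)"
    if "i \<in> {1..n}" "j \<in> {1..n}" "k \<in> {1..n}" "i \<noteq> j" "k \<noteq> i" "k \<noteq> j" for i j k
  proof (cases "pT T i = pT T j \<and> pT T j = pT T k")
    case True
    then have "u j - u i \<noteq> 0" "u k - u j \<noteq> 0" "u k - u i \<noteq> 0" using assms that by auto
    then show ?thesis using True by (simp add: alT_def field_simps)
  next
    case False
    then show ?thesis by (auto simp: alT_def)
  qed
  show ?thesis unfolding yang_baxter_def using 1 2 by blast
qed

text \<open>An order count at the content of k. Every double pole, from an earlier node on the same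
  diagonal, is matched with one zero from each adjacent diagonal. By \<open>diagonal_counts\<close>
  a zero is left over, unless the content and with it the leading factor u tends to 0.\<close>

lemma resolvent_numerator_limit:
  assumes T: "T \<in> SYT" and k: "k \<in> {1..n}"
  shows "((\<lambda>\<epsilon>. resolvent_numerator (pT T) (pT T k) (cT T) k (cT T k + \<i> * of_real \<epsilon>)) \<longlongrightarrow> 0) (at_right 0)"
proof -
  define N where "N d = {m \<in> {1..<k}. cmp T m = cmp T k \<and> ct T m = ct T k + d}" for d
  define M where "M = {m \<in> {1..<k}. cmp T m = cmp T k}"
  define R where "R = M - (N 0 \<union> N 1 \<union> N (- 1))"
  define w where "w d \<epsilon> = 1 - 1 / (\<i> * of_real \<epsilon> - of_int d)\<^sup>2" for d :: int and \<epsilon> :: real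
  \<comment> \<open>The joint factor of one node on each of the diagonals at distance 0, 1 and -1;
    its poles at \<epsilon> = 0 cancel and it tends to 4.\<close>
  define W where "W \<epsilon> = ((\<i> * of_real \<epsilon>)\<^sup>2 - 4) / ((\<i> * of_real \<epsilon>)\<^sup>2 - 1)" for \<epsilon> :: real
  define n0 where "n0 = card (N 0)"
  have cnt: "n0 \<le> card (N 1)" "n0 \<le> card (N (- 1))"
    "ct T k \<noteq> 0 \<Longrightarrow> 2 * n0 + 1 \<le> card (N 1) + card (N (- 1))"
    using diagonal_counts[OF T k] unfolding N_def n0_def by auto
  obtain i where i: "card (N 1) = n0 + i" using cnt(1) le_Suc_ex by blast
  obtain j where j: "card (N (- 1)) = n0 + j" using cnt(2) le_Suc_ex by blast
  have ij: "cT T k = 0 \<or> i > 0 \<or> j > 0" using cnt(3) i j by (auto simp: cT_def)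
  have fin: "finite M" "finite (N d)" "finite R" for d by (auto simp: M_def N_def R_def)
  have prod: "(\<Prod>m\<in>M. w (ct T m - ct T k) \<epsilon>) =
      w 0 \<epsilon> ^ n0 * (w 1 \<epsilon> ^ (n0 + i) * (w (- 1) \<epsilon> ^ (n0 + j) * (\<Prod>m\<in>R. w (ct T m - ct T k) \<epsilon>)))" for \<epsilon>
  proof -
    have "M = N 0 \<union> (N 1 \<union> (N (- 1) \<union> R))" by (auto simp: R_def M_def N_def)
    moreover have "(\<Prod>m\<in>N d. w (ct T m - ct T k) \<epsilon>) = w d \<epsilon> ^ card (N d)" for d
    proof -
      have "(\<Prod>m\<in>N d. w (ct T m - ct T k) \<epsilon>) = (\<Prod>m\<in>N d. w d \<epsilon>)"
        by (rule prod.cong) (auto simp: N_def)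
      then show ?thesis by simp
    qed
    moreover have "N 0 \<inter> (N 1 \<union> (N (- 1) \<union> R)) = {}" "N 1 \<inter> (N (- 1) \<union> R) = {}" "N (- 1) \<inter> R = {}"
      by (auto simp: N_def R_def)
    ultimately show ?thesis
      using i j fin by (simp add: prod.union_disjoint n0_def)
  qed
  have f: "resolvent_numerator (pT T) (pT T k) (cT T) k (cT T k + \<i> * of_real \<epsilon>)
     = (cT T k + \<i> * of_real \<epsilon>) * (\<Prod>m\<in>M. w (ct T m - ct T k) \<epsilon>)" for \<epsilon>
  proof -
    have e: "cT T k + \<i> * of_real \<epsilon> - cT T m = \<i> * of_real \<epsilon> - of_int (ct T m - ct T k)" for m
      by (simp add: cT_def)
    have "(\<Prod>m\<in>{1..<k}. if pT T m = pT T k then 1 - 1 / (cT T k + \<i> * of_real \<epsilon> - cT T m)\<^sup>2 else 1)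
        = (\<Prod>m\<in>{1..<k}. if cmp T m = cmp T k then w (ct T m - ct T k) \<epsilon> else 1)"
      by (rule prod.cong) (use pT_eq_iff[OF T _ k] k in \<open>auto simp: e w_def\<close>)
    also have "\<dots> = (\<Prod>m\<in>M. w (ct T m - ct T k) \<epsilon>)"
      unfolding M_def by (rule prod.inter_filter[symmetric]) simp
    finally show ?thesis by (simp add: resolvent_numerator_def)
  qed
  have W: "w 0 \<epsilon> * w 1 \<epsilon> * w (- 1) \<epsilon> = W \<epsilon>" if "\<epsilon> > 0" for \<epsilon>
  proof -
    define x where "x = \<i> * complex_of_real \<epsilon>"
    have x: "x \<noteq> 0" "x - 1 \<noteq> 0" "x + 1 \<noteq> 0" using that by (auto simp: x_def complex_eq_iff)
    have "(1 - 1 / x\<^sup>2) * (1 - 1 / (x - 1)\<^sup>2) * (1 - 1 / (x + 1)\<^sup>2) = (x\<^sup>2 - 4) / (x\<^sup>2 - 1)"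
    proof -
      have x1: "x\<^sup>2 - 1 = (x - 1) * (x + 1)" by (simp add: power2_eq_square algebra_simps)
      have sq: "1 - 1 / y\<^sup>2 = ((y - 1) * (y + 1)) / y\<^sup>2" if "y \<noteq> 0" for y :: complex
        using that by (simp add: field_simps power2_eq_square)
      have a: "1 - 1 / x\<^sup>2 = ((x - 1) * (x + 1)) / x\<^sup>2" using x by (intro sq) auto
      have b: "1 - 1 / (x - 1)\<^sup>2 = (x * (x - 2)) / (x - 1)\<^sup>2"
        using sq[OF x(2)] by (simp add: mult.commute)
      have c: "1 - 1 / (x + 1)\<^sup>2 = (x * (x + 2)) / (x + 1)\<^sup>2"
        using sq[OF x(3)] by (simp add: add.assoc)
      have d: "x\<^sup>2 - 4 = (x - 2) * (x + 2)" by (simp add: power2_eq_square algebra_simps)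
      show ?thesis unfolding a b c d x1 using x by (simp add: power2_eq_square)
    qed
    then show ?thesis by (simp add: w_def W_def x_def)
  qed
  have tw: "(w d \<longlongrightarrow> 1 - 1 / (of_int d)\<^sup>2) (at_right 0)" if "d \<noteq> 0" for d
  proof -
    have "((\<lambda>\<epsilon>. 1 - 1 / (\<i> * of_real \<epsilon> - of_int d)\<^sup>2) \<longlongrightarrow> 1 - 1 / (\<i> * of_real 0 - of_int d)\<^sup>2) (at_right (0::real))"
      using that by (intro tendsto_intros) auto
    then show ?thesis by (simp add: w_def[abs_def])
  qed
  have tW: "(W \<longlongrightarrow> 4) (at_right 0)"
  proof -
    have "(W \<longlongrightarrow> ((\<i> * of_real 0)\<^sup>2 - 4) / ((\<i> * of_real 0)\<^sup>2 - 1)) (at_right 0)"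
      unfolding W_def by (intro tendsto_intros) auto
    then show ?thesis by simp
  qed
  have tR: "((\<lambda>\<epsilon>. \<Prod>m\<in>R. w (ct T m - ct T k) \<epsilon>) \<longlongrightarrow> (\<Prod>m\<in>R. 1 - 1 / (of_int (ct T m - ct T k))\<^sup>2)) (at_right 0)"
    by (rule tendsto_prod, rule tw) (auto simp: R_def M_def N_def)
  have u: "((\<lambda>\<epsilon>. cT T k + \<i> * of_real \<epsilon>) \<longlongrightarrow> cT T k + \<i> * of_real 0) (at_right 0)"
    by (intro tendsto_intros)
  have "((\<lambda>\<epsilon>. (cT T k + \<i> * of_real \<epsilon>) * (W \<epsilon> ^ n0 * (w 1 \<epsilon> ^ i * (w (- 1) \<epsilon> ^ j *
      (\<Prod>m\<in>R. w (ct T m - ct T k) \<epsilon>))))) \<longlongrightarrow>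
      (cT T k + \<i> * of_real 0) * (4 ^ n0 * ((1 - 1 / (of_int 1)\<^sup>2) ^ i * ((1 - 1 / (of_int (- 1))\<^sup>2) ^ j *
      (\<Prod>m\<in>R. 1 - 1 / (of_int (ct T m - ct T k))\<^sup>2))))) (at_right 0)"
    by (intro tendsto_mult tendsto_power u tW tR tw) auto
  \<comment> \<open>The left-over zero is 1 - 1/1 raised to a positive power i or j, or else the
    content itself.\<close>
  then have "((\<lambda>\<epsilon>. (cT T k + \<i> * of_real \<epsilon>) * (W \<epsilon> ^ n0 * (w 1 \<epsilon> ^ i * (w (- 1) \<epsilon> ^ j *
      (\<Prod>m\<in>R. w (ct T m - ct T k) \<epsilon>))))) \<longlongrightarrow> 0) (at_right 0)"
    using ij by (auto simp: power_0_left)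
  then show ?thesis
  proof (rule lim.reg_cong[rotated])
    fix \<epsilon> :: real assume "\<epsilon> \<in> {0<..}"
    then have "W \<epsilon> = w 0 \<epsilon> * w 1 \<epsilon> * w (- 1) \<epsilon>" using W by simp
    then show "(cT T k + \<i> * of_real \<epsilon>) * (W \<epsilon> ^ n0 * (w 1 \<epsilon> ^ i * (w (- 1) \<epsilon> ^ j *
        (\<Prod>m\<in>R. w (ct T m - ct T k) \<epsilon>)))) = resolvent_numerator (pT T) (pT T k) (cT T) k (cT T k + \<i> * of_real \<epsilon>)"
      unfolding f prod by (simp add: power_mult_distrib power_add mult_ac)
  qed
qed

lemma hook_singular:
  assumes "T \<in> SYT" "hook_ordered T" "k \<le> n" "sing T k m"
  shows "1 \<le> m" "Suc m < k" "pT T (Suc m) = pT T m" "pT T m = pT T k" "cT T m = cT T k"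
    "cT T (Suc m) - cT T m = 1 \<or> cT T (Suc m) - cT T m = - 1" "same_hook l T m (Suc m)"
    "\<not> sing T k (Suc m)"
proof -
  have s: "1 \<le> m" "m < k" "pT T m = pT T k" "cT T m = cT T k" using assms(4) by (auto simp: sing_def)
  have r: "m \<in> {1..n}" "k \<in> {1..n}" using s assms(3) by auto
  have h: "Suc m < k" "cmp T (Suc m) = cmp T m" "ct T (Suc m) = ct T m + 1 \<or> ct T (Suc m) = ct T m - 1"
    "same_hook l T m (Suc m)"
    using hook_ordered_singular[OF assms(1,2,3) s(1,2)] s(3,4) pT_eq_iff[OF assms(1) r] cT_eq_iff by auto
  show "1 \<le> m" "Suc m < k" "same_hook l T m (Suc m)" "pT T m = pT T k" "cT T m = cT T k" by fact+
  show "pT T (Suc m) = pT T m" using h(1,2) r assms(3) pT_eq_iff[OF assms(1), of "Suc m" m] by auto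
  show e: "cT T (Suc m) - cT T m = 1 \<or> cT T (Suc m) - cT T m = - 1" using h(3) by (auto simp: cT_def)
  show "\<not> sing T k (Suc m)" using e s(4) by (auto simp: sing_def)
qed

lemma jm_reg_fusR: "k < j \<Longrightarrow> jm j * reg_fusR T k = reg_fusR T k * jm j"
proof (induction k)
  case (Suc k)
  have "jm j * reg_phi (sing T (Suc k)) (alT T (cT T)) (Suc k) k = reg_phi (sing T (Suc k)) (alT T (cT T)) (Suc k) k * jm j"
    by (rule reg_phi_commute) (use Suc.prems in \<open>auto intro!: jm_sg simp: sing_def\<close>)
  then show ?case unfolding reg_fusR.simps by (rule mult_pass) (use Suc in simp)
qed simp

text \<open>Induction on k with the value X for k - 1 held fixed. Only u_k = c_k + i \<epsilon>
  moves, so row k acts on a constant weight vector, where the resolvent identity holds; as its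
  numerator tends to 0, the limit becomes an eigenvector of \<open>jm k\<close>. The coefficient of
  the identity stays that of the sign projector.\<close>

lemma hook_value:
  assumes T: "T \<in> SYT" "hook_ordered T" and "k \<le> n"
  defines "P \<equiv> sign_idem (pT T) n"
  shows "(\<forall>m\<in>{1..n}. tau m * (reg_fusR T k * P) = pT T m \<cdot> (reg_fusR T k * P)) \<and>
    (\<forall>m\<in>{1..k}. jm m * (reg_fusR T k * P) = cT T m \<cdot> (reg_fusR T k * P) \<and> (reg_fusR T k * P) * jm m = cT T m \<cdot> (reg_fusR T k * P)) \<and>
    coef (reg_fusR T k * P) 0 = 1 / 2 ^ n \<and> fixes_above k (reg_fusR T k * P)"
  using assms(3)
proof (induction k)
  case 0
  show ?case
    using tau_sign_idem[of _ n "pT T"] pT_cases sign_idem_support[of "pT T" n] by (auto simp: P_def fixes_above_def)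
next
  case (Suc k')
  define k where "k = Suc k'"
  define X where "X = reg_fusR T k' * P"
  have kn: "k \<in> {1..n}" and k': "k - 1 = k'" using Suc.prems by (auto simp: k_def)
  have X: "\<And>m. m \<in> {1..n} \<Longrightarrow> tau m * X = pT T m \<cdot> X"
    "\<And>m. 1 \<le> m \<Longrightarrow> m < k \<Longrightarrow> jm m * X = cT T m \<cdot> X" "\<And>m. 1 \<le> m \<Longrightarrow> m < k \<Longrightarrow> X * jm m = cT T m \<cdot> X"
    "coef X 0 = 1 / 2 ^ n" "fixes_above (k - 1) X"
    using Suc by (auto simp: X_def k_def)
  define S where "S = sing T k"
  define E where "E = reg_phi S (alT T (cT T)) k k' * X"
  have E: "E = reg_fusR T k * P" by (simp add: E_def X_def S_def k_def mult.assoc)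
  define u where "u \<epsilon> = cT T k + \<i> * complex_of_real \<epsilon>" for \<epsilon>
  define \<alpha> where "\<alpha> \<epsilon> = spec_alpha (pT T) (pT T k) (cT T) (u \<epsilon>)" for \<epsilon>
  define Z where "Z \<epsilon> = phi (\<alpha> \<epsilon>) k k' * X" for \<epsilon>
  define f where "f \<epsilon> = resolvent_numerator (pT T) (pT T k) (cT T) k (u \<epsilon>)" for \<epsilon>
  have Imu: "Im (u \<epsilon>) \<noteq> 0" if "\<epsilon> > 0" for \<epsilon> using that by (simp add: u_def cT_def)
  have Zr: "Z \<epsilon> = reg_phi S (\<alpha> \<epsilon>) k k' * X" if \<epsilon>: "\<epsilon> \<in> {0<..}" for \<epsilon>
  proof -
    have "\<not> S k'" using hook_singular(2)[OF T, of k k'] kn by (auto simp: S_def k_def)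
    moreover have "phi (\<alpha> \<epsilon>) k (if S k' then k' - 1 else k') * X = reg_phi S (\<alpha> \<epsilon>) k k' * X"
    proof (rule phi_eq_reg_phi)
      fix m assume "S m" "m < k"
      note h = hook_singular[OF T, of k m, folded S_def, OF _ this(1)]
      let ?e = "cT T (Suc m) - cT T m"
      have h': "1 \<le> m" "Suc m < k" "pT T (Suc m) = pT T m" "pT T m = pT T k" "cT T m = cT T k"
        "?e = 1 \<or> ?e = - 1" "\<not> S (Suc m)" using h kn by auto
      \<comment> \<open>m and m + 1 are neighbours in a hook, so the weights already known for X
        force the sign.\<close>
      have "sg m (Suc m) * X = ?e \<cdot> X"
      proof (rule left_weight_adjacent)
        show "tau m * X = pT T m \<cdot> X" "tau (Suc m) * X = pT T m \<cdot> X"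
          using X(1)[of m] X(1)[of "Suc m"] h' kn by auto
        show "jm m * X = cT T m \<cdot> X" "jm (Suc m) * X = (cT T m + ?e) \<cdot> X" using X(2) h' by auto
      qed (use h' pT_sq in \<open>auto simp: cT_def\<close>)
      moreover have "\<alpha> \<epsilon> m k + ?e * \<alpha> \<epsilon> m k * \<alpha> \<epsilon> (Suc m) k = \<alpha> \<epsilon> (Suc m) k"
      proof -
        define \<eta> where "\<eta> = u \<epsilon> - cT T m"
        have "\<eta> \<noteq> 0" "\<eta> - ?e \<noteq> 0"
          using \<epsilon> h'(6) by (auto simp: \<eta>_def u_def cT_def complex_eq_iff)
        then have "1 / \<eta> + ?e * (1 / \<eta>) * (1 / (\<eta> - ?e)) = 1 / (\<eta> - ?e)"
          by (simp add: divide_simps)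
        moreover have "\<alpha> \<epsilon> m k = 1 / \<eta>" "\<alpha> \<epsilon> (Suc m) k = 1 / (\<eta> - ?e)"
          using h'(3,4) by (auto simp: \<alpha>_def \<eta>_def)
        ultimately show ?thesis by (simp only:)
      qed
      ultimately show "1 \<le> m \<and> Suc m < k \<and> \<not> S (Suc m) \<and> sg m (Suc m) * X = ?e \<cdot> X \<and>
          \<alpha> \<epsilon> m k + ?e * \<alpha> \<epsilon> m k * \<alpha> \<epsilon> (Suc m) k = \<alpha> \<epsilon> (Suc m) k" using h' by simp
    qed (simp add: k_def)
    ultimately show ?thesis by (simp add: Z_def)
  qed
  have ZE: "lim.regA Z E"
  proof -
    have "lim.regA (\<lambda>\<epsilon>. reg_phi S (\<alpha> \<epsilon>) k k' * X) (reg_phi S (alT T (cT T)) k k' * X)"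
    proof (rule lim.regA_reg_phi[OF _ lim.regA_const])
      fix m assume m: "1 \<le> m" "m \<le> k'" "\<not> S m"
      show "((\<lambda>\<epsilon>. \<alpha> \<epsilon> m k) \<longlongrightarrow> alT T (cT T) m k) (at_right 0)"
      proof (cases "pT T m = pT T k")
        case True
        then have ne: "cT T k - cT T m \<noteq> 0" using m by (auto simp: S_def sing_def k_def)
        have "((\<lambda>\<epsilon>. 1 / (cT T k + \<i> * complex_of_real \<epsilon> - cT T m)) \<longlongrightarrow>
            1 / (cT T k + \<i> * complex_of_real 0 - cT T m)) (at_right 0)"
          using ne by (intro tendsto_intros) auto
        then show ?thesis using True by (simp add: \<alpha>_def u_def alT_def)
      qed (simp add: \<alpha>_def alT_def)
    qed
    then show ?thesis unfolding E_def by (rule lim.regA_cong[rotated]) (simp add: Zr)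
  qed
  have u: "(u \<longlongrightarrow> cT T k) (at_right 0)"
  proof -
    have "(u \<longlongrightarrow> cT T k + \<i> * complex_of_real 0) (at_right 0)" unfolding u_def by (intro tendsto_intros)
    then show ?thesis by simp
  qed
  have f0: "(f \<longlongrightarrow> 0) (at_right 0)" unfolding f_def u_def by (rule resolvent_numerator_limit[OF T(1) kn])
  have uf: "lim.regA (\<lambda>\<epsilon>. u \<epsilon> \<cdot> Z \<epsilon> - f \<epsilon> \<cdot> X) (cT T k \<cdot> E)"
    using lim.regA_diff[OF lim.regA_smul[OF u ZE] lim.regA_smul[OF f0 lim.regA_const[of X]]] by simp
  have res: "jm k * Z \<epsilon> = u \<epsilon> \<cdot> Z \<epsilon> - f \<epsilon> \<cdot> X" if "\<epsilon> > 0" for \<epsilon>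
    unfolding Z_def \<alpha>_def f_def k'[symmetric]
    by (rule phi_resolvent) (use X(1,2) kn pT_cases Imu[OF that] in \<open>auto simp: cT_def\<close>)
  have tauE: "tau m * E = pT T m \<cdot> E" if m: "m \<in> {1..n}" for m
  proof -
    have "tau m * Z \<epsilon> = pT T m \<cdot> Z \<epsilon>" for \<epsilon>
    proof -
      have "(\<forall>m. 1 \<le> m \<longrightarrow> m \<noteq> k \<longrightarrow> m \<le> n \<longrightarrow> tau m * Z \<epsilon> = pT T m \<cdot> Z \<epsilon>) \<and> tau k * Z \<epsilon> = pT T k \<cdot> Z \<epsilon>"
        unfolding Z_def by (rule phi_weights) (use X(1) kn in \<open>auto simp: k_def \<alpha>_def split: if_splits\<close>)
      then show ?thesis using m by (cases "m = k") auto
    qed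
    then show ?thesis
      using lim_regA_unique[OF lim.regA_tau_left[OF ZE, of m]] lim.regA_smul[OF tendsto_const ZE] by simp
  qed
  have jmE: "jm k * E = cT T k \<cdot> E"
    by (rule lim_regA_unique[OF lim.regA_jm_left[OF ZE, of k]])
       (rule lim.regA_cong[OF _ uf], simp add: res)
  have jmE': "jm m * E = cT T m \<cdot> E" if m: "1 \<le> m" "m < k" for m
  proof -
    have "jm m * Z \<epsilon> = cT T m \<cdot> Z \<epsilon>" if \<epsilon>: "\<epsilon> > 0" for \<epsilon>
    proof -
      \<comment> \<open>The failure of Z to have weight c_m satisfies the eigenvalue equation of
        \<open>jm k\<close> with the non-real u, hence vanishes.\<close>
      have "jm k * (jm m * Z \<epsilon> - cT T m \<cdot> Z \<epsilon>) = jm m * (jm k * Z \<epsilon>) - cT T m \<cdot> (jm k * Z \<epsilon>)"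
        using jm_jm[of m k] m by (simp add: right_diff_distrib mult.assoc[symmetric])
      also have "\<dots> = u \<epsilon> \<cdot> (jm m * Z \<epsilon> - cT T m \<cdot> Z \<epsilon>)"
        unfolding res[OF \<epsilon>] using X(2)[OF m]
        by (simp add: right_diff_distrib av.scale_right_diff_distrib mult.commute)
      finally show ?thesis using jm_nonreal_eigenvalue[OF _ Imu[OF \<epsilon>]] by fastforce
    qed
    then have "lim.regA (\<lambda>\<epsilon>. jm m * Z \<epsilon>) (cT T m \<cdot> E)"
      by (intro lim.regA_cong[OF _ lim.regA_smul[OF tendsto_const ZE]]) simp
    then show ?thesis by (rule lim_regA_unique[OF lim.regA_jm_left[OF ZE, of m]])
  qed
  \<comment> \<open>X is built from sign changes and from transpositions of letters below k.\<close>
  have Xk: "jm k * X = X * jm k"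
  proof -
    have "jm k * P = P * jm k" unfolding P_def using kn by (intro sign_idem_commute jm_tau) auto
    then show ?thesis unfolding X_def using mult_pass[OF jm_reg_fusR] by (simp add: k_def)
  qed
  have Ejm: "E * jm k = cT T k \<cdot> E"
  proof -
    have "Z \<epsilon> * jm k = u \<epsilon> \<cdot> Z \<epsilon> - f \<epsilon> \<cdot> X" if \<epsilon>: "\<epsilon> > 0" for \<epsilon>
    proof -
      \<comment> \<open>Z jm k and jm k Z satisfy the same resolvent equation because X commutes
        with \<open>jm k\<close>, and a non-real u admits only one solution.\<close>
      have "jm k * (Z \<epsilon> * jm k) = (u \<epsilon> \<cdot> Z \<epsilon> - f \<epsilon> \<cdot> X) * jm k"
        using res[OF \<epsilon>] by (simp add: mult.assoc[symmetric])
      moreover have "jm k * (u \<epsilon> \<cdot> Z \<epsilon> - f \<epsilon> \<cdot> X) = u \<epsilon> \<cdot> (u \<epsilon> \<cdot> Z \<epsilon> - f \<epsilon> \<cdot> X) - f \<epsilon> \<cdot> (X * jm k)"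
        using res[OF \<epsilon>] Xk by (simp add: right_diff_distrib)
      ultimately have "jm k * (Z \<epsilon> * jm k - (u \<epsilon> \<cdot> Z \<epsilon> - f \<epsilon> \<cdot> X)) = u \<epsilon> \<cdot> (Z \<epsilon> * jm k - (u \<epsilon> \<cdot> Z \<epsilon> - f \<epsilon> \<cdot> X))"
        by (simp add: right_diff_distrib[of "jm k" "Z \<epsilon> * jm k"] left_diff_distrib av.scale_right_diff_distrib)
      from jm_nonreal_eigenvalue[OF this Imu[OF \<epsilon>]] show ?thesis by simp
    qed
    then have "lim.regA (\<lambda>\<epsilon>. Z \<epsilon> * jm k) (cT T k \<cdot> E)"
      by (intro lim.regA_cong[OF _ uf]) simp
    moreover have "lim.regA (\<lambda>\<epsilon>. Z \<epsilon> * jm k) (E * jm k)"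
      by (rule lim.regA_jm_right[OF ZE])
    ultimately show ?thesis using lim_regA_unique by blast
  qed
  have Ejm': "E * jm m = cT T m \<cdot> E" if "1 \<le> m" "m < k" for m
    using X(3)[OF that] by (simp add: E_def mult.assoc)
  have "coef E 0 = 1 / 2 ^ n"
  proof -
    have "coef (Z \<epsilon>) 0 = 1 / 2 ^ n" for \<epsilon>
      unfolding Z_def k'[symmetric] using coef_phi_0[OF X(5), of "\<alpha> \<epsilon>"] X(4) kn by auto
    moreover have "((\<lambda>\<epsilon>. coef (Z \<epsilon>) 0) \<longlongrightarrow> coef E 0) (at_right 0)"
      using ZE by (simp add: lim.regA_def)
    ultimately show ?thesis
      using tendsto_unique[OF trivial_limit_at_right_real _ tendsto_const] by simp
  qed
  moreover have "fixes_above k E"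
    unfolding E_def
  proof (rule fixes_above_reg_phi)
    show "fixes_above k X" using X(5) unfolding fixes_above_def by auto
  qed (simp_all add: k_def S_def sing_def)
  ultimately show ?case
    using tauE jmE jmE' Ejm Ejm' unfolding E k_def by (auto simp: le_Suc_eq less_Suc_eq_le)
qed

end

section \<open>Regularity of the fusion product\<close>

text \<open>Division is expressed by F h = G on D, with no condition on h apart from its nonzero
  value. It serves for the single coefficients 1 / (u_k - u_m) and for the scalar 1 - a^2 of an
  exchange.\<close>

locale coef_limit_div = coef_limit +
  assumes reg_divide: "reg h c \<Longrightarrow> c \<noteq> 0 \<Longrightarrow> reg G d \<Longrightarrow> (\<And>y. y \<in> D \<Longrightarrow> F y * h y = G y) \<Longrightarrow> reg F (d / c)"
begin

lemma regA_divide: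
  assumes "reg h c" "c \<noteq> 0" "regA G V" "\<And>y. y \<in> D \<Longrightarrow> h y \<cdot> F y = G y"
  shows "regA F ((1 / c) \<cdot> V)"
  unfolding regA_def
proof
  fix g
  have "reg (\<lambda>y. coef (F y) g) (coef V g / c)"
  proof (rule reg_divide[OF assms(1,2)])
    show "reg (\<lambda>y. coef (G y) g) (coef V g)" using assms(3) by (simp add: regA_def)
    show "coef (F y) g * h y = coef (G y) g" if "y \<in> D" for y
      using assms(4)[OF that, symmetric] by simp
  qed
  then show "reg (\<lambda>y. coef (F y) g) (coef ((1 / c) \<cdot> V) g)" by simp
qed

end

locale fusion = bipart n l + coef_limit_div reg D
  for n :: nat and l :: bipart and reg :: "('p \<Rightarrow> complex) \<Rightarrow> complex \<Rightarrow> bool" and D :: "'p set"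
begin

definition admissible :: "bitableau \<Rightarrow> (nat \<Rightarrow> 'p \<Rightarrow> complex) \<Rightarrow> complex \<Rightarrow> bool" where
  "admissible T z \<zeta> \<longleftrightarrow> (\<forall>m\<in>{1..n}. reg (z m) \<zeta>) \<and>
     (\<forall>m\<in>{1..n}. \<forall>k\<in>{1..n}. same_hook l T m k \<longrightarrow> (\<forall>y\<in>D. z m y = z k y)) \<and>
     (\<forall>y\<in>D. \<forall>m\<in>{1..n}. \<forall>k\<in>{1..n}. m \<noteq> k \<longrightarrow> pT T m = pT T k \<longrightarrow> z m y + cT T m \<noteq> z k y + cT T k)"

definition ual :: "bitableau \<Rightarrow> (nat \<Rightarrow> 'p \<Rightarrow> complex) \<Rightarrow> 'p \<Rightarrow> nat \<Rightarrow> nat \<Rightarrow> complex" where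
  "ual T z y = alT T (\<lambda>m. z m y + cT T m)"

text \<open>One V for all families z admissible for T over a fixed D: along a chain of exchanges the
  tableau and the indices of z are permuted together while D stays the same.\<close>

definition regular_value :: "bitableau \<Rightarrow> galg \<Rightarrow> bool" where
  "regular_value T V \<longleftrightarrow> (\<forall>z \<zeta>. admissible T z \<zeta> \<longrightarrow> regA (\<lambda>y. fusR (ual T z y) n) V)"

lemma yang_baxter_ual:
  assumes "admissible T z \<zeta>" "y \<in> D"
  shows "yang_baxter n (ual T z y)"
  unfolding ual_def by (rule yang_baxter_alT) (use assms in \<open>auto simp: admissible_def\<close>)

lemma reg_ual:
  assumes "admissible T z \<zeta>" "m \<in> {1..n}" "k \<in> {1..n}" "m \<noteq> k" "pT T m = pT T k \<Longrightarrow> cT T m \<noteq> cT T k"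
  shows "reg (\<lambda>y. ual T z y m k) (alT T (cT T) m k)"
proof (cases "pT T m = pT T k")
  case False
  then show ?thesis using reg_const[of 0] by (simp add: ual_def alT_def)
next
  case True
  have z: "reg (z m) \<zeta>" "reg (z k) \<zeta>" using assms by (auto simp: admissible_def)
  have "reg (\<lambda>y. (z k y + cT T k) + - 1 * (z m y + cT T m)) ((\<zeta> + cT T k) + - 1 * (\<zeta> + cT T m))"
    by (intro reg_add reg_mult reg_const z)
  then have h: "reg (\<lambda>y. (z k y + cT T k) - (z m y + cT T m)) (cT T k - cT T m)"
    by (simp add: algebra_simps)
  have "reg (\<lambda>y. ual T z y m k) (1 / (cT T k - cT T m))"
  proof (rule reg_divide[OF h _ reg_const])
    fix y assume "y \<in> D"
    then have "z m y + cT T m \<noteq> z k y + cT T k" using assms True by (auto simp: admissible_def)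
    then show "ual T z y m k * (z k y + cT T k - (z m y + cT T m)) = 1"
      using True by (simp add: ual_def alT_def)
  qed (use assms True in auto)
  then show ?thesis using True by (simp add: alT_def)
qed

text \<open>The cancellation of \<open>hook_value\<close> with all z varying. Here the sign of s_m
  comes from \<open>fusR_eigen\<close>: neighbours in a hook have equal z on D, so their coefficient
  is 1 or -1. The outcome is again \<open>reg_fusR\<close>, so the value found along the path is the
  value on the hook subspace.\<close>

lemma hook_regular:
  assumes T: "T \<in> SYT" "hook_ordered T" and z: "admissible T z \<zeta>" and "k \<le> n"
  shows "regA (\<lambda>y. fusR (ual T z y) k) (reg_fusR T k)"
  using assms(4)
proof (induction k)
  case 0
  show ?case using regA_const by simp
next
  case (Suc k)
  let ?K = "Suc k" and ?S = "sing T (Suc k)"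
  have IH: "regA (\<lambda>y. fusR (ual T z y) k) (reg_fusR T k)" using Suc by simp
  have "regA (\<lambda>y. reg_phi ?S (ual T z y) ?K k * fusR (ual T z y) k) (reg_phi ?S (alT T (cT T)) ?K k * reg_fusR T k)"
  proof (rule regA_reg_phi[OF _ IH])
    fix m assume "1 \<le> m" "m \<le> k" "\<not> ?S m"
    then show "reg (\<lambda>y. ual T z y m ?K) (alT T (cT T) m ?K)"
      using Suc.prems by (intro reg_ual[OF z]) (auto simp: sing_def)
  qed
  then show ?case
    unfolding reg_fusR.simps
  proof (rule regA_cong[rotated])
    fix y assume y: "y \<in> D"
    let ?\<alpha> = "ual T z y" and ?X = "fusR (ual T z y) k"
    have "\<not> ?S k" using hook_singular(2)[OF T Suc.prems, of k] by auto
    moreover have "phi ?\<alpha> ?K (if ?S k then k - 1 else k) * ?X = reg_phi ?S ?\<alpha> ?K k * ?X"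
    proof (rule phi_eq_reg_phi)
      fix m assume "?S m"
      note h = hook_singular[OF T Suc.prems this]
      let ?e = "cT T (Suc m) - cT T m"
      have r: "m \<in> {1..n}" "Suc m \<in> {1..n}" "?K \<in> {1..n}" "m \<noteq> ?K" "Suc m \<noteq> ?K"
        using h Suc.prems by auto
      have "z m y = z (Suc m) y" using z y h(7) r unfolding admissible_def by blast
      then have zz: "z (Suc m) y = z m y" by simp
      have e1: "?\<alpha> m (Suc m) = 1 / ?e" using h(3) zz by (simp add: ual_def alT_def)
      have e2: "1 / ?e = ?e" "?e * ?e = 1" using h(6) by auto
      have sX: "sg m (Suc m) * ?X = ?e \<cdot> ?X"
        by (rule fusR_eigen[OF yang_baxter_ual[OF z y]]) (use h Suc.prems e1 e2 in auto)
      define \<eta> where "\<eta> = (z ?K y + cT T ?K) - (z m y + cT T m)"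
      have "z m y + cT T m \<noteq> z ?K y + cT T ?K" "z (Suc m) y + cT T (Suc m) \<noteq> z ?K y + cT T ?K"
        using z y r h(3,4) unfolding admissible_def by metis+
      then have \<eta>: "\<eta> \<noteq> 0" "\<eta> - ?e \<noteq> 0" using zz by (auto simp: \<eta>_def algebra_simps)
      have a: "?\<alpha> m ?K = 1 / \<eta>" "?\<alpha> (Suc m) ?K = 1 / (\<eta> - ?e)"
        using h(3,4) zz by (auto simp: ual_def alT_def \<eta>_def algebra_simps)
      have "1 / \<eta> + ?e * (1 / \<eta>) * (1 / (\<eta> - ?e)) = 1 / (\<eta> - ?e)"
        using \<eta> by (simp add: divide_simps)
      then show "1 \<le> m \<and> Suc m < ?K \<and> \<not> ?S (Suc m) \<and> sg m (Suc m) * ?X = ?e \<cdot> ?X \<and>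
          ?\<alpha> m ?K + ?e * ?\<alpha> m ?K * ?\<alpha> (Suc m) ?K = ?\<alpha> (Suc m) ?K"
        using h sX unfolding a by blast
    qed simp
    ultimately show "reg_phi ?S ?\<alpha> ?K k * ?X = fusR ?\<alpha> ?K" by simp
  qed
qed

section \<open>Transport of value and weights along adjacent exchanges\<close>

definition weight_value :: "bitableau \<Rightarrow> galg \<Rightarrow> bool" where
  "weight_value T V \<longleftrightarrow> left_weight n (pT T) (cT T) (V * sign_idem (pT T) n) \<and> right_weight n (pT T) (cT T) (V * sign_idem (pT T) n) \<and>
     coef (V * sign_idem (pT T) n) 0 = 1 / 2 ^ n"

lemma hook_weight_value:
  assumes "T \<in> SYT" "hook_ordered T"
  shows "weight_value T (reg_fusR T n)"
proof -
  have "reg_fusR T n * sign_idem (pT T) n * tau m = pT T m \<cdot> (reg_fusR T n * sign_idem (pT T) n)" if "m \<in> {1..n}" for m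
    using sign_idem_tau[of m n "pT T"] that pT_cases by (simp add: mult.assoc)
  then show ?thesis
    using hook_value[OF assms order_refl] unfolding weight_value_def left_weight_def right_weight_def by auto
qed

text \<open>The new value is (s_i + a) V (s_i + a) / (1 - a^2), where a is the limit of the
  coefficient. Exchangeable entries of one component have contents at least 2 apart, so a is finite
  and a^2 differs from 1; entries of different components have a = 0.\<close>

lemma exchange_step:
  assumes T: "T \<in> SYT" and i: "1 \<le> i" "i < n" and E: "exchange l i T \<in> SYT"
    and V: "weight_value T V" "regular_value T V"
  shows "\<exists>V'. weight_value (exchange l i T) V' \<and> regular_value (exchange l i T) V'"
proof -
  let ?T = "exchange l i T" and ?t = "swap i (Suc i)" and ?s = "sg i (Suc i)"
  let ?P = "sign_idem (pT T) n" and ?P' = "sign_idem (pT ?T) n"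
  define a where "a = alT T (cT T) (Suc i) i"
  define V' where "V' = (1 / (1 - a\<^sup>2)) \<cdot> ((?s + a \<cdot> 1) * V * (?s + a \<cdot> 1))"
  have ii: "i \<in> {1..n}" "Suc i \<in> {1..n}" using i by auto
  have tin: "?t m \<in> {1..n}" if "m \<in> {1..n}" for m using transpose_in[OF i that] .
  have p': "pT ?T m = pT T (?t m)" and c': "cT ?T m = cT T (?t m)" if "m \<in> {1..n}" for m
    using cmp_exchange[OF T i E that] by (auto simp: pT_def cT_def)
  have nsl: "\<not> same_line T i" using exchange_std_iff[OF T i] E by simp
  have far: "cT T i - cT T (Suc i) \<noteq> 0 \<and> (cT T i - cT T (Suc i))\<^sup>2 \<noteq> 1" if "pT T i = pT T (Suc i)"
  proof -
    have f: "2 \<le> \<bar>ct T (Suc i) - ct T i\<bar>"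
      using not_same_line_content[OF T i nsl] that pT_eq_iff[OF T ii] by simp
    have "cT T i - cT T (Suc i) = of_int (ct T i - ct T (Suc i))" by (simp add: cT_def)
    moreover have "(ct T i - ct T (Suc i))\<^sup>2 \<noteq> 1" using f by (auto simp: power2_eq_1_iff)
    then have "complex_of_int ((ct T i - ct T (Suc i))\<^sup>2) \<noteq> 1" by (metis of_int_eq_1_iff)
    ultimately show ?thesis using f by (auto simp del: of_int_diff)
  qed
  have a1: "a * (cT T i - cT T (Suc i)) = (if pT T i = pT T (Suc i) then 1 else 0)"
    using far by (simp add: a_def alT_def)
  have a0: "a = 0" if "pT T i \<noteq> pT T (Suc i)" using that by (auto simp: a_def alT_def)
  have a2: "1 - a\<^sup>2 \<noteq> 0"
  proof (cases "pT T i = pT T (Suc i)")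
    case True
    then show ?thesis using far by (simp add: a_def alT_def power_divide divide_eq_eq)
  qed (use a0 in simp)
  have P': "?P' = sign_idem (\<lambda>m. pT T (?t m)) n" by (rule sign_idem_cong) (use p' in auto)
  have sP: "(?s + a \<cdot> 1) * ?P' = ?P * (?s + a \<cdot> 1)"
  proof -
    have 1: "?s * ?P' = ?P * ?s" unfolding P' using s_sign_idem[OF i, of "\<lambda>m. pT T (?t m)"] by simp
    have "a \<cdot> ?P' = a \<cdot> ?P"
    proof (cases "pT T i = pT T (Suc i)")
      case True
      then have "pT T (?t m) = pT T m" for m by (auto simp: Transposition.transpose_def)
      then show ?thesis by (simp add: P')
    qed (use a0 in simp)
    then show ?thesis using 1 by (simp add: galg_simps)
  qed
  let ?E = "V * ?P"
  have VE: "V' * ?P' = (1 / (1 - a\<^sup>2)) \<cdot> ((?s + a \<cdot> 1) * ?E * (?s + a \<cdot> 1))"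
    unfolding V'_def using sP by (simp add: mult.assoc)
  have wE: "left_weight n (pT T) (cT T) ?E" "right_weight n (pT T) (cT T) ?E" "coef ?E 0 = 1 / 2 ^ n"
    using V(1) by (auto simp: weight_value_def)
  have cong: "left_weight n (pT ?T) (cT ?T) X = left_weight n (\<lambda>m. pT T (?t m)) (\<lambda>m. cT T (?t m)) X"
    "right_weight n (pT ?T) (cT ?T) X = right_weight n (\<lambda>m. pT T (?t m)) (\<lambda>m. cT T (?t m)) X" for X
    using p' c' by (auto simp: left_weight_def right_weight_def)
  have "left_weight n (pT ?T) (cT ?T) (V' * ?P')"
    unfolding cong VE using pT_cases a1 a0
    by (intro left_weight_smul left_weight_mult_right left_weight_intertwine wE(1) i) auto
  moreover have "right_weight n (pT ?T) (cT ?T) (V' * ?P')"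
    unfolding cong VE using pT_cases a1 a0
    by (intro right_weight_smul right_weight_intertwine[OF right_weight_mult_left[OF wE(2)] i]) auto
  moreover have "coef (V' * ?P') 0 = 1 / 2 ^ n"
  proof -
    have ss: "?s * ?s = 1" using i by (simp add: sg_sq)
    have "coef ((?s + a \<cdot> 1) * ?E * (?s + a \<cdot> 1)) 0 = coef ((?s + a \<cdot> 1) * ((?s + a \<cdot> 1) * ?E)) 0"
      by (rule coef_0_commute)
    also have "(?s + a \<cdot> 1) * ((?s + a \<cdot> 1) * ?E) = (1 + a\<^sup>2) \<cdot> ?E + (2 * a) \<cdot> (?s * ?E)"
    proof -
      have "?s * (?s * ?E) = ?E" using ss by (simp add: mult.assoc[symmetric])
      then show ?thesis
        by (simp only: galg_simps smul_mult_left smul_mult_right mult_1_left mult_1_right)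
           (rule poly_mapping_eqI, simp add: lookup_add power2_eq_square algebra_simps)
    qed
    also have "coef \<dots> 0 = (1 + a\<^sup>2) * coef ?E 0 + 2 * (a * coef (?s * ?E) 0)" by (simp add: lookup_add)
    \<comment> \<open>For equal signs \<open>coef_s_weight\<close> gives s_i E the coefficient -a
      times that of E, so the total is 1 + a^2 - 2 a^2 = 1 - a^2, which the normalisation
      removes.\<close>
    also have "a * coef (?s * ?E) 0 = - a\<^sup>2 * coef ?E 0"
    proof (cases "pT T i = pT T (Suc i)")
      case True
      have "(cT T (Suc i) - cT T i) * coef (?s * ?E) 0 = coef ?E 0"
        by (rule coef_s_weight[OF wE(1,2) i True pT_sq])
      then have "a * (a * ((cT T (Suc i) - cT T i) * coef (?s * ?E) 0)) = a * (a * coef ?E 0)" by simp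
      moreover have "a * (cT T (Suc i) - cT T i) = - 1" using a1 True by (simp add: algebra_simps)
      ultimately show ?thesis by (simp add: power2_eq_square algebra_simps) algebra
    qed (use a0 in simp)
    finally have "coef ((?s + a \<cdot> 1) * ?E * (?s + a \<cdot> 1)) 0 = (1 - a\<^sup>2) * coef ?E 0"
      by (simp add: algebra_simps)
    then show ?thesis unfolding VE using a2 wE(3) by simp
  qed
  ultimately have "weight_value ?T V'" by (simp add: weight_value_def)
  moreover have "regular_value ?T V'"
    unfolding regular_value_def
  proof (intro allI impI)
    fix z \<zeta> assume z: "admissible ?T z \<zeta>"
    \<comment> \<open>The exchange renames the entries of the tableau by the same transposition, so
      the relabelled family is admissible for T.\<close>
    define z0 where "z0 m = z (?t m)" for m
    have nd: "nd ?T (?t m) = nd T m" if "m \<in> {1..n}" for m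
      using nd_exchange[OF T i E tin[OF that]] by simp
    have z0: "admissible T z0 \<zeta>"
      unfolding admissible_def
    proof (intro conjI ballI impI)
      show "reg (z0 m) \<zeta>" if "m \<in> {1..n}" for m
        using z tin[OF that] by (auto simp: z0_def admissible_def)
      show "z0 m y = z0 k y" if "m \<in> {1..n}" "k \<in> {1..n}" "same_hook l T m k" "y \<in> D" for m k y
      proof -
        have "same_hook l ?T (?t m) (?t k)" using that nd by (simp add: same_hook_def)
        then show ?thesis using z tin that unfolding admissible_def z0_def by blast
      qed
      show "z0 m y + cT T m \<noteq> z0 k y + cT T k"
        if "y \<in> D" "m \<in> {1..n}" "k \<in> {1..n}" "m \<noteq> k" "pT T m = pT T k" for y m k
      proof -
        have "?t m \<noteq> ?t k" using that(4) by (metis transpose_involutory)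
        then have "z (?t m) y + cT ?T (?t m) \<noteq> z (?t k) y + cT ?T (?t k)"
          using z tin that p' unfolding admissible_def by simp
        then show ?thesis using c' tin that by (simp add: z0_def)
      qed
    qed
    have R0: "regA (\<lambda>y. fusR (ual T z0 y) n) V" using V(2) z0 unfolding regular_value_def by blast
    define b where "b y = ual T z0 y (Suc i) i" for y
    have b: "reg b a"
      unfolding b_def[abs_def] a_def using far ii by (intro reg_ual[OF z0]) (auto simp: power2_eq_square)
    have "regA (\<lambda>y. ?s * fusR (ual T z0 y) n * ?s + b y \<cdot> (?s * fusR (ual T z0 y) n)
        + b y \<cdot> (fusR (ual T z0 y) n * ?s) + b y \<cdot> (b y \<cdot> fusR (ual T z0 y) n))
       (?s * V * ?s + a \<cdot> (?s * V) + a \<cdot> (V * ?s) + a \<cdot> (a \<cdot> V))"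
      by (intro regA_add regA_smul regA_sg_right regA_sg_left R0 b)
    then have G: "regA (\<lambda>y. (?s + b y \<cdot> 1) * fusR (ual T z0 y) n * (?s + b y \<cdot> 1))
        ((?s + a \<cdot> 1) * V * (?s + a \<cdot> 1))"
      by (simp add: galg_simps add_ac)
    have "reg (\<lambda>y. 1 + - 1 * (b y * b y)) (1 + - 1 * (a * a))" by (intro reg_add reg_mult reg_const b)
    then have h: "reg (\<lambda>y. 1 - (b y)\<^sup>2) (1 - a\<^sup>2)" by (simp add: power2_eq_square)
    show "regA (\<lambda>y. fusR (ual ?T z y) n) V'"
      unfolding V'_def
    proof (rule regA_divide[OF h a2 G])
      fix y assume y: "y \<in> D"
      have "fusR (swap_alpha i (ual T z0 y)) n = fusR (ual ?T z y) n"
      proof (rule fusR_cong)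
        fix m k assume "1 \<le> m" "m < k" "k \<le> n"
        then have mk: "m \<in> {1..n}" "k \<in> {1..n}" by auto
        then show "swap_alpha i (ual T z0 y) m k = ual ?T z y m k"
          by (simp add: swap_alpha_def ual_def alT_def z0_def p' c')
      qed
      then show "(1 - (b y)\<^sup>2) \<cdot> fusR (ual ?T z y) n = (?s + b y \<cdot> 1) * fusR (ual T z0 y) n * (?s + b y \<cdot> 1)"
        using fusR_conj[OF yang_baxter_ual[OF z0 y] i order_refl] by (simp add: b_def)
    qed
  qed
  ultimately show ?thesis by blast
qed

theorem fusion_value_exists:
  assumes "T \<in> SYT"
  shows "\<exists>V. weight_value T V \<and> regular_value T V"
  using assms
proof (induction "disorder rank T" arbitrary: T rule: less_induct)
  case less
  show ?case
  proof (cases "hook_ordered T")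
    case True
    then show ?thesis
      using hook_weight_value hook_regular less.prems unfolding regular_value_def by blast
  next
    case False
    then obtain i where i: "1 \<le> i" "i < n" "rank (nd T (Suc i)) < rank (nd T i)"
      unfolding hook_ordered_def by (meson not_le)
    have E: "exchange l i T \<in> SYT"
      using descent_exchange_std[OF linear_rank[OF finite_nodes]] less.prems i by blast
    obtain V where "weight_value (exchange l i T) V" "regular_value (exchange l i T) V"
      using less.hyps[OF disorder_exchange[OF less.prems i(1,2) E i(3)] E] by blast
    then show ?thesis
      using exchange_step[OF E i(1,2)] exchange_exchange[OF less.prems] less.prems by metis
  qed
qed

end

section \<open>Generators of the hyperoctahedral group\<close>

lemma hyp_carrier: "g \<in> carrier (hyperoctahedral n) \<longleftrightarrow> g permutes {- int n..int n} \<and> (\<forall>x. g (- x) = - g x)"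
  by (simp add: hyperoctahedral_def)

lemma hyp_mult: "g \<otimes>\<^bsub>hyperoctahedral n\<^esub> h = g \<circ> h"
  by (simp add: hyperoctahedral_def)

lemma hyp_one: "\<one>\<^bsub>hyperoctahedral n\<^esub> = id"
  by (simp add: hyperoctahedral_def)

lemma hyp_closed:
  "g \<in> carrier (hyperoctahedral n) \<Longrightarrow> h \<in> carrier (hyperoctahedral n) \<Longrightarrow> g \<circ> h \<in> carrier (hyperoctahedral n)"
  using group.subgroup_self[OF group_hyperoctahedral] by (metis hyp_mult subgroup.m_closed)

lemma hyp_inv:
  assumes "g \<in> carrier (hyperoctahedral n)"
  shows "finv g \<in> carrier (hyperoctahedral n)" "g \<circ> finv g = id" "finv g \<circ> g = id"
proof -
  have p: "g permutes {- int n..int n}" "\<And>x. g (- x) = - g x" using assms by (auto simp: hyp_carrier)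
  have "finv g (- x) = - finv g x" for x
    using permutes_inv_eq[OF p(1)] p(2) permutes_inverses(1)[OF p(1)] by metis
  then show "finv g \<in> carrier (hyperoctahedral n)"
    using permutes_inv[OF p(1)] by (simp add: hyp_carrier)
  show "g \<circ> finv g = id" "finv g \<circ> g = id"
    using permutes_inv_o[OF p(1)] by auto
qed

text \<open>Bubble sort. When g fixes everything above k, generators on the left raise the image of
  k step by step up to k: s_i raises an image i or -(i + 1), and t turns -1 into 1. A generator r is
  an involution, so \<open>P g\<close> follows from \<open>P (r \<circ> g)\<close>.\<close>

lemma hyp_gen_induct [consumes 1, case_names id s t]:
  assumes "g \<in> carrier (hyperoctahedral n)"
    and id: "P id"
    and s: "\<And>i g. 1 \<le> i \<Longrightarrow> i < n \<Longrightarrow> g \<in> carrier (hyperoctahedral n) \<Longrightarrow> P g \<Longrightarrow> P (gen_s i \<circ> g)"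
    and t: "\<And>g. 1 \<le> n \<Longrightarrow> g \<in> carrier (hyperoctahedral n) \<Longrightarrow> P g \<Longrightarrow> P (gen_t \<circ> g)"
  shows "P g"
proof -
  have "P g" if "k \<le> n" "g \<in> carrier (hyperoctahedral n)" "\<And>x. int k < x \<Longrightarrow> g x = x" for k g
    using that
  proof (induction k arbitrary: g)
    case 0
    have odd: "g (- x) = - g x" for x using 0 by (auto simp: hyp_carrier)
    have "g x = x" for x
    proof (cases x "0::int" rule: linorder_cases)
      case less
      then show ?thesis using 0(3)[of "- x"] odd[of x] by simp
    next
      case equal
      then show ?thesis using odd[of 0] by simp
    next
      case greater
      then show ?thesis using 0(3)[of x] by simp
    qed
    then have "g = id" by auto
    then show ?case by (simp only: id)
  next
    case (Suc k)
    from Suc.prems show ?case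
    proof (induction "nat (int (Suc k) - g (int (Suc k)))" arbitrary: g rule: less_induct)
      case (less g)
      let ?K = "int (Suc k)" and ?y = "g (int (Suc k))"
      note C = less.prems(2)
      have p: "g permutes {- int n..int n}" and odd: "\<And>x. g (- x) = - g x" using C by (auto simp: hyp_carrier)
      have inj: "g x = g y \<Longrightarrow> x = y" for x y using permutes_inj[OF p] by (auto dest: injD)
      have g0: "g 0 = 0" using odd[of 0] by simp
      have y0: "?y \<noteq> 0" using inj[of ?K 0] g0 by auto
      have yK: "?y \<le> ?K"
      proof (rule ccontr)
        assume "\<not> ?y \<le> ?K"
        then have "g ?y = ?y" using less.prems(3) by simp
        then have "?y = ?K" using inj by blast
        then show False using \<open>\<not> ?y \<le> ?K\<close> by simp
      qed
      have yK': "- ?K \<le> ?y"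
      proof (rule ccontr)
        assume "\<not> - ?K \<le> ?y"
        then have "g (- ?y) = - ?y" using less.prems(3)[of "- ?y"] by simp
        then have "g ?y = ?y" using odd[of ?y] by simp
        then have "?y = ?K" using inj by blast
        then show False using \<open>\<not> - ?K \<le> ?y\<close> by simp
      qed
      have step: "P g" if r: "r \<in> carrier (hyperoctahedral n)" "r \<circ> r = id" "\<And>x. ?K < x \<Longrightarrow> r x = x" "r ?y > ?y" "r ?y \<le> ?K"
        and ind: "P (r \<circ> g) \<Longrightarrow> P (r \<circ> (r \<circ> g))" for r
      proof -
        have "P (r \<circ> g)"
          by (rule less.hyps) (use r less.prems hyp_closed[OF r(1) C] in auto)
        then have "P (r \<circ> (r \<circ> g))" by (rule ind)
        then show ?thesis using r(2) by (simp add: comp_assoc[symmetric])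
      qed
      consider "?y = ?K" | "0 < ?y" "?y < ?K" | "?y = - 1" | "?y < - 1" using y0 yK by linarith
      then show ?case
      proof cases
        case 1
        show ?thesis
        proof (rule Suc.IH)
          show "g x = x" if "int k < x" for x
            using that 1 less.prems(3)[of x] by (cases "x = ?K") auto
        qed (use less.prems in auto)
      next
        case 2
        define i where "i = nat ?y"
        have i: "1 \<le> i" "i < n" "int i = ?y" "int i + 1 \<le> ?K" using 2 less.prems(1) by (auto simp: i_def)
        show ?thesis
          by (rule step[of "gen_s i"])
            (use i gens_in_hyperoctahedral(1)[OF i(1,2)] coxeter_relations(1)[OF i(1)] s[OF i(1,2)]
              hyp_closed[OF gens_in_hyperoctahedral(1)[OF i(1,2)] C]
             in \<open>auto simp: gen_s_apply\<close>)
      next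
        case 3
        have n: "1 \<le> n" using less.prems(1) by simp
        show ?thesis
          by (rule step[of gen_t])
            (use n 3 gens_in_hyperoctahedral(2)[OF n] coxeter_relations(2) t[OF n]
              hyp_closed[OF gens_in_hyperoctahedral(2)[OF n] C]
             in \<open>auto simp: gen_t_apply\<close>)
      next
        case 4
        define i where "i = nat (- ?y) - 1"
        have i: "1 \<le> i" "i < n" "- int i - 1 = ?y" "int i + 1 \<le> ?K"
          using 4 yK' less.prems(1) by (auto simp: i_def)
        show ?thesis
          by (rule step[of "gen_s i"])
            (use i gens_in_hyperoctahedral(1)[OF i(1,2)] coxeter_relations(1)[OF i(1)] s[OF i(1,2)]
              hyp_closed[OF gens_in_hyperoctahedral(1)[OF i(1,2)] C]
             in \<open>auto simp: gen_s_apply\<close>)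
      qed
    qed
  qed
  from this[of n g] assms(1) show ?thesis
    by (auto simp: hyp_carrier permutes_def)
qed

lemma hyp_sperm: "g \<in> carrier (hyperoctahedral n) \<Longrightarrow> bij g \<and> (\<forall>x. g (- x) = - g x)"
  by (auto simp: hyp_carrier permutes_bij)

lemma app_Sperm: "g \<in> carrier (hyperoctahedral n) \<Longrightarrow> app (Sperm g) = g"
  using hyp_sperm by (simp add: Sperm_inverse)

lemma Sperm_comp:
  assumes "g \<in> carrier (hyperoctahedral n)" "h \<in> carrier (hyperoctahedral n)"
  shows "Sperm (g \<circ> h) = Sperm g + Sperm h"
  by (rule sperm_eqI) (use assms hyp_closed[OF assms] in \<open>simp add: app_Sperm\<close>)

lemma Sperm_id: "Sperm id = 0"
  by (simp add: zero_sperm_def)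

lemma Sperm_inv:
  assumes "g \<in> carrier (hyperoctahedral n)"
  shows "Sperm (finv g) = - Sperm g"
proof -
  have "Sperm g + Sperm (finv g) = 0"
    using Sperm_comp[OF assms hyp_inv(1)[OF assms]] hyp_inv(2)[OF assms] by (simp add: Sperm_id)
  then show ?thesis by (simp add: minus_unique)
qed

lemma Sperm_s: "1 \<le> i \<Longrightarrow> Sperm (gen_s i) = swap_perm i (Suc i)"
proof -
  assume i: "1 \<le> i"
  have "app (swap_perm i (Suc i)) = gen_s i"
    using i by (auto simp: fun_eq_iff app_swap_perm gen_s_apply)
  then show ?thesis by (metis app_inverse)
qed

lemma Sperm_t: "Sperm gen_t = flip_perm 1"
proof -
  have "app (flip_perm 1) = gen_t" by (auto simp: fun_eq_iff app_flip_perm gen_t_apply)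
  then show ?thesis by (metis app_inverse)
qed

section \<open>The left ideal of the fusion element\<close>

context bipart
begin

definition axial_diag :: "bitableau \<Rightarrow> nat \<Rightarrow> complex" where
  "axial_diag S i = (if cmp S i = cmp S (Suc i) then complex_of_real (axial_d l i S) else 0)"

definition axial_off :: "bitableau \<Rightarrow> nat \<Rightarrow> complex" where
  "axial_off S i = (if cmp S i = cmp S (Suc i) then complex_of_real (sqrt (1 - (axial_d l i S)\<^sup>2)) else 1)"

text \<open>Normalised so that in Young's orthogonal form it sends the basis vector of S to that of
  the exchanged tableau.\<close>

definition intertwiner :: "bitableau \<Rightarrow> nat \<Rightarrow> galg \<Rightarrow> galg" where
  "intertwiner S i X = (1 / axial_off S i) \<cdot> (sg i (Suc i) * X - axial_diag S i \<cdot> X)"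

lemma axial_diag_eq: "axial_diag S i = (if cmp S i = cmp S (Suc i) then 1 else 0) / (cT S (Suc i) - cT S i)"
  by (simp add: axial_diag_def axial_d_def cT_def)

lemma axial_off_sq:
  assumes "S \<in> SYT" "1 \<le> i" "i < n" "exchange l i S \<in> SYT"
  shows "axial_off S i \<noteq> 0" "axial_off S i * axial_off S i = 1 - axial_diag S i * axial_diag S i"
proof -
  have "(axial_d l i S)\<^sup>2 < 1" if c: "cmp S i = cmp S (Suc i)"
  proof -
    have f: "2 \<le> \<bar>ct S (Suc i) - ct S i\<bar>"
      using not_same_line_content[OF assms(1-3) _ c] exchange_std_iff[OF assms(1-3)] assms(4) by simp
    then have "2 \<le> \<bar>real_of_int (ct S (Suc i) - ct S i)\<bar>" by linarith
    then have "\<bar>axial_d l i S\<bar> < 1" by (simp add: axial_d_def field_simps)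
    then show ?thesis by (simp add: abs_square_less_1)
  qed
  then have pos: "cmp S i = cmp S (Suc i) \<Longrightarrow> 1 - (axial_d l i S)\<^sup>2 > 0" by simp
  then show "axial_off S i \<noteq> 0" by (auto simp: axial_off_def)
  show "axial_off S i * axial_off S i = 1 - axial_diag S i * axial_diag S i"
    using pos by (auto simp: axial_off_def axial_diag_def power2_eq_square simp flip: of_real_mult)
qed

lemma axial_diag_exchange:
  assumes "S \<in> SYT" "1 \<le> i" "i < n" "exchange l i S \<in> SYT"
  shows "axial_diag (exchange l i S) i = - axial_diag S i" "axial_off (exchange l i S) i = axial_off S i"
proof -
  have "i \<in> {1..n}" "Suc i \<in> {1..n}" using assms by auto
  then have e: "cmp (exchange l i S) i = cmp S (Suc i)" "cmp (exchange l i S) (Suc i) = cmp S i"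
    "ct (exchange l i S) i = ct S (Suc i)" "ct (exchange l i S) (Suc i) = ct S i"
    using cmp_exchange[OF assms] by auto
  have a: "axial_d l i (exchange l i S) = - axial_d l i S"
    using e by (simp add: axial_d_def) (metis minus_diff_eq minus_divide_right)
  show "axial_diag (exchange l i S) i = - axial_diag S i" "axial_off (exchange l i S) i = axial_off S i"
    using e a by (auto simp: axial_diag_def axial_off_def)
qed

lemma intertwiner_intertwiner:
  assumes "S \<in> SYT" "1 \<le> i" "i < n" "exchange l i S \<in> SYT"
  shows "intertwiner (exchange l i S) i (intertwiner S i X) = X"
proof -
  let ?s = "sg i (Suc i)" and ?d = "axial_diag S i" and ?m = "axial_off S i"
  have ss: "?s * (?s * X) = X" using assms(2) by (simp add: mult.assoc[symmetric] sg_sq)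
  have "intertwiner (exchange l i S) i (intertwiner S i X) = (1 / ?m * (1 / ?m)) \<cdot> ((1 - ?d * ?d) \<cdot> X)"
    unfolding intertwiner_def axial_diag_exchange[OF assms]
    by (simp add: galg_simps ss)
  also have "1 - ?d * ?d = ?m * ?m" using axial_off_sq[OF assms] by simp
  finally show ?thesis using axial_off_sq(1)[OF assms] by simp
qed

lemma s_intertwiner:
  assumes "S \<in> SYT" "1 \<le> i" "i < n" "exchange l i S \<in> SYT"
  shows "sg i (Suc i) * X = axial_diag S i \<cdot> X + axial_off S i \<cdot> intertwiner S i X"
  using axial_off_sq(1)[OF assms] by (simp add: intertwiner_def)

lemma left_weight_intertwiner:
  assumes "S \<in> SYT" "1 \<le> i" "i < n" "exchange l i S \<in> SYT" "left_weight n (pT S) (cT S) X"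
  shows "left_weight n (pT (exchange l i S)) (cT (exchange l i S)) (intertwiner S i X)"
proof -
  let ?t = "swap i (Suc i)"
  have ii: "i \<in> {1..n}" "Suc i \<in> {1..n}" using assms by auto
  have e: "pT (exchange l i S) m = pT S (?t m)" "cT (exchange l i S) m = cT S (?t m)" if "m \<in> {1..n}" for m
    using cmp_exchange[OF assms(1-4) that] by (simp_all add: pT_def cT_def)
  have ne: "cT S i - cT S (Suc i) \<noteq> 0" if "cmp S i = cmp S (Suc i)"
    using not_same_line_content[OF assms(1-3) _ that] exchange_std_iff[OF assms(1-3)] assms(4)
    by (auto simp: cT_eq_iff)
  have "left_weight n (\<lambda>m. pT S (?t m)) (\<lambda>m. cT S (?t m)) ((sg i (Suc i) + (- axial_diag S i) \<cdot> 1) * X)"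
  proof (rule left_weight_intertwine[OF assms(5,2,3) pT_cases pT_cases])
    show "- axial_diag S i * (cT S i - cT S (Suc i)) = (if pT S i = pT S (Suc i) then 1 else 0)"
    proof (cases "cmp S i = cmp S (Suc i)")
      case True
      then have "cT S (Suc i) - cT S i \<noteq> 0" using ne by auto
      then show ?thesis using True pT_eq_iff[OF assms(1) ii] by (simp add: axial_diag_eq field_simps)
    qed (use pT_eq_iff[OF assms(1) ii] in \<open>simp add: axial_diag_eq\<close>)
    show "- axial_diag S i = 0" if "pT S i \<noteq> pT S (Suc i)" using that pT_eq_iff[OF assms(1) ii] by (simp add: axial_diag_eq)
  qed
  then have "left_weight n (\<lambda>m. pT S (?t m)) (\<lambda>m. cT S (?t m)) (intertwiner S i X)"
    unfolding intertwiner_def by (intro left_weight_smul) (simp add: galg_simps)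
  then show ?thesis using e by (simp add: left_weight_def)
qed

lemma right_weight_intertwiner: "right_weight n p c X \<Longrightarrow> right_weight n p c (intertwiner S i X)"
  unfolding intertwiner_def right_weight_def
  by (simp add: left_diff_distrib av.scale_right_diff_distrib mult.assoc mult.commute)

lemma intertwiner_commute:
  assumes S: "S \<in> SYT" and i: "1 \<le> i" "i < n" "exchange l i S \<in> SYT" and j: "1 \<le> j" "j < n" "exchange l j S \<in> SYT"
    and ij: "Suc i < j \<or> Suc j < i"
  shows "intertwiner (exchange l i S) j (intertwiner S i X) = intertwiner (exchange l j S) i (intertwiner S j X)"
proof -
  have r: "i \<in> {1..n}" "Suc i \<in> {1..n}" "j \<in> {1..n}" "Suc j \<in> {1..n}" using i j by auto
  have e1: "cmp (exchange l i S) m = cmp S m \<and> ct (exchange l i S) m = ct S m" if "m = j \<or> m = Suc j" for m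
    using cmp_exchange[OF S i, of m] that r ij by (auto simp: Transposition.transpose_def)
  have e2: "cmp (exchange l j S) m = cmp S m \<and> ct (exchange l j S) m = ct S m" if "m = i \<or> m = Suc i" for m
    using cmp_exchange[OF S j, of m] that r ij by (auto simp: Transposition.transpose_def)
  have a: "axial_diag (exchange l i S) j = axial_diag S j" "axial_off (exchange l i S) j = axial_off S j"
    "axial_diag (exchange l j S) i = axial_diag S i" "axial_off (exchange l j S) i = axial_off S i"
    using e1 e2 by (auto simp: axial_diag_def axial_off_def axial_d_def)
  have "sg j (Suc j) * sg i (Suc i) = sg i (Suc i) * sg j (Suc j)"
    by (rule sg_disjoint) (use i j ij in auto)
  then have c: "sg j (Suc j) * (sg i (Suc i) * X) = sg i (Suc i) * (sg j (Suc j) * X)"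
    by (simp add: mult.assoc[symmetric])
  show ?thesis
    unfolding intertwiner_def a by (simp add: galg_simps c mult.commute)
qed

text \<open>By the braid relation the two expansions agree up to a multiple of s_(i+1) X - s_i X.
  The scalar is p r' - q (p + r') for the three axial coefficients and vanishes by the identity
  behind \<open>yang_baxter\<close>. The square roots are the same on both sides, in a different
  order.\<close>

lemma intertwiner_braid:
  assumes S: "S \<in> SYT" and i: "1 \<le> i" "Suc i < n"
    and S1: "exchange l i S \<in> SYT" and S12: "exchange l (Suc i) (exchange l i S) \<in> SYT"
    and S2: "exchange l (Suc i) S \<in> SYT" and S21: "exchange l i (exchange l (Suc i) S) \<in> SYT"
  shows "intertwiner (exchange l (Suc i) (exchange l i S)) i (intertwiner (exchange l i S) (Suc i) (intertwiner S i X))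
       = intertwiner (exchange l i (exchange l (Suc i) S)) (Suc i) (intertwiner (exchange l (Suc i) S) i (intertwiner S (Suc i) X))"
proof -
  let ?A = "exchange l i S" and ?B = "exchange l (Suc i) S"
  let ?AB = "exchange l (Suc i) ?A" and ?BA = "exchange l i ?B"
  have r: "i \<in> {1..n}" "Suc i \<in> {1..n}" "Suc (Suc i) \<in> {1..n}" using i by auto
  have i': "i < n" "1 \<le> Suc i" using i by auto
  note ex1 = cmp_exchange[OF S i(1) i'(1) S1] and ex2 = cmp_exchange[OF S i'(2) i(2) S2]
  note ex12 = cmp_exchange[OF S1 i'(2) i(2) S12] and ex21 = cmp_exchange[OF S2 i(1) i'(1) S21]
  have tp: "swap i (Suc i) (Suc (Suc i)) = Suc (Suc i)"
    "swap (Suc i) (Suc (Suc i)) i = i" by (auto simp: Transposition.transpose_def)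
  have A: "cmp ?A i = cmp S (Suc i)" "cmp ?A (Suc i) = cmp S i" "cmp ?A (Suc (Suc i)) = cmp S (Suc (Suc i))"
    "ct ?A i = ct S (Suc i)" "ct ?A (Suc i) = ct S i" "ct ?A (Suc (Suc i)) = ct S (Suc (Suc i))"
    using ex1[OF r(1)] ex1[OF r(2)] ex1[OF r(3)] tp by auto
  have B: "cmp ?B i = cmp S i" "cmp ?B (Suc i) = cmp S (Suc (Suc i))" "cmp ?B (Suc (Suc i)) = cmp S (Suc i)"
    "ct ?B i = ct S i" "ct ?B (Suc i) = ct S (Suc (Suc i))" "ct ?B (Suc (Suc i)) = ct S (Suc i)"
    using ex2[OF r(1)] ex2[OF r(2)] ex2[OF r(3)] tp by auto
  have AB: "cmp ?AB i = cmp S (Suc i)" "cmp ?AB (Suc i) = cmp S (Suc (Suc i))"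
    "ct ?AB i = ct S (Suc i)" "ct ?AB (Suc i) = ct S (Suc (Suc i))"
    using ex12[OF r(1)] ex12[OF r(2)] tp A by auto
  have BA: "cmp ?BA (Suc i) = cmp S i" "cmp ?BA (Suc (Suc i)) = cmp S (Suc i)"
    "ct ?BA (Suc i) = ct S i" "ct ?BA (Suc (Suc i)) = ct S (Suc i)"
    using ex21[OF r(2)] ex21[OF r(3)] tp B by auto
  define p q r' where "p = axial_diag S i" and "q = axial_diag ?A (Suc i)" and "r' = axial_diag S (Suc i)"
  have eqs: "axial_diag ?AB i = r'" "axial_diag ?B i = q" "axial_diag ?BA (Suc i) = p"
    "axial_off ?AB i = axial_off S (Suc i)" "axial_off ?B i = axial_off ?A (Suc i)" "axial_off ?BA (Suc i) = axial_off S i"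
    using A B AB BA by (auto simp: p_def q_def r'_def axial_diag_def axial_off_def axial_d_def)
  have ne1: "cT S (Suc i) - cT S i \<noteq> 0" if "cmp S i = cmp S (Suc i)"
    using not_same_line_content[OF S i(1) i'(1) _ that] exchange_std_iff[OF S i(1) i'(1)] S1 by (auto simp: cT_eq_iff)
  have ne2: "cT S (Suc (Suc i)) - cT S (Suc i) \<noteq> 0" if "cmp S (Suc i) = cmp S (Suc (Suc i))"
    using not_same_line_content[OF S i'(2) i(2) _ that] exchange_std_iff[OF S i'(2) i(2)] S2 by (auto simp: cT_eq_iff)
  have ne3: "cT S (Suc (Suc i)) - cT S i \<noteq> 0" if "cmp S i = cmp S (Suc (Suc i))"
    using not_same_line_content[OF S1 i'(2) i(2)] exchange_std_iff[OF S1 i'(2) i(2)] S12 A that by (auto simp: cT_eq_iff)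
  have q: "q = (if cmp S i = cmp S (Suc (Suc i)) then 1 else 0) / (cT S (Suc (Suc i)) - cT S i)"
    using A by (simp add: q_def axial_diag_eq cT_def)
  have yang_baxter: "p * r' = q * (p + r')"
  proof (cases "cmp S i = cmp S (Suc i) \<and> cmp S (Suc i) = cmp S (Suc (Suc i))")
    case True
    then show ?thesis using ne1 ne2 ne3 by (simp add: p_def r'_def q axial_diag_eq field_simps)
  next
    case False
    then show ?thesis by (auto simp: p_def r'_def q axial_diag_eq)
  qed
  let ?s = "sg i (Suc i)" and ?u = "sg (Suc i) (Suc (Suc i))"
  have ss: "?s * (?s * Y) = Y" "?u * (?u * Y) = Y" for Y
    using i by (simp_all add: mult.assoc[symmetric] sg_sq)
  have br: "?s * (?u * (?s * X)) = ?u * (?s * (?u * X))"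
  proof -
    have "?s * ?u = sg i (Suc (Suc i)) * ?s" using i by (intro sg_conj) auto
    moreover have "?u * sg (Suc i) i = sg (Suc (Suc i)) i * ?u"
      using i sg_conj[of "Suc (Suc i)" "Suc i" i] by (simp add: sg_commute)
    ultimately have "?s * ?u * ?s = sg i (Suc (Suc i))" "?u * ?s * ?u = sg i (Suc (Suc i))"
      using i sg_commute[of i "Suc i"] sg_commute[of i "Suc (Suc i)"] by (auto simp: mult.assoc sg_sq)
    then have "?s * ?u * ?s * X = ?u * ?s * ?u * X" by simp
    then show ?thesis by (simp only: mult.assoc)
  qed
  have key: "?s * (?u * (?s * X - p \<cdot> X) - q \<cdot> (?s * X - p \<cdot> X)) - r' \<cdot> (?u * (?s * X - p \<cdot> X) - q \<cdot> (?s * X - p \<cdot> X))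
     = ?u * (?s * (?u * X - r' \<cdot> X) - q \<cdot> (?u * X - r' \<cdot> X)) - p \<cdot> (?s * (?u * X - r' \<cdot> X) - q \<cdot> (?u * X - r' \<cdot> X))"
    (is "?L = ?R")
  proof -
    have "?L - ?R = (p * r' - q * (p + r')) \<cdot> (?u * X) - (p * r' - q * (p + r')) \<cdot> (?s * X)"
      by (simp add: galg_simps ss br) (rule poly_mapping_eqI, simp add: lookup_add lookup_minus algebra_simps)
    then show ?thesis using yang_baxter by simp
  qed
  let ?m = "1 / axial_off S i" and ?m' = "1 / axial_off ?A (Suc i)" and ?m'' = "1 / axial_off S (Suc i)"
  have "intertwiner ?AB i (intertwiner ?A (Suc i) (intertwiner S i X)) = (?m * ?m' * ?m'') \<cdot> ?L"
    unfolding intertwiner_def eqs p_def[symmetric] q_def[symmetric]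
    by (simp add: galg_simps mult_ac)
  moreover have "intertwiner ?BA (Suc i) (intertwiner ?B i (intertwiner S (Suc i) X)) = (?m * ?m' * ?m'') \<cdot> ?R"
    unfolding intertwiner_def eqs r'_def[symmetric]
    by (simp add: galg_simps mult_ac)
  ultimately show ?thesis using key by simp
qed


section \<open>Chains of exchanges and their confluence\<close>

lemma exchange_commute:
  assumes "Suc i < j \<or> Suc j < i"
  shows "exchange l i (exchange l j S) = exchange l j (exchange l i S)"
  using assms by (auto simp: exchange_def fun_eq_iff restrict_def Transposition.transpose_def)

lemma exchange_braid:
  "exchange l i (exchange l (Suc i) (exchange l i S)) = exchange l (Suc i) (exchange l i (exchange l (Suc i) S))"
  by (auto simp: exchange_def fun_eq_iff restrict_def Transposition.transpose_def)

text \<open>Only exchanges creating a descent relative to T are allowed. Hence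
  \<open>disorder T\<close> grows along every chain, and tracing a chain back to T
  terminates.\<close>

inductive reach :: "bitableau \<Rightarrow> galg \<Rightarrow> bitableau \<Rightarrow> galg \<Rightarrow> bool" for T E where
  base: "reach T E T E"
| step: "reach T E S X \<Longrightarrow> 1 \<le> i \<Longrightarrow> i < n \<Longrightarrow> exchange l i S \<in> SYT \<Longrightarrow> T (nd S i) < T (nd S (Suc i)) \<Longrightarrow>
    reach T E (exchange l i S) (intertwiner S i X)"

lemma reach_props:
  assumes "reach T E S X" "T \<in> SYT" "left_weight n (pT T) (cT T) E" "right_weight n p c E"
  shows "S \<in> SYT \<and> left_weight n (pT S) (cT S) X \<and> right_weight n p c X"
  using assms(1)
  by (induction rule: reach.induct) (use assms left_weight_intertwiner right_weight_intertwiner in auto)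

text \<open>As a function of i, \<open>T (nd S i)\<close> is strictly increasing from {1..n} to
  itself, hence the identity.\<close>

lemma no_descent:
  assumes T: "T \<in> SYT" and S: "S \<in> SYT"
    and le: "\<And>i. 1 \<le> i \<Longrightarrow> i < n \<Longrightarrow> \<not> T (nd S (Suc i)) < T (nd S i)"
  shows "S = T"
proof -
  have lt: "T (nd S i) < T (nd S (Suc i))" if "1 \<le> i" "i < n" for i
  proof -
    have r: "i \<in> {1..n}" "Suc i \<in> {1..n}" using that by auto
    have "T (nd S i) \<noteq> T (nd S (Suc i))"
      using nd_T[OF T nd_in[OF S r(1)]] nd_T[OF T nd_in[OF S r(2)]] nd_inj[OF S r] by (metis n_not_Suc_n)
    then show ?thesis using le[OF that] by simp
  qed
  have ge: "i \<le> T (nd S i)" if "i \<in> {1..n}" for i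
    using that
  proof (induction i)
    case (Suc i)
    show ?case
    proof (cases "i = 0")
      case True
      then show ?thesis using T_in[OF T nd_in[OF S Suc.prems]] by simp
    qed (use Suc lt[of i] in force)
  qed simp
  have up: "T (nd S (n - j)) \<le> n - j" if "j < n" for j
    using that
  proof (induction j)
    case 0
    then show ?case using T_in[OF T nd_in[OF S, of n]] by simp
  next
    case (Suc j)
    have "Suc (n - Suc j) = n - j" using Suc.prems by simp
    then show ?case using Suc lt[of "n - Suc j"] by force
  qed
  have eq: "T (nd S i) = i" if "i \<in> {1..n}" for i
    using ge[OF that] up[of "n - i"] that by force
  have "nd S i = nd T i" if "i \<in> {1..n}" for i
    using nd_T[OF T nd_in[OF S that]] eq[OF that] by simp
  then show ?thesis
    by (intro weights_determine_tableau[OF S T]) (simp add: component_def content_def)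
qed

lemma reach_exists:
  assumes T: "T \<in> SYT" and "S \<in> SYT"
  shows "\<exists>X. reach T E S X"
  using assms(2)
proof (induction "disorder T S" arbitrary: S rule: less_induct)
  case less
  show ?case
  proof (cases "S = T")
    case True
    then show ?thesis using reach.base by blast
  next
    case False
    then obtain i where i: "1 \<le> i" "i < n" "T (nd S (Suc i)) < T (nd S i)"
      using no_descent[OF T less.prems] by blast
    have E: "exchange l i S \<in> SYT"
      using descent_exchange_std[OF linear_tableau[OF T] less.prems i] .
    obtain X where X: "reach T E (exchange l i S) X"
      using less.hyps[OF disorder_exchange[OF less.prems i(1,2) E i(3)] E] by blast
    have "i \<in> {1..n}" "Suc i \<in> {1..n}" using i by auto
    then have "T (nd (exchange l i S) i) < T (nd (exchange l i S) (Suc i))"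
      using nd_exchange[OF less.prems i(1,2) E] i(3) by simp
    then show ?thesis
      using reach.step[OF X i(1,2)] exchange_exchange[OF less.prems] less.prems by metis
  qed
qed

text \<open>Independence of the chain of exchanges, by Newman's lemma: two different descents of a tableau
  are joined by a square or by a braid hexagon.\<close>

lemma reach_unique:
  assumes T: "T \<in> SYT" and "reach T E S X" "reach T E S X'"
  shows "X = X'"
  using assms(2,3)
proof (induction "disorder T S" arbitrary: S X X' rule: less_induct)
  case less
  have in_SYT: "reach T E S X \<Longrightarrow> S \<in> SYT" for S X
    by (induction rule: reach.induct) (use T in auto)
  have S: "S \<in> SYT" using in_SYT less.prems by blast
  have inv: "(S = T \<and> X = E) \<or> (\<exists>i X0. 1 \<le> i \<and> i < n \<and> exchange l i S \<in> SYT \<and>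
      T (nd S (Suc i)) < T (nd S i) \<and> reach T E (exchange l i S) X0 \<and> X = intertwiner (exchange l i S) i X0)"
    if "reach T E S X" for X
    using that
  proof (cases rule: reach.cases)
    case (step S0 X0 i)
    have S0: "S0 \<in> SYT" using in_SYT step by blast
    have r: "i \<in> {1..n}" "Suc i \<in> {1..n}" using step by auto
    have "exchange l i S = S0" using step exchange_exchange[OF S0] by simp
    moreover have "T (nd S (Suc i)) < T (nd S i)"
      using nd_exchange[OF S0 step(4,5,6)] r step by simp
    ultimately show ?thesis using step S0 by blast
  qed simp
  have asc: "T (nd (exchange l i S) i) < T (nd (exchange l i S) (Suc i))"
    if "S \<in> SYT" "1 \<le> i" "i < n" "exchange l i S \<in> SYT" "T (nd S (Suc i)) < T (nd S i)" for S i
  proof -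
    have "i \<in> {1..n}" "Suc i \<in> {1..n}" using that by auto
    then show ?thesis using nd_exchange[OF that(1-4)] that(5) by simp
  qed
  have desc_std: "exchange l i S \<in> SYT"
    if "S \<in> SYT" "1 \<le> i" "i < n" "T (nd S (Suc i)) < T (nd S i)" for S i
    using descent_exchange_std[OF linear_tableau[OF T] that] .
  have noT: "\<not> T (nd T (Suc i)) < T (nd T i)" if "1 \<le> i" "i < n" for i
    using T_nd[OF T, of i] T_nd[OF T, of "Suc i"] that by simp
  have main: "intertwiner (exchange l i S) i X0 = intertwiner (exchange l j S) j X0'"
    if i: "1 \<le> i" "i < n" "exchange l i S \<in> SYT" "T (nd S (Suc i)) < T (nd S i)" "reach T E (exchange l i S) X0"
      and j: "1 \<le> j" "j < n" "exchange l j S \<in> SYT" "T (nd S (Suc j)) < T (nd S j)" "reach T E (exchange l j S) X0'"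
      and ij: "i \<le> j" for i j X0 X0'
  proof -
    have ri: "i \<in> {1..n}" "Suc i \<in> {1..n}" and rj: "j \<in> {1..n}" "Suc j \<in> {1..n}" using i j by auto
    note IHi = less.hyps[OF disorder_exchange[OF S i(1-4)] i(5)]
    note IHj = less.hyps[OF disorder_exchange[OF S j(1-4)] j(5)]
    note ni = nd_exchange[OF S i(1-3)] and nj = nd_exchange[OF S j(1-3)]
    consider "i = j" | "j = Suc i" | "Suc i < j" using ij by linarith
    then show ?thesis
    proof cases
      case 1
      then show ?thesis using IHi[of X0'] j by simp
    next
      case 3
      let ?Si = "exchange l i S" and ?Sj = "exchange l j S"
      have di: "T (nd ?Sj (Suc i)) < T (nd ?Sj i)" and dj: "T (nd ?Si (Suc j)) < T (nd ?Si j)"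
        using nj[OF ri(1)] nj[OF ri(2)] ni[OF rj(1)] ni[OF rj(2)] i(4) j(4) 3
        by (auto simp: Transposition.transpose_def)
      \<comment> \<open>U lies below both predecessors of S; by the induction hypothesis both
        vectors come from one vector Y at U.\<close>
      define U where "U = exchange l j ?Si"
      have U: "U \<in> SYT" unfolding U_def by (rule desc_std[OF i(3) j(1,2) dj])
      have U': "U = exchange l i ?Sj" unfolding U_def by (rule exchange_commute) (use 3 in auto)
      obtain Y where Y: "reach T E U Y" using reach_exists[OF T U] by blast
      have Ui: "exchange l j U = ?Si" unfolding U_def by (rule exchange_exchange[OF i(3)])
      have Uj: "exchange l i U = ?Sj" unfolding U' by (rule exchange_exchange[OF j(3)])
      have "reach T E (exchange l j U) (intertwiner U j Y)"
        by (rule reach.step[OF Y j(1,2)])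
          (use Ui i(3) asc[OF i(3) j(1,2) U[unfolded U_def] dj] in \<open>auto simp: U_def\<close>)
      then have 1: "X0 = intertwiner U j Y" unfolding Ui by (rule IHi)
      have "reach T E (exchange l i U) (intertwiner U i Y)"
        by (rule reach.step[OF Y i(1,2)])
          (use Uj j(3) asc[OF j(3) i(1,2) U[unfolded U'] di] in \<open>auto simp: U'\<close>)
      then have 2: "X0' = intertwiner U i Y" unfolding Uj by (rule IHj)
      have "intertwiner (exchange l i U) j (intertwiner U i Y) = intertwiner (exchange l j U) i (intertwiner U j Y)"
        by (rule intertwiner_commute[OF U i(1,2) _ j(1,2)]) (use Ui Uj i(3) j(3) 3 in auto)
      then show ?thesis unfolding 1 2 Ui Uj by simp
    next
      case 2
      let ?Si = "exchange l i S" and ?Sj = "exchange l j S"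
      have rk: "Suc (Suc i) \<in> {1..n}" using rj 2 by simp
      have tp: "swap i (Suc i) (Suc (Suc i)) = Suc (Suc i)"
        "swap (Suc i) (Suc (Suc i)) i = i" by (auto simp: Transposition.transpose_def)
      have v: "T (nd S (Suc (Suc i))) < T (nd S (Suc i))" "T (nd S (Suc i)) < T (nd S i)" using i j 2 by auto
      have A: "nd ?Si i = nd S (Suc i)" "nd ?Si (Suc i) = nd S i" "nd ?Si (Suc (Suc i)) = nd S (Suc (Suc i))"
        using ni[OF ri(1)] ni[OF ri(2)] ni[OF rk] tp by auto
      have B: "nd ?Sj i = nd S i" "nd ?Sj (Suc i) = nd S (Suc (Suc i))" "nd ?Sj (Suc (Suc i)) = nd S (Suc i)"
        using nj[OF ri(1)] nj[OF ri(2)] nj[OF rk] tp 2 by auto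
      define A1 where "A1 = exchange l (Suc i) ?Si"
      define B1 where "B1 = exchange l i ?Sj"
      have dA: "T (nd ?Si (Suc (Suc i))) < T (nd ?Si (Suc i))" using A v by simp
      have dB: "T (nd ?Sj (Suc i)) < T (nd ?Sj i)" using B v by simp
      have si: "Suc i < n" "1 \<le> Suc i" using j 2 by auto
      have A1: "A1 \<in> SYT" unfolding A1_def by (rule desc_std[OF i(3) si(2,1) dA])
      have B1: "B1 \<in> SYT" unfolding B1_def by (rule desc_std[OF j(3) i(1,2) dB])
      have nA1: "nd A1 i = nd S (Suc i)" "nd A1 (Suc i) = nd S (Suc (Suc i))"
        using nd_exchange[OF i(3) si(2,1) A1[unfolded A1_def]] ri A tp unfolding A1_def by auto
      have nB1: "nd B1 (Suc i) = nd S i" "nd B1 (Suc (Suc i)) = nd S (Suc i)"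
        using nd_exchange[OF j(3) i(1,2) B1[unfolded B1_def]] ri rk B tp unfolding B1_def by auto
      have dA1: "T (nd A1 (Suc i)) < T (nd A1 i)" using nA1 v by simp
      have dB1: "T (nd B1 (Suc (Suc i))) < T (nd B1 (Suc i))" using nB1 v by simp
      \<comment> \<open>The bottom of the hexagon: both chains of three descents from S end in
        U.\<close>
      define U where "U = exchange l i A1"
      have U: "U \<in> SYT" unfolding U_def by (rule desc_std[OF A1 i(1,2) dA1])
      have U': "U = exchange l (Suc i) B1"
        unfolding U_def A1_def B1_def 2 by (rule exchange_braid)
      obtain Y where Y: "reach T E U Y" using reach_exists[OF T U] by blast
      have UA: "exchange l i U = A1" unfolding U_def by (rule exchange_exchange[OF A1])
      have UB: "exchange l (Suc i) U = B1" unfolding U' by (rule exchange_exchange[OF B1])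
      have AA: "exchange l (Suc i) A1 = ?Si" unfolding A1_def by (rule exchange_exchange[OF i(3)])
      have BB: "exchange l i B1 = ?Sj" unfolding B1_def by (rule exchange_exchange[OF j(3)])
      have "reach T E (exchange l i U) (intertwiner U i Y)"
        by (rule reach.step[OF Y i(1,2)])
          (use UA A1 asc[OF A1 i(1,2) U[unfolded U_def] dA1] in \<open>auto simp: U_def\<close>)
      then have r1: "reach T E A1 (intertwiner U i Y)" by (simp only: UA)
      have "reach T E (exchange l (Suc i) A1) (intertwiner A1 (Suc i) (intertwiner U i Y))"
        by (rule reach.step[OF r1 si(2,1)])
          (use AA i(3) asc[OF i(3) si(2,1) A1[unfolded A1_def] dA] in \<open>auto simp: A1_def\<close>)
      then have 1: "X0 = intertwiner A1 (Suc i) (intertwiner U i Y)" unfolding AA by (rule IHi)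
      have "reach T E (exchange l (Suc i) U) (intertwiner U (Suc i) Y)"
        by (rule reach.step[OF Y si(2,1)])
          (use UB B1 asc[OF B1 si(2,1) U[unfolded U'] dB1] in \<open>auto simp: U'\<close>)
      then have r2: "reach T E B1 (intertwiner U (Suc i) Y)" by (simp only: UB)
      have "reach T E (exchange l i B1) (intertwiner B1 i (intertwiner U (Suc i) Y))"
        by (rule reach.step[OF r2 i(1,2)])
          (use BB j(3) asc[OF j(3) i(1,2) B1[unfolded B1_def] dB] in \<open>auto simp: B1_def\<close>)
      then have b2: "X0' = intertwiner B1 i (intertwiner U (Suc i) Y)" unfolding BB by (rule IHj)
      have "intertwiner (exchange l (Suc i) (exchange l i U)) i (intertwiner (exchange l i U) (Suc i) (intertwiner U i Y))
         = intertwiner (exchange l i (exchange l (Suc i) U)) (Suc i) (intertwiner (exchange l (Suc i) U) i (intertwiner U (Suc i) Y))"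
        by (rule intertwiner_braid[OF U i(1) si(1)]) (use UA UB AA BB A1 B1 i(3) j(3) in auto)
      then show ?thesis unfolding 1 b2 UA UB AA BB 2 by simp
    qed
  qed
  from inv[OF less.prems(1)] inv[OF less.prems(2)] show ?case
  proof (elim disjE exE conjE)
    fix i X0 j X0'
    assume A: "1 \<le> i" "i < n" "exchange l i S \<in> SYT" "T (nd S (Suc i)) < T (nd S i)" "reach T E (exchange l i S) X0"
      "X = intertwiner (exchange l i S) i X0"
      "1 \<le> j" "j < n" "exchange l j S \<in> SYT" "T (nd S (Suc j)) < T (nd S j)" "reach T E (exchange l j S) X0'"
      "X' = intertwiner (exchange l j S) j X0'"
    show "X = X'"
    proof (cases "i \<le> j")
      case True
      show ?thesis unfolding A(6,12) by (rule main[OF A(1-5) A(7-11) True])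
    next
      case False
      then have "j \<le> i" by simp
      from main[OF A(7-11) A(1-5) this] show ?thesis unfolding A(6,12) by (rule sym)
    qed
  qed (use noT in auto)
qed

definition seminormal :: "bitableau \<Rightarrow> galg \<Rightarrow> bitableau \<Rightarrow> galg" where
  "seminormal T E S = (THE X. reach T E S X)"

lemma reach_seminormal: "T \<in> SYT \<Longrightarrow> S \<in> SYT \<Longrightarrow> reach T E S (seminormal T E S)"
  unfolding seminormal_def using reach_exists reach_unique by (metis theI)

lemma seminormal_eq: "T \<in> SYT \<Longrightarrow> reach T E S X \<Longrightarrow> seminormal T E S = X"
  unfolding seminormal_def using reach_unique by blast

lemma seminormal_base: "T \<in> SYT \<Longrightarrow> seminormal T E T = E"
  using seminormal_eq reach.base by blast

text \<open>An exchange that creates a descent is a step of \<open>reach\<close>; one that removes a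
  descent inverts such a step, because the intertwiners of the two directions are mutually
  inverse.\<close>

lemma intertwiner_seminormal:
  assumes T: "T \<in> SYT" and S: "S \<in> SYT" and i: "1 \<le> i" "i < n" and E: "exchange l i S \<in> SYT"
  shows "intertwiner S i (seminormal T E S) = seminormal T E (exchange l i S)"
proof -
  have r: "i \<in> {1..n}" "Suc i \<in> {1..n}" using i by auto
  have ne: "T (nd S i) \<noteq> T (nd S (Suc i))"
    using nd_T[OF T nd_in[OF S r(1)]] nd_T[OF T nd_in[OF S r(2)]] nd_inj[OF S r] by (metis n_not_Suc_n)
  show ?thesis
  proof (cases "T (nd S i) < T (nd S (Suc i))")
    case True
    then show ?thesis using seminormal_eq[OF T reach.step[OF reach_seminormal[OF T S] i E]] by simp
  next
    case False
    let ?S = "exchange l i S"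
    have "T (nd ?S i) < T (nd ?S (Suc i))" using nd_exchange[OF S i E] r False ne by simp
    then have "reach T E (exchange l i ?S) (intertwiner ?S i (seminormal T E ?S))"
      using reach.step[OF reach_seminormal[OF T E] i] exchange_exchange[OF S] S by simp
    then have "seminormal T E S = intertwiner ?S i (seminormal T E ?S)" using seminormal_eq[OF T] exchange_exchange[OF S] by simp
    moreover have "intertwiner (exchange l i ?S) i (intertwiner ?S i (seminormal T E ?S)) = seminormal T E ?S"
      by (rule intertwiner_intertwiner[OF E i]) (simp add: exchange_exchange[OF S] S)
    ultimately show ?thesis using exchange_exchange[OF S] by simp
  qed
qed

text \<open>The traces of tau_m e_S and of jm m e_S can be read off from the left weight, that of S,
  or from the right weight, that of T; some m separates the two.\<close>

lemma coef_seminormal: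
  assumes T: "T \<in> SYT" and S: "S \<in> SYT" and ne: "S \<noteq> T"
    and E: "left_weight n (pT T) (cT T) E" "right_weight n (pT T) (cT T) E"
  shows "coef (seminormal T E S) 0 = 0"
proof -
  have w: "left_weight n (pT S) (cT S) (seminormal T E S)" "right_weight n (pT T) (cT T) (seminormal T E S)"
    using reach_props[OF reach_seminormal[OF T S] T E] by auto
  obtain m where m: "m \<in> {1..n}" "\<not> (cmp S m = cmp T m \<and> ct S m = ct T m)"
    using weights_determine_tableau[OF S T] ne by blast
  have swap_perm: "coef (Y * seminormal T E S) 0 = coef (seminormal T E S * Y) 0" for Y by (rule coef_0_commute)
  have "pT S m * coef (seminormal T E S) 0 = pT T m * coef (seminormal T E S) 0"
    using swap_perm[of "tau m"] w m(1) by (simp add: left_weight_def right_weight_def)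
  moreover have "cT S m * coef (seminormal T E S) 0 = cT T m * coef (seminormal T E S) 0"
    using swap_perm[of "jm m"] w m(1) by (simp add: left_weight_def right_weight_def)
  moreover have "pT S m \<noteq> pT T m \<or> cT S m \<noteq> cT T m"
  proof -
    have "cmp S m = 1 \<or> cmp S m = 2" "cmp T m = 1 \<or> cmp T m = 2" using cmp_cases S T m by auto
    then show ?thesis using m(2) by (auto simp: pT_def cT_def sgn_p_def xi_def)
  qed
  ultimately show ?thesis by auto
qed

lemma finite_SYT: "finite SYT"
proof (cases "SYT = {}")
  case False
  then obtain T where "T \<in> SYT" by blast
  then have fin: "finite (nodes l)" by (rule finite_nodes)
  have "SYT \<subseteq> PiE (nodes l) (\<lambda>_. {1..n})"
  proof
    fix S assume S: "S \<in> SYT"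
    then have ext: "S \<in> extensional (nodes l)" by (simp add: standard_bitableaux_def)
    show "S \<in> PiE (nodes l) (\<lambda>_. {1..n})"
      using T_in[OF S] extensional_arb[OF ext] by (rule PiE_I)
  qed
  moreover have "finite (PiE (nodes l) (\<lambda>_. {1..n}))" by (rule finite_PiE[OF fin]) simp
  ultimately show ?thesis by (rule finite_subset)
qed simp

section \<open>Matrix elements\<close>

lemma basis_rep: "S \<in> SYT \<Longrightarrow> basis_vec S \<in> rep_space l"
  by (auto simp: rep_space_def basis_vec_def)

lemma act_expand:
  assumes act: "young_orthogonal_rep n l act" and g: "g \<in> carrier (hyperoctahedral n)" and u: "u \<in> rep_space l"
  shows "act g u S' = (\<Sum>S\<in>SYT. u S * act g (basis_vec S) S')"
proof -
  have lin: "act g (\<lambda>T. a * u T + b * v T) = (\<lambda>T. a * act g u T + b * act g v T)"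
    if "u \<in> rep_space l" "v \<in> rep_space l" for u v a b
    using act g that unfolding young_orthogonal_rep_def by blast
  have fin: "(\<lambda>T. \<Sum>S\<in>F. u S * basis_vec S T) \<in> rep_space l \<and>
      act g (\<lambda>T. \<Sum>S\<in>F. u S * basis_vec S T) = (\<lambda>T. \<Sum>S\<in>F. u S * act g (basis_vec S) T)"
    if "finite F" "F \<subseteq> SYT" for F
    using that
  proof (induction F rule: finite_induct)
    case empty
    have "(\<lambda>_. 0) \<in> rep_space l" by (simp add: rep_space_def)
    then show ?case using lin[of u u 0 0] u by simp
  next
    case (insert S F)
    let ?v = "\<lambda>T. \<Sum>S\<in>F. u S * basis_vec S T"
    have v: "?v \<in> rep_space l" "act g ?v = (\<lambda>T. \<Sum>S\<in>F. u S * act g (basis_vec S) T)" using insert by auto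
    have b: "basis_vec S \<in> rep_space l" using basis_rep insert.prems by simp
    have e: "(\<lambda>T. \<Sum>S\<in>insert S F. u S * basis_vec S T) = (\<lambda>T. u S * basis_vec S T + 1 * ?v T)"
      using insert.hyps by simp
    have "(\<lambda>T. u S * basis_vec S T + 1 * ?v T) \<in> rep_space l"
      using v(1) b by (simp add: rep_space_def)
    then show ?case
      unfolding e lin[OF b v(1)] v(2) using insert.hyps by simp
  qed
  have "u = (\<lambda>T. \<Sum>S\<in>SYT. u S * basis_vec S T)"
  proof
    fix T
    have "(\<Sum>S\<in>SYT. u S * basis_vec S T) = (\<Sum>S\<in>SYT. if S = T then u S else 0)"
      by (rule sum.cong) (auto simp: basis_vec_def)
    also have "\<dots> = u T" using u finite_SYT by (auto simp: rep_space_def)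
    finally show "u T = (\<Sum>S\<in>SYT. u S * basis_vec S T)" by simp
  qed
  then show ?thesis using fin[OF finite_SYT order_refl] by metis
qed

lemma act_s:
  assumes act: "young_orthogonal_rep n l act" and i: "1 \<le> i" "i < n" and S: "S \<in> SYT"
  shows "act (gen_s i) (basis_vec S) = (\<lambda>S'. axial_diag S i * basis_vec S S' +
      (if exchange l i S \<in> SYT then axial_off S i * basis_vec (exchange l i S) S' else 0))"
proof -
  have "act (gen_s i) (basis_vec S) =
         (if cmp S i = cmp S (i + 1) then
            if exchange l i S \<in> SYT then
              (\<lambda>S'. complex_of_real (axial_d l i S) * basis_vec S S'
                 + complex_of_real (sqrt (1 - (axial_d l i S)\<^sup>2)) * basis_vec (exchange l i S) S')
            else (\<lambda>S'. complex_of_real (axial_d l i S) * basis_vec S S')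
          else basis_vec (exchange l i S))"
    by (rule act[unfolded young_orthogonal_rep_def, THEN conjunct2, THEN conjunct2, THEN conjunct1,
          THEN spec[of _ i], THEN spec[of _ S], THEN mp]) (use i S in simp)
  moreover have "exchange l i S \<in> SYT" if "cmp S i \<noteq> cmp S (Suc i)"
    using exchange_std[OF S i] that by (simp add: same_line_def)
  ultimately show ?thesis by (auto simp: axial_diag_def axial_off_def fun_eq_iff)
qed

lemma act_t:
  assumes act: "young_orthogonal_rep n l act" and n: "1 \<le> n" and S: "S \<in> SYT"
  shows "act gen_t (basis_vec S) = (\<lambda>S'. pT S 1 * basis_vec S S')"
proof -
  have "act gen_t (basis_vec S) = (if cmp S 1 = 1 then basis_vec S else (\<lambda>S'. - basis_vec S S'))"
    by (rule act[unfolded young_orthogonal_rep_def, THEN conjunct2, THEN conjunct2, THEN conjunct2,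
          THEN spec[of _ S], THEN mp]) (use n S in simp)
  then show ?thesis by (auto simp: pT_def sgn_p_def xi_def)
qed

lemma act_comp:
  assumes act: "young_orthogonal_rep n l act" and gh: "g \<in> carrier (hyperoctahedral n)" "h \<in> carrier (hyperoctahedral n)"
    and S: "S \<in> SYT"
  shows "act (g \<circ> h) (basis_vec S) S'' = (\<Sum>S'\<in>SYT. act h (basis_vec S) S' * act g (basis_vec S') S'')"
proof -
  have ga: "group_action (hyperoctahedral n) (rep_space l) act"
    using act by (simp add: young_orthogonal_rep_def)
  have "act (g \<circ> h) (basis_vec S) = act g (act h (basis_vec S))"
    using group_action.composition_rule[OF ga basis_rep[OF S] gh] by (simp add: hyp_mult)
  moreover have "act h (basis_vec S) \<in> rep_space l"
    using group_action.element_image[OF ga gh(2) basis_rep[OF S]] by simp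
  ultimately show ?thesis using act_expand[OF act gh(1)] by simp
qed

lemma act_id:
  assumes act: "young_orthogonal_rep n l act" and S: "S \<in> SYT"
  shows "act id (basis_vec S) = basis_vec S"
proof -
  have ga: "group_action (hyperoctahedral n) (rep_space l) act"
    using act by (simp add: young_orthogonal_rep_def)
  show ?thesis
    using group_action.id_eq_one[OF ga] basis_rep[OF S] by (metis hyp_one restrict_apply')
qed

text \<open>It suffices to compare generators. The case not built into the construction is that of
  i, i + 1 in one line: there the contents differ by 1 or -1 and \<open>left_weight_adjacent\<close>
  yields the sign prescribed by Young's form.\<close>

lemma seminormal_act:
  assumes act: "young_orthogonal_rep n l act" and g: "g \<in> carrier (hyperoctahedral n)"
    and T: "T \<in> SYT" and E: "left_weight n (pT T) (cT T) E" "right_weight n (pT T) (cT T) E" and S: "S \<in> SYT"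
  shows "(\<Sum>S'\<in>SYT. act g (basis_vec S) S' \<cdot> seminormal T E S') = gr (Sperm g) * seminormal T E S"
proof -
  have b1: "(\<Sum>S'\<in>SYT. (basis_vec S S' * c) \<cdot> seminormal T E S') = c \<cdot> seminormal T E S" if "S \<in> SYT" for S c
  proof -
    have "(\<Sum>S'\<in>SYT. (basis_vec S S' * c) \<cdot> seminormal T E S') = (\<Sum>S'\<in>SYT. if S' = S then c \<cdot> seminormal T E S' else 0)"
      by (rule sum.cong) (auto simp: basis_vec_def)
    then show ?thesis using that finite_SYT by simp
  qed
  have gs: "(\<Sum>S'\<in>SYT. act (gen_s i) (basis_vec S) S' \<cdot> seminormal T E S') = sg i (Suc i) * seminormal T E S"
    if i: "1 \<le> i" "i < n" and S: "S \<in> SYT" for i S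
  proof (cases "exchange l i S \<in> SYT")
    case True
    then show ?thesis
      using b1[OF S, of "axial_diag S i"] b1[OF True, of "axial_off S i"] s_intertwiner[OF S i True, of "seminormal T E S"] intertwiner_seminormal[OF T S i True]
      by (simp add: act_s[OF act i S] av.scale_left_distrib sum.distrib mult.commute)
  next
    case False
    have sl: "same_line S i" using exchange_std_iff[OF S i] False by simp
    then have c: "cmp S i = cmp S (Suc i)" by (simp add: same_line_def)
    have r: "i \<in> {1..n}" "Suc i \<in> {1..n}" using i by auto
    define e where "e = cT S (Suc i) - cT S i"
    have e: "e = 1 \<or> e = - 1" using same_line_content[OF S i sl] by (auto simp: e_def cT_def)
    have w: "left_weight n (pT S) (cT S) (seminormal T E S)" using reach_props[OF reach_seminormal[OF T S] T E] by auto
    have "sg i (Suc i) * seminormal T E S = e \<cdot> seminormal T E S"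
    proof (rule left_weight_adjacent)
      show "tau i * seminormal T E S = pT S i \<cdot> seminormal T E S" "tau (Suc i) * seminormal T E S = pT S i \<cdot> seminormal T E S"
        using w r pT_eq_iff[OF S r] c by (auto simp: left_weight_def)
      show "jm i * seminormal T E S = cT S i \<cdot> seminormal T E S" "jm (Suc i) * seminormal T E S = (cT S i + e) \<cdot> seminormal T E S"
        using w r by (auto simp: left_weight_def e_def)
    qed (use e i pT_sq in \<open>auto simp: cT_def\<close>)
    moreover have "axial_diag S i = e" using c e by (auto simp: axial_diag_eq e_def[symmetric])
    ultimately show ?thesis
      using b1[OF S, of "axial_diag S i"] False by (simp add: act_s[OF act i S] mult.commute)
  qed
  have gt: "(\<Sum>S'\<in>SYT. act gen_t (basis_vec S) S' \<cdot> seminormal T E S') = tau 1 * seminormal T E S"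
    if n: "1 \<le> n" and S: "S \<in> SYT" for S
  proof -
    have w: "left_weight n (pT S) (cT S) (seminormal T E S)" using reach_props[OF reach_seminormal[OF T S] T E] by auto
    then show ?thesis
      using b1[OF S, of "pT S 1"] n by (simp add: act_t[OF act n S] mult.commute left_weight_def)
  qed
  have comp: "\<forall>S\<in>SYT. (\<Sum>S''\<in>SYT. act (r \<circ> g) (basis_vec S) S'' \<cdot> seminormal T E S'') = gr (Sperm (r \<circ> g)) * seminormal T E S"
    if r: "r \<in> carrier (hyperoctahedral n)" and g: "g \<in> carrier (hyperoctahedral n)"
      and hr: "\<And>S. S \<in> SYT \<Longrightarrow> (\<Sum>S'\<in>SYT. act r (basis_vec S) S' \<cdot> seminormal T E S') = gr (Sperm r) * seminormal T E S"
      and hg: "\<forall>S\<in>SYT. (\<Sum>S'\<in>SYT. act g (basis_vec S) S' \<cdot> seminormal T E S') = gr (Sperm g) * seminormal T E S" for r g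
  proof
    fix S assume S: "S \<in> SYT"
    have "(\<Sum>S''\<in>SYT. act (r \<circ> g) (basis_vec S) S'' \<cdot> seminormal T E S'')
        = (\<Sum>S''\<in>SYT. \<Sum>S'\<in>SYT. act g (basis_vec S) S' \<cdot> (act r (basis_vec S') S'' \<cdot> seminormal T E S''))"
      by (simp add: act_comp[OF act r g S] av.scale_sum_left)
    also have "\<dots> = (\<Sum>S'\<in>SYT. act g (basis_vec S) S' \<cdot> (\<Sum>S''\<in>SYT. act r (basis_vec S') S'' \<cdot> seminormal T E S''))"
      by (subst sum.swap) (simp add: av.scale_sum_right)
    also have "\<dots> = gr (Sperm r) * (\<Sum>S'\<in>SYT. act g (basis_vec S) S' \<cdot> seminormal T E S')"
      by (simp add: hr sum_distrib_left)
    also have "\<dots> = gr (Sperm (r \<circ> g)) * seminormal T E S"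
      using hg S Sperm_comp[OF r g] by (simp add: mult.assoc[symmetric] gr_mult)
    finally show "(\<Sum>S''\<in>SYT. act (r \<circ> g) (basis_vec S) S'' \<cdot> seminormal T E S'') = gr (Sperm (r \<circ> g)) * seminormal T E S" .
  qed
  have "\<forall>S\<in>SYT. (\<Sum>S'\<in>SYT. act g (basis_vec S) S' \<cdot> seminormal T E S') = gr (Sperm g) * seminormal T E S"
    using g
  proof (induction rule: hyp_gen_induct)
    case id
    show ?case
    proof
      fix S assume S: "S \<in> SYT"
      show "(\<Sum>S'\<in>SYT. act id (basis_vec S) S' \<cdot> seminormal T E S') = gr (Sperm id) * seminormal T E S"
        unfolding act_id[OF act S] Sperm_id using b1[OF S, of 1] by simp
    qed
  next
    case (s i g)
    show ?case
      by (rule comp[OF gens_in_hyperoctahedral(1)[OF s(1,2)] s(3) _ s(4)])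
        (use gs[OF s(1,2)] s(1) in \<open>simp add: Sperm_s sg_def\<close>)
  next
    case (t g)
    show ?case
      by (rule comp[OF gens_in_hyperoctahedral(2)[OF t(1)] t(2) _ t(3)])
        (use gt[OF t(1)] in \<open>simp add: Sperm_t tau_def\<close>)
  qed
  then show ?thesis using S by blast
qed

text \<open>Generators act by symmetric matrices and are involutions, so inversion transposes
  matrices. This is needed because the coefficient of g in E is read off from the action of the
  inverse of g.\<close>

lemma act_symmetric:
  assumes act: "young_orthogonal_rep n l act" and g: "g \<in> carrier (hyperoctahedral n)"
  shows "\<forall>S\<in>SYT. \<forall>S'\<in>SYT. act g (basis_vec S) S' = act (finv g) (basis_vec S') S"
proof -
  have comp: "\<forall>S\<in>SYT. \<forall>S'\<in>SYT. act (r \<circ> g) (basis_vec S) S' = act (finv (r \<circ> g)) (basis_vec S') S"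
    if r: "r \<in> carrier (hyperoctahedral n)" "r \<circ> r = id" and g: "g \<in> carrier (hyperoctahedral n)"
      and hr: "\<And>S S'. S \<in> SYT \<Longrightarrow> S' \<in> SYT \<Longrightarrow> act r (basis_vec S) S' = act r (basis_vec S') S"
      and hg: "\<forall>S\<in>SYT. \<forall>S'\<in>SYT. act g (basis_vec S) S' = act (finv g) (basis_vec S') S" for r g
  proof (intro ballI)
    fix S S' assume S: "S \<in> SYT" "S' \<in> SYT"
    have bij: "bij r" "bij g" using r g hyp_sperm by blast+
    have "finv r = r" using r(2) bij by (metis inv_unique_comp)
    then have inv: "finv (r \<circ> g) = finv g \<circ> r" using o_inv_distrib[OF bij] by simp
    have "act (r \<circ> g) (basis_vec S) S' = (\<Sum>U\<in>SYT. act g (basis_vec S) U * act r (basis_vec U) S')"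
      by (rule act_comp[OF act r(1) g S(1)])
    also have "\<dots> = (\<Sum>U\<in>SYT. act r (basis_vec S') U * act (finv g) (basis_vec U) S)"
      by (rule sum.cong) (use hr hg S in \<open>auto simp: mult.commute\<close>)
    also have "\<dots> = act (finv (r \<circ> g)) (basis_vec S') S"
      unfolding inv by (rule act_comp[OF act hyp_inv(1)[OF g] r(1) S(2), symmetric])
    finally show "act (r \<circ> g) (basis_vec S) S' = act (finv (r \<circ> g)) (basis_vec S') S" .
  qed
  have sym_s: "act (gen_s i) (basis_vec S) S' = act (gen_s i) (basis_vec S') S"
    if i: "1 \<le> i" "i < n" and S: "S \<in> SYT" "S' \<in> SYT" for i S S'
  proof -
    have "exchange l i S = S' \<longleftrightarrow> exchange l i S' = S" using exchange_exchange S by metis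
    moreover have "axial_off (exchange l i S) i = axial_off S i" if "exchange l i S = S'"
      using axial_diag_exchange(2)[OF S(1) i] S that by simp
    ultimately show ?thesis
      unfolding act_s[OF act i S(1)] act_s[OF act i S(2)] using S by (auto simp: basis_vec_def)
  qed
  have sym_t: "act gen_t (basis_vec S) S' = act gen_t (basis_vec S') S"
    if n: "1 \<le> n" and S: "S \<in> SYT" "S' \<in> SYT" for S S'
    unfolding act_t[OF act n S(1)] act_t[OF act n S(2)] by (simp add: basis_vec_def)
  show ?thesis
    using g
  proof (induction rule: hyp_gen_induct)
    case id
    show ?case
    proof (intro ballI)
      fix S S' assume S: "S \<in> SYT" "S' \<in> SYT"
      show "act id (basis_vec S) S' = act (finv id) (basis_vec S') S"
        unfolding inv_id act_id[OF act S(1)] act_id[OF act S(2)] by (simp add: basis_vec_def)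
    qed
  next
    case (s i g)
    show ?case
      by (rule comp[OF gens_in_hyperoctahedral(1)[OF s(1,2)] coxeter_relations(1)[OF s(1)] s(3) _ s(4)])
        (rule sym_s[OF s(1,2)])
  next
    case (t g)
    show ?case
      by (rule comp[OF gens_in_hyperoctahedral(2)[OF t(1)] coxeter_relations(2) t(2) _ t(3)])
        (rule sym_t[OF t(1)])
  qed
qed

theorem weight_element_coef:
  assumes act: "young_orthogonal_rep n l act" and g: "g \<in> carrier (hyperoctahedral n)"
    and T: "T \<in> SYT" and E: "left_weight n (pT T) (cT T) E" "right_weight n (pT T) (cT T) E" "coef E 0 = 1 / 2 ^ n"
  shows "coef E (Sperm g) = 1 / 2 ^ n * diagonal_element n l act T g"
proof -
  let ?h = "finv g"
  note h = hyp_inv(1)[OF g]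
  have "coef E (Sperm g) = coef (gr (Sperm ?h) * seminormal T E T) 0"
    by (simp add: seminormal_base[OF T] Sperm_inv[OF g])
  also have "\<dots> = (\<Sum>S\<in>SYT. act ?h (basis_vec T) S * coef (seminormal T E S) 0)"
    unfolding seminormal_act[OF act h T E(1,2) T, symmetric] by (simp add: lookup_sum)
  also have "\<dots> = (\<Sum>S\<in>SYT. if S = T then act ?h (basis_vec T) T * coef E 0 else 0)"
    by (rule sum.cong) (use coef_seminormal[OF T _ _ E(1,2)] seminormal_base[OF T] in auto)
  also have "\<dots> = act ?h (basis_vec T) T / 2 ^ n" using T finite_SYT E(3) by simp
  also have "act ?h (basis_vec T) T = act g (basis_vec T) T"
    using act_symmetric[OF act g] T by simp
  also have "\<dots> = rep_inner l (basis_vec T) (act g (basis_vec T))"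
  proof -
    have "rep_inner l (basis_vec T) (act g (basis_vec T)) = (\<Sum>S\<in>SYT. if S = T then act g (basis_vec T) S else 0)"
      unfolding rep_inner_def by (rule sum.cong) (auto simp: basis_vec_def)
    then show ?thesis using T finite_SYT by simp
  qed
  finally show ?thesis using g by (simp add: diagonal_element_def)
qed

end

section \<open>Evaluation of polynomials and rational functions\<close>

definition monomial_eval :: "(var \<Rightarrow>\<^sub>0 nat) \<Rightarrow> (var \<Rightarrow> complex) \<Rightarrow> complex" where
  "monomial_eval m x = (\<Prod>v\<in>keys m. x v ^ lookup m v)"

lemma monomial_eval_superset:
  "finite A \<Longrightarrow> keys m \<subseteq> A \<Longrightarrow> monomial_eval m x = (\<Prod>v\<in>A. x v ^ lookup m v)"
  unfolding monomial_eval_def by (rule prod.mono_neutral_left) (auto simp: in_keys_iff)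

lemma monomial_eval_add: "monomial_eval (m + m') x = monomial_eval m x * monomial_eval m' x"
proof -
  let ?A = "keys m \<union> keys m'"
  have "keys (m + m') \<subseteq> ?A" by (rule keys_add)
  then show ?thesis
    using monomial_eval_superset[of ?A "m + m'"] monomial_eval_superset[of ?A m] monomial_eval_superset[of ?A m']
    by (simp add: lookup_add power_add prod.distrib)
qed

lemma meval_superset:
  "finite A \<Longrightarrow> keys p \<subseteq> A \<Longrightarrow> meval p x = (\<Sum>m\<in>A. lookup p m * monomial_eval m x)"
  unfolding meval_def monomial_eval_def by (rule sum.mono_neutral_left) (auto simp: in_keys_iff)

lemma meval_add: "meval (p + q) x = meval p x + meval q x"
proof -
  let ?A = "keys p \<union> keys q"
  have "keys (p + q) \<subseteq> ?A" by (rule keys_add)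
  then show ?thesis
    using meval_superset[of ?A "p + q"] meval_superset[of ?A p] meval_superset[of ?A q]
    by (simp add: lookup_add distrib_right sum.distrib)
qed

lemma meval_0: "meval 0 x = 0"
  by (simp add: meval_def)

lemma meval_sum: "meval (\<Sum>i\<in>I. f i) x = (\<Sum>i\<in>I. meval (f i) x)"
  by (induction I rule: infinite_finite_induct) (auto simp: meval_0 meval_add)

lemma meval_single: "meval (Poly_Mapping.single m c) x = c * monomial_eval m x"
  using meval_superset[of "{m}" "Poly_Mapping.single m c"] by simp

lemma mpoly_expand: "p = (\<Sum>m\<in>keys p. Poly_Mapping.single m (lookup p m))"
  for p :: mpoly
  by (rule poly_mapping_eqI) (auto simp: lookup_sum lookup_single when_def in_keys_iff)

lemma meval_mult: "meval (p * q) x = meval p x * meval q x"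
proof -
  have "meval (p * q) x = (\<Sum>m\<in>keys p. \<Sum>m'\<in>keys q.
      (lookup p m * monomial_eval m x) * (lookup q m' * monomial_eval m' x))"
    by (subst mpoly_expand[of p], subst mpoly_expand[of q])
       (simp add: sum_product meval_sum mult_single meval_single monomial_eval_add mult_ac)
  then show ?thesis
    by (simp add: meval_superset[of "keys p" p] meval_superset[of "keys q" q] sum_product)
qed

lemma meval_const: "meval (Poly_Mapping.single 0 c) x = c"
  by (simp add: meval_single monomial_eval_def)

lemma meval_1: "meval 1 x = 1"
  using meval_const[of 1] by simp

lemma meval_uminus: "meval (- p) x = - meval p x"
  using meval_add[of p "- p" x] by (simp add: meval_0 add_eq_0_iff2)

lemma meval_diff: "meval (p - q) x = meval p x - meval q x"
  using meval_add[of p "- q" x] by (simp add: meval_uminus)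

lemma meval_mvar: "meval (mvar v) x = x v"
  by (simp add: mvar_def meval_single monomial_eval_def)

lemma meval_prod: "meval (\<Prod>i\<in>I. f i) x = (\<Prod>i\<in>I. meval (f i) x)"
  by (induction I rule: infinite_finite_induct) (auto simp: meval_1 meval_mult)

text \<open>A formal fraction has no value by itself, since representatives differ in where their
  denominators vanish. One representative usable on all of G is carried through the ring
  operations.\<close>

definition eval_rel :: "(var \<Rightarrow> complex) set \<Rightarrow> ratfun \<Rightarrow> ((var \<Rightarrow> complex) \<Rightarrow> complex) \<Rightarrow> bool" where
  "eval_rel G f F \<longleftrightarrow> (\<exists>P Q. f = Fract P Q \<and> Q \<noteq> 0 \<and> (\<forall>y\<in>G. meval Q y \<noteq> 0 \<and> F y = meval P y / meval Q y))"

lemma eval_rel_poly: "eval_rel G (Fract P 1) (\<lambda>y. meval P y)"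
  unfolding eval_rel_def by (intro exI[of _ P] exI[of _ 1]) (simp add: meval_1)

lemma eval_rel_0: "eval_rel G 0 (\<lambda>_. 0)"
  using eval_rel_poly[of G 0] by (simp add: meval_0 Zero_fract_def)

lemma eval_rel_1: "eval_rel G 1 (\<lambda>_. 1)"
  using eval_rel_poly[of G 1] by (simp add: meval_1 One_fract_def)

lemma eval_rel_rvar: "eval_rel G (rvar v) (\<lambda>y. y v)"
  using eval_rel_poly[of G "mvar v"] by (simp add: meval_mvar rvar_def)

lemma eval_rel_add:
  assumes "eval_rel G f F" "eval_rel G f' F'"
  shows "eval_rel G (f + f') (\<lambda>y. F y + F' y)"
proof -
  obtain P Q P' Q' where "f = Fract P Q" "Q \<noteq> 0" "\<forall>y\<in>G. meval Q y \<noteq> 0 \<and> F y = meval P y / meval Q y"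
    "f' = Fract P' Q'" "Q' \<noteq> 0" "\<forall>y\<in>G. meval Q' y \<noteq> 0 \<and> F' y = meval P' y / meval Q' y"
    using assms unfolding eval_rel_def by metis
  then show ?thesis
    unfolding eval_rel_def
    by (intro exI[of _ "P * Q' + P' * Q"] exI[of _ "Q * Q'"])
       (auto simp: meval_add meval_mult add_frac_eq)
qed

lemma eval_rel_mult:
  assumes "eval_rel G f F" "eval_rel G f' F'"
  shows "eval_rel G (f * f') (\<lambda>y. F y * F' y)"
proof -
  obtain P Q P' Q' where "f = Fract P Q" "Q \<noteq> 0" "\<forall>y\<in>G. meval Q y \<noteq> 0 \<and> F y = meval P y / meval Q y"
    "f' = Fract P' Q'" "Q' \<noteq> 0" "\<forall>y\<in>G. meval Q' y \<noteq> 0 \<and> F' y = meval P' y / meval Q' y"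
    using assms unfolding eval_rel_def by metis
  then show ?thesis
    unfolding eval_rel_def
    by (intro exI[of _ "P * P'"] exI[of _ "Q * Q'"]) (auto simp: meval_mult)
qed

lemma eval_rel_uminus:
  assumes "eval_rel G f F"
  shows "eval_rel G (- f) (\<lambda>y. - F y)"
proof -
  obtain P Q where "f = Fract P Q" "Q \<noteq> 0" "\<forall>y\<in>G. meval Q y \<noteq> 0 \<and> F y = meval P y / meval Q y"
    using assms unfolding eval_rel_def by metis
  then show ?thesis
    unfolding eval_rel_def by (intro exI[of _ "- P"] exI[of _ Q]) (auto simp: meval_uminus)
qed

lemma eval_rel_diff: "eval_rel G f F \<Longrightarrow> eval_rel G f' F' \<Longrightarrow> eval_rel G (f - f') (\<lambda>y. F y - F' y)"
  using eval_rel_add[OF _ eval_rel_uminus, of G f F f' F'] by simp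

lemma eval_rel_of_nat: "eval_rel G (of_nat k) (\<lambda>_. of_nat k)"
  by (induction k) (simp_all add: eval_rel_0 eval_rel_add eval_rel_1)

lemma eval_rel_of_int: "eval_rel G (of_int k) (\<lambda>_. of_int k)"
  by (cases k) (use eval_rel_of_nat eval_rel_uminus[OF eval_rel_of_nat] in \<open>simp_all del: of_nat_Suc\<close>)

lemma eval_rel_inverse:
  assumes "eval_rel G f F" "\<And>y. y \<in> G \<Longrightarrow> F y \<noteq> 0" "G \<noteq> {}"
  shows "eval_rel G (1 / f) (\<lambda>y. 1 / F y)"
proof -
  obtain P Q where *: "f = Fract P Q" "Q \<noteq> 0" "\<forall>y\<in>G. meval Q y \<noteq> 0 \<and> F y = meval P y / meval Q y"
    using assms unfolding eval_rel_def by metis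
  then have nz: "\<forall>y\<in>G. meval P y \<noteq> 0" using assms(2) by auto
  \<comment> \<open>A point of G is needed to exclude the zero polynomial as the new
    denominator.\<close>
  then have "P \<noteq> 0" using assms(3) by (auto simp: meval_0)
  moreover have "1 / f = Fract Q P" using *(1) by (simp add: inverse_eq_divide[symmetric] inverse_fract)
  ultimately show ?thesis
    unfolding eval_rel_def using * nz by (intro exI[of _ Q] exI[of _ P]) auto
qed

lemma eval_rel_sum:
  assumes "\<And>i. i \<in> I \<Longrightarrow> eval_rel G (f i) (F i)"
  shows "eval_rel G (\<Sum>i\<in>I. f i) (\<lambda>y. \<Sum>i\<in>I. F i y)"
  using assms by (induction I rule: infinite_finite_induct) (auto intro: eval_rel_0 eval_rel_add)

section \<open>Evaluation in the group algebra\<close>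

abbreviation (input) hyp :: "nat \<Rightarrow> (int \<Rightarrow> int) set" where "hyp n \<equiv> carrier (hyperoctahedral n)"

text \<open>\<open>galg\<close> lives on all signed permutations of the integers; the support
  condition makes its product agree with the convolution over the finite group in
  \<open>ga_mult\<close>.\<close>

definition eval_galg :: "(var \<Rightarrow> complex) set \<Rightarrow> nat \<Rightarrow> ((int \<Rightarrow> int) \<Rightarrow> ratfun) \<Rightarrow> ((var \<Rightarrow> complex) \<Rightarrow> galg) \<Rightarrow> bool" where
  "eval_galg G n f F \<longleftrightarrow> (\<forall>g\<in>hyp n. eval_rel G (f g) (\<lambda>y. coef (F y) (Sperm g))) \<and>
     (\<forall>y. keys (F y) \<subseteq> Sperm ` hyp n)"

lemma finite_hyp: "finite (hyp n)"
  by (rule finite_subset[OF _ finite_permutations[of "{- int n..int n}"]]) (auto simp: hyp_carrier)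

lemma Sperm_inj: "inj_on Sperm (hyp n)"
  by (rule inj_onI) (metis app_Sperm)

lemma coef_mult_hyp:
  assumes X: "keys X \<subseteq> Sperm ` hyp n" and g: "g \<in> hyp n"
  shows "coef (X * Y) (Sperm g) = (\<Sum>(h, k)\<in>{(h, k). h \<in> hyp n \<and> k \<in> hyp n \<and> h \<circ> k = g}. coef X (Sperm h) * coef Y (Sperm k))"
proof -
  have "coef (X * Y) (Sperm g) = (\<Sum>a\<in>keys X. coef X a * coef Y (- a + Sperm g))"
    by (subst galg_expand[of X]) (simp add: sum_distrib_right lookup_sum)
  also have "\<dots> = (\<Sum>a\<in>Sperm ` hyp n. coef X a * coef Y (- a + Sperm g))"
    by (rule sum.mono_neutral_left) (use X finite_hyp in \<open>auto simp: in_keys_iff\<close>)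
  also have "\<dots> = (\<Sum>h\<in>hyp n. coef X (Sperm h) * coef Y (Sperm (finv h \<circ> g)))"
  proof -
    have "- Sperm h + Sperm g = Sperm (finv h \<circ> g)" if "h \<in> hyp n" for h
      using Sperm_comp[OF hyp_inv(1)[OF that] g] Sperm_inv[OF that] by simp
    then show ?thesis by (subst sum.reindex[OF Sperm_inj]) (auto intro!: sum.cong)
  qed
  also have "\<dots> = (\<Sum>(h, k)\<in>(\<lambda>h. (h, finv h \<circ> g)) ` hyp n. coef X (Sperm h) * coef Y (Sperm k))"
    by (subst sum.reindex) (auto simp: inj_on_def)
  also have "(\<lambda>h. (h, finv h \<circ> g)) ` hyp n = {(h, k). h \<in> hyp n \<and> k \<in> hyp n \<and> h \<circ> k = g}"
  proof (intro equalityI subsetI)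
    fix z assume "z \<in> (\<lambda>h. (h, finv h \<circ> g)) ` hyp n"
    then show "z \<in> {(h, k). h \<in> hyp n \<and> k \<in> hyp n \<and> h \<circ> k = g}"
      using hyp_inv g hyp_closed by (auto simp: comp_assoc[symmetric])
  next
    fix z assume "z \<in> {(h, k). h \<in> hyp n \<and> k \<in> hyp n \<and> h \<circ> k = g}"
    then obtain h k where z: "z = (h, k)" "h \<in> hyp n" "k \<in> hyp n" "h \<circ> k = g" by auto
    then have "finv h \<circ> g = k" using hyp_inv(3)[OF z(2)] by (auto simp: comp_assoc[symmetric])
    then show "z \<in> (\<lambda>h. (h, finv h \<circ> g)) ` hyp n" using z by auto
  qed
  finally show ?thesis .
qed

lemma eval_galg_mult:
  assumes "eval_galg G n f F" "eval_galg G n f' F'"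
  shows "eval_galg G n (ga_mult (hyperoctahedral n) f f') (\<lambda>y. F y * F' y)"
  unfolding eval_galg_def
proof (intro conjI ballI allI)
  fix g assume g: "g \<in> hyp n"
  have "eval_rel G (\<Sum>z\<in>{(h, k). h \<in> hyp n \<and> k \<in> hyp n \<and> h \<circ> k = g}. (case z of (h, k) \<Rightarrow> f h * f' k))
     (\<lambda>y. \<Sum>z\<in>{(h, k). h \<in> hyp n \<and> k \<in> hyp n \<and> h \<circ> k = g}. (case z of (h, k) \<Rightarrow> coef (F y) (Sperm h) * coef (F' y) (Sperm k)))"
    by (rule eval_rel_sum) (use assms in \<open>auto simp: eval_galg_def intro!: eval_rel_mult\<close>)
  moreover have "coef (F y * F' y) (Sperm g) =
    (\<Sum>z\<in>{(h, k). h \<in> hyp n \<and> k \<in> hyp n \<and> h \<circ> k = g}. (case z of (h, k) \<Rightarrow> coef (F y) (Sperm h) * coef (F' y) (Sperm k)))" for y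
    by (rule coef_mult_hyp[OF _ g]) (use assms in \<open>simp add: eval_galg_def\<close>)
  ultimately show "eval_rel G (ga_mult (hyperoctahedral n) f f' g) (\<lambda>y. coef (F y * F' y) (Sperm g))"
    by (simp add: ga_mult_def hyp_mult)
next
  fix y
  have k: "keys (F y) \<subseteq> Sperm ` hyp n" "keys (F' y) \<subseteq> Sperm ` hyp n"
    using assms by (auto simp: eval_galg_def)
  show "keys (F y * F' y) \<subseteq> Sperm ` hyp n"
  proof
    fix a assume "a \<in> keys (F y * F' y)"
    then obtain b c where "a = b + c" "b \<in> keys (F y)" "c \<in> keys (F' y)"
      using keys_mult by blast
    moreover from this k obtain h h' where "b = Sperm h" "c = Sperm h'" "h \<in> hyp n" "h' \<in> hyp n" by blast
    ultimately show "a \<in> Sperm ` hyp n" using Sperm_comp hyp_closed by (metis imageI)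
  qed
qed

lemma eval_galg_add:
  assumes "eval_galg G n f F" "eval_galg G n f' F'"
  shows "eval_galg G n (ga_add f f') (\<lambda>y. F y + F' y)"
proof -
  have "keys (F y + F' y) \<subseteq> Sperm ` hyp n" for y
    using assms keys_add[of "F y" "F' y"] unfolding eval_galg_def by blast
  then show ?thesis using assms by (auto simp: eval_galg_def ga_add_def lookup_add intro!: eval_rel_add)
qed

lemma eval_galg_of:
  assumes "g \<in> hyp n" "eval_rel G c C"
  shows "eval_galg G n (ga_of g c) (\<lambda>y. C y \<cdot> gr (Sperm g))"
  unfolding eval_galg_def
proof (intro conjI ballI allI)
  fix h assume h: "h \<in> hyp n"
  have "Sperm g = Sperm h \<longleftrightarrow> g = h" using Sperm_inj assms(1) h by (auto dest: inj_onD)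
  then show "eval_rel G (ga_of g c h) (\<lambda>y. coef (C y \<cdot> gr (Sperm g)) (Sperm h))"
    using assms(2) eval_rel_0 by (auto simp: ga_of_def lookup_single when_def)
next
  fix y
  have "coef (C y \<cdot> gr (Sperm g)) a = 0" if "a \<noteq> Sperm g" for a
    using that by (simp add: lookup_single)
  then show "keys (C y \<cdot> gr (Sperm g)) \<subseteq> Sperm ` hyp n"
    using assms(1) by (metis image_eqI in_keys_iff subsetI)
qed

lemma eval_galg_foldr:
  assumes "\<And>i. i \<in> set xs \<Longrightarrow> eval_galg G n (f i) (F i)" "eval_galg G n a A"
  shows "eval_galg G n (foldr (ga_mult (hyperoctahedral n)) (map f xs) a) (\<lambda>y. prod_list (map (\<lambda>i. F i y) xs) * A y)"
  using assms(1)
proof (induction xs)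
  case (Cons i xs)
  have "eval_galg G n (ga_mult (hyperoctahedral n) (f i) (foldr (ga_mult (hyperoctahedral n)) (map f xs) a))
    (\<lambda>y. F i y * (prod_list (map (\<lambda>i. F i y) xs) * A y))"
    by (rule eval_galg_mult) (use Cons in auto)
  then show ?case by (simp add: mult.assoc)
qed (use assms in simp)

lemma eval_galg_one: "eval_galg G n (ga_of \<one>\<^bsub>hyperoctahedral n\<^esub> 1) (\<lambda>_. 1)"
proof -
  have "id \<in> hyp n" by (simp add: hyp_carrier permutes_id)
  from eval_galg_of[OF this eval_rel_1] show ?thesis by (simp add: hyp_one Sperm_id)
qed

text \<open>Each step adds s_k + \<beta> on the left and s_k on the right. As \<beta> depends on m
  only, conjugation by s_k merely renames the last letter of the row and of the sign factor, and
  (s_k + \<beta>) s_k = 1 + \<beta> s_k is the new factor.\<close>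

lemma prod_S_eq_phi:
  "prod_list (map (\<lambda>m. sg m (Suc m) + \<beta> m \<cdot> 1) (rev [1..<Suc j])) *
     (sign_proj \<omega> 1 * prod_list (map (\<lambda>m. sg m (Suc m)) [1..<Suc j]))
   = phi (\<lambda>m _. \<beta> m) (Suc j) j * sign_proj \<omega> (Suc j)"
proof (induction j)
  case (Suc j)
  let ?K = "Suc j" and ?\<alpha> = "\<lambda>m _. \<beta> m"
  let ?s = "sg ?K (Suc ?K)"
  have ss: "?s * ?s = 1" by (simp add: sg_sq)
  have t: "?s * sign_proj \<omega> ?K = sign_proj \<omega> (Suc ?K) * ?s"
    using sg_tau_transpose[of ?K "Suc ?K" ?K] by (simp add: sign_proj_def galg_simps)
  have P: "phi ?\<alpha> (Suc ?K) j = ?s * phi ?\<alpha> ?K j * ?s" by (rule phi_Suc_conj) auto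
  have P': "phi ?\<alpha> ?K j = ?s * phi ?\<alpha> (Suc ?K) j * ?s"
    unfolding P by (simp add: mult.assoc[symmetric] ss) (simp add: mult.assoc ss)
  let ?L = "prod_list (map (\<lambda>m. sg m (Suc m) + \<beta> m \<cdot> 1) (rev [1..<Suc j]))"
    and ?R = "prod_list (map (\<lambda>m. sg m (Suc m)) [1..<Suc j])"
  have "prod_list (map (\<lambda>m. sg m (Suc m) + \<beta> m \<cdot> 1) (rev [1..<Suc ?K])) *
     (sign_proj \<omega> 1 * prod_list (map (\<lambda>m. sg m (Suc m)) [1..<Suc ?K]))
     = (?s + \<beta> ?K \<cdot> 1) * ((?L * (sign_proj \<omega> 1 * ?R)) * ?s)"
    by (simp add: mult.assoc)
  also have "\<dots> = (?s + \<beta> ?K \<cdot> 1) * ((phi ?\<alpha> ?K j * sign_proj \<omega> ?K) * ?s)"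
    by (simp only: Suc.IH)
  also have "\<dots> = (?s + \<beta> ?K \<cdot> 1) * (?s * (phi ?\<alpha> (Suc ?K) j * ((?s * sign_proj \<omega> ?K) * ?s)))"
    by (subst P') (simp only: mult.assoc)
  also have "\<dots> = ((?s + \<beta> ?K \<cdot> 1) * ?s) * (phi ?\<alpha> (Suc ?K) j * sign_proj \<omega> (Suc ?K))"
    unfolding t by (simp add: mult.assoc ss)
  also have "(?s + \<beta> ?K \<cdot> 1) * ?s = 1 + \<beta> ?K \<cdot> ?s" by (simp add: distrib_right ss)
  finally show ?case by (simp add: mult.assoc)
qed simp

lemma prod_phi_eq_fusR:
  "prod_list (map (\<lambda>k. phi \<alpha> k (k - 1) * sign_proj (\<omega> k) k) (rev [1..<Suc n])) = fusR \<alpha> n * sign_idem \<omega> n"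
proof (induction n)
  case (Suc n)
  let ?t = "sign_proj (\<omega> (Suc n)) (Suc n)"
  have c: "?t * fusR \<alpha> n = fusR \<alpha> n * ?t"
  proof (rule fusR_commute)
    fix m k assume "1 \<le> m" "m < k" "k \<le> n"
    then have "tau (Suc n) * sg m k = sg m k * tau (Suc n)" by (intro tau_sg_disjoint) auto
    then show "?t * sg m k = sg m k * ?t" by (simp add: sign_proj_def galg_simps)
  qed
  have "prod_list (map (\<lambda>k. phi \<alpha> k (k - 1) * sign_proj (\<omega> k) k) (rev [1..<Suc (Suc n)]))
      = phi \<alpha> (Suc n) n * (?t * fusR \<alpha> n) * sign_idem \<omega> n"
    using Suc.IH by (simp add: mult.assoc)
  then show ?case unfolding c by (simp add: mult.assoc)
qed simp

context bipart
begin

definition generic_points :: "bitableau \<Rightarrow> (var \<Rightarrow> complex) set" where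
  "generic_points T = {y. \<forall>m\<in>{1..n}. \<forall>k\<in>{1..n}. m \<noteq> k \<longrightarrow> pT T m = pT T k \<longrightarrow> y (ZV m) + cT T m \<noteq> y (ZV k) + cT T k}"

definition al_at :: "bitableau \<Rightarrow> (var \<Rightarrow> complex) \<Rightarrow> nat \<Rightarrow> nat \<Rightarrow> complex" where
  "al_at T y = alT T (\<lambda>m. y (ZV m) + cT T m)"

definition om_at :: "bitableau \<Rightarrow> (var \<Rightarrow> complex) \<Rightarrow> nat \<Rightarrow> complex" where
  "om_at T y k = pT T k + y (WV k)"

text \<open>The witness takes z_j to be the imaginary unit times the hook index of j. Contents are
  real, so a vanishing denominator would force equal hook index and equal content in one component,
  that is, the same node. Without such a point the restriction would not be defined.\<close>

lemma generic_point:
  assumes T: "T \<in> SYT"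
  shows "\<exists>y. y \<in> generic_points T \<and> y \<in> hook_subspace n l T"
proof -
  define h where "h i = (case nd T i of (k, a, b) \<Rightarrow> min a b)" for i
  define y :: "var \<Rightarrow> complex" where "y v = (case v of ZV i \<Rightarrow> \<i> * of_nat (h i) | WV i \<Rightarrow> 0)" for v
  have hook: "h i = h j" if "same_hook l T i j" for i j
    using that by (auto simp: same_hook_def principal_hook_def h_def)
  then have "y \<in> hook_subspace n l T" by (simp add: hook_subspace_def y_def)
  moreover have "y \<in> generic_points T"
    unfolding generic_points_def
  proof (intro CollectI ballI impI notI)
    fix m k assume mk: "m \<in> {1..n}" "k \<in> {1..n}" "m \<noteq> k" "pT T m = pT T k"
      and eq: "y (ZV m) + cT T m = y (ZV k) + cT T k"
    have e: "h m = h k" "ct T m = ct T k" using eq by (auto simp: y_def cT_def complex_eq_iff)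
    have c: "cmp T m = cmp T k" using mk pT_eq_iff[OF T] by blast
    have "nd T m = nd T k"
      using e c by (cases "nd T m"; cases "nd T k")
        (auto simp: h_def content_def component_def min_def split: if_splits)
    then show False using nd_inj[OF T mk(1,2)] mk(3) by blast
  qed
  ultimately show ?thesis by blast
qed

lemma eval_galg_fus_Phi:
  assumes T: "T \<in> SYT"
  shows "eval_galg (generic_points T) n (fus_Phi n l T) (\<lambda>y. fusR (al_at T y) n * sign_idem (om_at T y) n)"
proof -
  let ?G = "generic_points T"
  have G: "?G \<noteq> {}" using generic_point[OF T] by blast
  have idn: "id \<in> hyp n" by (simp add: hyp_carrier permutes_id)
  have S: "eval_galg ?G n (fus_S l T m k m) (\<lambda>y. sg m (Suc m) + al_at T y m k \<cdot> 1)"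
    if mk: "1 \<le> m" "m < k" "k \<le> n" for m k
  proof -
    have s: "eval_galg ?G n (ga_of (gen_s m) 1) (\<lambda>y. sg m (Suc m))"
      using eval_galg_of[OF gens_in_hyperoctahedral(1)[of m n] eval_rel_1] mk by (simp add: Sperm_s sg_def)
    let ?c = "(if sgn_p l T k = sgn_p l T m then 1 else 0) /
        ((rvar (ZV k) + of_int (content l T k)) - (rvar (ZV m) + of_int (content l T m))) :: ratfun"
    have c: "eval_rel ?G ?c (\<lambda>y. al_at T y m k)"
    proof (cases "sgn_p l T k = sgn_p l T m")
      case True
      then have p: "pT T m = pT T k" by (simp add: pT_def)
      have "eval_rel ?G (1 / ((rvar (ZV k) + of_int (content l T k)) - (rvar (ZV m) + of_int (content l T m))))
          (\<lambda>y. 1 / ((y (ZV k) + of_int (ct T k)) - (y (ZV m) + of_int (ct T m))))"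
      proof (rule eval_rel_inverse)
        show "eval_rel ?G ((rvar (ZV k) + of_int (content l T k)) - (rvar (ZV m) + of_int (content l T m)))
          (\<lambda>y. (y (ZV k) + of_int (ct T k)) - (y (ZV m) + of_int (ct T m)))"
          by (intro eval_rel_diff eval_rel_add eval_rel_rvar eval_rel_of_int)
        fix y assume "y \<in> ?G"
        then have "y (ZV m) + cT T m \<noteq> y (ZV k) + cT T k" using mk p by (auto simp: generic_points_def)
        then show "(y (ZV k) + of_int (ct T k)) - (y (ZV m) + of_int (ct T m)) \<noteq> 0" by (auto simp: cT_def)
      qed fact
      then show ?thesis using True p by (simp add: al_at_def alT_def cT_def)
    next
      case False
      then have "pT T m \<noteq> pT T k" by (simp add: pT_def)
      then show ?thesis using False eval_rel_0 by (simp add: al_at_def alT_def)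
    qed
    have "eval_galg ?G n (ga_of id ?c) (\<lambda>y. al_at T y m k \<cdot> 1)"
      using eval_galg_of[OF idn c] by (simp add: Sperm_id)
    from eval_galg_add[OF s this] show ?thesis by (simp add: fus_S_def)
  qed
  have half: "eval_rel ?G (1 / 2) (\<lambda>_. 1 / 2)"
    using eval_rel_inverse[OF eval_rel_of_nat[of ?G 2] _ G] by simp
  have t: "eval_galg ?G n (fus_t (of_int (sgn_p l T k) + rvar (WV k))) (\<lambda>y. sign_proj (om_at T y k) 1)"
    if n: "1 \<le> n" for k
  proof -
    have "eval_galg ?G n (ga_of id (1 / 2)) (\<lambda>y. (1 / 2) \<cdot> gr (Sperm id))" by (rule eval_galg_of[OF idn half])
    moreover have "eval_rel ?G ((of_int (sgn_p l T k) + rvar (WV k)) * (1 / 2)) (\<lambda>y. (of_int (sgn_p l T k) + y (WV k)) * (1 / 2))"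
      by (intro eval_rel_mult eval_rel_add eval_rel_of_int eval_rel_rvar half)
    then have "eval_galg ?G n (ga_of gen_t ((of_int (sgn_p l T k) + rvar (WV k)) / 2))
        (\<lambda>y. ((of_int (sgn_p l T k) + y (WV k)) * (1 / 2)) \<cdot> gr (Sperm gen_t))"
      by (intro eval_galg_of gens_in_hyperoctahedral(2)[OF n]) simp
    ultimately have "eval_galg ?G n (fus_t (of_int (sgn_p l T k) + rvar (WV k)))
        (\<lambda>y. (1 / 2) \<cdot> gr (Sperm id) + ((of_int (sgn_p l T k) + y (WV k)) * (1 / 2)) \<cdot> gr (Sperm gen_t))"
      unfolding fus_t_def by (rule eval_galg_add)
    moreover have "(1 / 2) \<cdot> gr (Sperm id) + ((of_int (sgn_p l T k) + y (WV k)) * (1 / 2)) \<cdot> gr (Sperm gen_t)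
        = sign_proj (om_at T y k) 1" for y
      by (simp add: sign_proj_def om_at_def pT_def Sperm_id Sperm_t tau_def av.scale_right_distrib mult.commute)
    ultimately show ?thesis by simp
  qed
  have phi: "eval_galg ?G n (fus_phi n l T k) (\<lambda>y. phi (al_at T y) k (k - 1) * sign_proj (om_at T y k) k)"
    if k: "1 \<le> k" "k \<le> n" for k
  proof -
    let ?H = "ga_mult (hyperoctahedral n)"
    have 1: "eval_galg ?G n (foldr ?H (map (\<lambda>m. ga_of (gen_s m) 1) [1..<k]) (ga_of \<one>\<^bsub>hyperoctahedral n\<^esub> 1))
       (\<lambda>y. prod_list (map (\<lambda>m. sg m (Suc m)) [1..<k]) * 1)"
    proof (rule eval_galg_foldr[OF _ eval_galg_one])
      fix m assume "m \<in> set [1..<k]"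
      then have m: "1 \<le> m" "m < n" using k by auto
      show "eval_galg ?G n (ga_of (gen_s m) 1) (\<lambda>y. sg m (Suc m))"
        using eval_galg_of[OF gens_in_hyperoctahedral(1)[OF m] eval_rel_1] m by (simp add: Sperm_s sg_def)
    qed
    have 2: "eval_galg ?G n (foldr ?H (map (\<lambda>m. fus_S l T m k m) (rev [1..<k]))
        (?H (fus_t (of_int (sgn_p l T k) + rvar (WV k)))
          (foldr ?H (map (\<lambda>m. ga_of (gen_s m) 1) [1..<k]) (ga_of \<one>\<^bsub>hyperoctahedral n\<^esub> 1))))
       (\<lambda>y. prod_list (map (\<lambda>m. sg m (Suc m) + al_at T y m k \<cdot> 1) (rev [1..<k])) *
          (sign_proj (om_at T y k) 1 * (prod_list (map (\<lambda>m. sg m (Suc m)) [1..<k]) * 1)))"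
      by (intro eval_galg_foldr eval_galg_mult t 1 S) (use k in auto)
    obtain j where j: "k = Suc j" using k by (cases k) auto
    have "phi (\<lambda>m _. al_at T y m k) k j = phi (al_at T y) k j" for y by (rule phi_cong) simp
    then have "prod_list (map (\<lambda>m. sg m (Suc m) + al_at T y m k \<cdot> 1) (rev [1..<k])) *
          (sign_proj (om_at T y k) 1 * (prod_list (map (\<lambda>m. sg m (Suc m)) [1..<k]) * 1))
        = phi (al_at T y) k (k - 1) * sign_proj (om_at T y k) k" for y
      using prod_S_eq_phi[of "\<lambda>m. al_at T y m k" j "om_at T y k"] j by simp
    then show ?thesis using 2 by (simp add: fus_phi_def ga_prod_def)
  qed
  have "eval_galg ?G n (foldr (ga_mult (hyperoctahedral n)) (map (fus_phi n l T) (rev [1..<n + 1])) (ga_of \<one>\<^bsub>hyperoctahedral n\<^esub> 1))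
     (\<lambda>y. prod_list (map (\<lambda>k. phi (al_at T y) k (k - 1) * sign_proj (om_at T y k) k) (rev [1..<n + 1])) * 1)"
  proof (rule eval_galg_foldr[OF _ eval_galg_one])
    fix k assume "k \<in> set (rev [1..<n + 1])"
    then have "1 \<le> k" "k \<le> n" by auto
    then show "eval_galg ?G n (fus_phi n l T k) (\<lambda>y. phi (al_at T y) k (k - 1) * sign_proj (om_at T y k) k)" by (rule phi)
  qed
  then show ?thesis
    unfolding fus_Phi_def ga_prod_def using prod_phi_eq_fusR by simp
qed

end

section \<open>Regular functions on the hook subspace\<close>

text \<open>The point x need not belong to D: D will be the generic part of the hook subspace, and x
  a point where denominators of f may vanish.\<close>

definition poly_reg :: "(var \<Rightarrow> complex) set \<Rightarrow> (var \<Rightarrow> complex) \<Rightarrow> ((var \<Rightarrow> complex) \<Rightarrow> complex) \<Rightarrow> complex \<Rightarrow> bool" where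
  "poly_reg D x f c \<longleftrightarrow> (\<exists>N Q. meval Q x \<noteq> 0 \<and> (\<forall>y\<in>D. f y * meval Q y = meval N y) \<and> c = meval N x / meval Q x)"

lemma poly_reg_var: "poly_reg D x (\<lambda>y. y v) (x v)"
  unfolding poly_reg_def
  by (intro exI[of _ "mvar v"] exI[of _ 1]) (simp add: meval_1 meval_mvar)

lemma poly_reg_const: "poly_reg D x (\<lambda>_. a) a"
  unfolding poly_reg_def
  by (intro exI[of _ "Poly_Mapping.single 0 a"] exI[of _ 1]) (simp add: meval_1 meval_const)

lemma poly_reg_add:
  assumes "poly_reg D x f a" "poly_reg D x g b"
  shows "poly_reg D x (\<lambda>y. f y + g y) (a + b)"
proof -
  from assms(1) obtain N Q where 1: "meval Q x \<noteq> 0" "\<forall>y\<in>D. f y * meval Q y = meval N y" "a = meval N x / meval Q x"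
    unfolding poly_reg_def by blast
  from assms(2) obtain N' Q' where 2: "meval Q' x \<noteq> 0" "\<forall>y\<in>D. g y * meval Q' y = meval N' y" "b = meval N' x / meval Q' x"
    unfolding poly_reg_def by blast
  show ?thesis
    unfolding poly_reg_def
  proof (rule exI[of _ "N * Q' + N' * Q"], rule exI[of _ "Q * Q'"], intro conjI ballI)
    fix y assume "y \<in> D"
    then have "meval N y = f y * meval Q y" "meval N' y = g y * meval Q' y" using 1 2 by auto
    then show "(f y + g y) * meval (Q * Q') y = meval (N * Q' + N' * Q) y"
      by (simp add: meval_add meval_mult algebra_simps)
  qed (use 1 2 in \<open>auto simp: meval_add meval_mult add_frac_eq\<close>)
qed

lemma poly_reg_mult:
  assumes "poly_reg D x f a" "poly_reg D x g b"
  shows "poly_reg D x (\<lambda>y. f y * g y) (a * b)"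
proof -
  from assms(1) obtain N Q where 1: "meval Q x \<noteq> 0" "\<forall>y\<in>D. f y * meval Q y = meval N y" "a = meval N x / meval Q x"
    unfolding poly_reg_def by blast
  from assms(2) obtain N' Q' where 2: "meval Q' x \<noteq> 0" "\<forall>y\<in>D. g y * meval Q' y = meval N' y" "b = meval N' x / meval Q' x"
    unfolding poly_reg_def by blast
  show ?thesis
    unfolding poly_reg_def
  proof (rule exI[of _ "N * N'"], rule exI[of _ "Q * Q'"], intro conjI ballI)
    fix y assume "y \<in> D"
    then have "meval N y = f y * meval Q y" "meval N' y = g y * meval Q' y" using 1 2 by auto
    then show "f y * g y * meval (Q * Q') y = meval (N * N') y" by (simp add: meval_mult)
  qed (use 1 2 in \<open>auto simp: meval_mult\<close>)
qed

lemma poly_reg_divide: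
  assumes h: "poly_reg D x h c" and c: "c \<noteq> 0" and G: "poly_reg D x G d"
    and F: "\<And>y. y \<in> D \<Longrightarrow> F y * h y = G y"
  shows "poly_reg D x F (d / c)"
proof -
  from h obtain N Q where 1: "meval Q x \<noteq> 0" "\<forall>y\<in>D. h y * meval Q y = meval N y" "c = meval N x / meval Q x"
    unfolding poly_reg_def by blast
  from G obtain N' Q' where 2: "meval Q' x \<noteq> 0" "\<forall>y\<in>D. G y * meval Q' y = meval N' y" "d = meval N' x / meval Q' x"
    unfolding poly_reg_def by blast
  show ?thesis
    unfolding poly_reg_def
  proof (rule exI[of _ "N' * Q"], rule exI[of _ "N * Q'"], intro conjI ballI)
    fix y assume y: "y \<in> D"
    then have "meval N y = h y * meval Q y" "meval N' y = G y * meval Q' y" using 1 2 by auto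
    then show "F y * meval (N * Q') y = meval (N' * Q) y"
      using F[OF y, symmetric] by (simp add: meval_mult)
  qed (use 1 2 c in \<open>auto simp: meval_mult\<close>)
qed

lemma poly_reg_cong: "(\<And>y. y \<in> D \<Longrightarrow> f y = g y) \<Longrightarrow> poly_reg D x f a \<Longrightarrow> poly_reg D x g a"
  unfolding poly_reg_def by (elim exE conjE, intro exI conjI) auto

lemma coef_limit_div_poly_reg: "coef_limit_div (poly_reg D x) D"
  by (intro coef_limit_div.intro coef_limit.intro coef_limit_div_axioms.intro)
    (fact poly_reg_const poly_reg_add poly_reg_mult poly_reg_cong poly_reg_divide)+

context coef_limit
begin

lemma regA_mult_sign_idem:
  assumes "\<And>m. 1 \<le> m \<Longrightarrow> m \<le> k \<Longrightarrow> reg (\<lambda>y. \<omega> y m) (\<omega>0 m)" "regA F V"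
  shows "regA (\<lambda>y. F y * sign_idem (\<omega> y) k) (V * sign_idem \<omega>0 k)"
  using assms
proof (induction k arbitrary: F V)
  case (Suc k)
  have w: "reg (\<lambda>y. \<omega> y (Suc k)) (\<omega>0 (Suc k))" using Suc.prems by simp
  have "regA (\<lambda>y. (1 / 2) \<cdot> (F y + \<omega> y (Suc k) \<cdot> (F y * tau (Suc k))))
     ((1 / 2) \<cdot> (V + \<omega>0 (Suc k) \<cdot> (V * tau (Suc k))))"
    by (intro regA_smul regA_add regA_tau_right reg_const w Suc.prems(2))
  then have "regA (\<lambda>y. F y * sign_proj (\<omega> y (Suc k)) (Suc k)) (V * sign_proj (\<omega>0 (Suc k)) (Suc k))"
    by (simp add: sign_proj_def distrib_left)
  from Suc.IH[OF Suc.prems(1) this] show ?case by (simp add: mult.assoc)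
qed simp

end

text \<open>The identity of functions is known only where no denominator vanishes, but it is
  required on the whole subspace. Multiplying P and Q by the product V of all relevant differences
  makes both sides 0 at the remaining points.\<close>

lemma (in bipart) restriction_has_value_fus_Phi:
  assumes T: "T \<in> SYT" and g: "g \<in> hyp n"
    and r: "poly_reg (generic_points T \<inter> hook_subspace n l T) x (\<lambda>y. coef (fusR (al_at T y) n * sign_idem (om_at T y) n) (Sperm g)) c"
  shows "restriction_has_value (fus_Phi n l T g) (hook_subspace n l T) x c"
proof -
  let ?L = "hook_subspace n l T"
  define F where "F y = coef (fusR (al_at T y) n * sign_idem (om_at T y) n) (Sperm g)" for y
  obtain P Q where PQ: "fus_Phi n l T g = Fract P Q" "Q \<noteq> 0"
    "\<forall>y\<in>generic_points T. meval Q y \<noteq> 0 \<and> F y = meval P y / meval Q y"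
    using eval_galg_fus_Phi[OF T] g unfolding eval_galg_def eval_rel_def F_def by blast
  obtain N D where ND: "meval D x \<noteq> 0" "\<forall>y\<in>generic_points T \<inter> ?L. F y * meval D y = meval N y" "c = meval N x / meval D x"
    using r unfolding poly_reg_def F_def by blast
  define I where "I = {(m, k). m \<in> {1..n} \<and> k \<in> {1..n} \<and> m \<noteq> k \<and> pT T m = pT T k}"
  have finI: "finite I" by (rule finite_subset[of _ "{1..n} \<times> {1..n}"]) (auto simp: I_def)
  define V where "V = (\<Prod>(m, k)\<in>I. (mvar (ZV m) + Poly_Mapping.single 0 (cT T m)) - (mvar (ZV k) + Poly_Mapping.single 0 (cT T k)))"
  have V: "meval V y \<noteq> 0 \<longleftrightarrow> y \<in> generic_points T" for y
  proof -
    define A where "A m = y (ZV m) + cT T m" for m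
    have "meval V y = (\<Prod>z\<in>I. A (fst z) - A (snd z))"
      unfolding V_def A_def
      by (simp add: meval_prod meval_diff meval_add meval_mvar meval_const case_prod_beta)
    then have "meval V y = 0 \<longleftrightarrow> (\<exists>z\<in>I. A (fst z) = A (snd z))" using finI by simp
    moreover have "y \<in> generic_points T \<longleftrightarrow> (\<forall>z\<in>I. A (fst z) \<noteq> A (snd z))"
    proof
      assume "y \<in> generic_points T"
      then have *: "A m \<noteq> A k" if "m \<in> {1..n}" "k \<in> {1..n}" "m \<noteq> k" "pT T m = pT T k" for m k
        using that unfolding generic_points_def A_def by blast
      show "\<forall>z\<in>I. A (fst z) \<noteq> A (snd z)"
      proof
        fix z assume "z \<in> I"
        then show "A (fst z) \<noteq> A (snd z)" by (intro *) (auto simp: I_def)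
      qed
    next
      assume *: "\<forall>z\<in>I. A (fst z) \<noteq> A (snd z)"
      have "A m \<noteq> A k" if "m \<in> {1..n}" "k \<in> {1..n}" "m \<noteq> k" "pT T m = pT T k" for m k
        using bspec[OF *, of "(m, k)"] that by (simp add: I_def)
      then show "y \<in> generic_points T" unfolding generic_points_def A_def by blast
    qed
    ultimately show ?thesis by blast
  qed
  obtain y0 where y0: "y0 \<in> generic_points T" "y0 \<in> ?L" using generic_point[OF T] by blast
  have V0: "V \<noteq> 0" using V[of y0] y0 by (auto simp: meval_0)
  show ?thesis
    unfolding restriction_has_value_def
  proof (rule exI[of _ "V * P"], rule exI[of _ "V * Q"], rule exI[of _ N], rule exI[of _ D], intro conjI ballI)
    show "fus_Phi n l T g = Fract (V * P) (V * Q)" using PQ(1) V0 by (simp add: mult_fract_cancel)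
    show "\<exists>y\<in>?L. meval (V * Q) y \<noteq> 0" using y0 V PQ(3) by (auto simp: meval_mult)
    fix y assume y: "y \<in> ?L"
    show "meval (V * P) y * meval D y = meval N y * meval (V * Q) y"
    proof (cases "y \<in> generic_points T")
      case True
      then have "meval P y = F y * meval Q y" "F y * meval D y = meval N y" using PQ(3) ND(2) y by auto
      then show ?thesis by (simp add: meval_mult mult_ac)
    next
      case False
      then show ?thesis using V[of y] by (simp add: meval_mult)
    qed
  qed (use ND in auto)
qed

theorem theorem2p2:
  fixes n :: nat and l :: bipart and T :: bitableau
  assumes "bipartition n l" and "T \<in> standard_bitableaux l"
  shows
    "(\<forall>x :: var \<Rightarrow> complex. (\<forall>i\<in>{1..n}. \<forall>j\<in>{1..n}. x (ZV i) = x (ZV j)) \<longrightarrow>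
        (\<forall>g\<in>carrier (hyperoctahedral n).
           restriction_regular_at (fus_Phi n l T g) (hook_subspace n l T) x)) \<and>
     (\<forall>act. young_orthogonal_rep n l act \<longrightarrow>
       (\<forall>x :: var \<Rightarrow> complex. (\<forall>i\<in>{1..n}. \<forall>j\<in>{1..n}. x (ZV i) = x (ZV j)) \<and>
            (\<forall>i\<in>{1..n}. x (WV i) = 0) \<longrightarrow>
         (\<forall>g\<in>carrier (hyperoctahedral n).
            restriction_has_value (fus_Phi n l T g) (hook_subspace n l T) x
              (1 / 2 ^ n * diagonal_element n l act T g))))"
proof -
  interpret bipart n l using assms(1) by (rule bipart.intro)
  note T = assms(2)
  \<comment> \<open>The weights concern V times the sign projector, while the value at x carries
    \<open>om_at T x\<close>; the two factors coincide when all w are 0.\<close>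
  have main: "\<exists>V. left_weight n (pT T) (cT T) (V * sign_idem (pT T) n) \<and> right_weight n (pT T) (cT T) (V * sign_idem (pT T) n) \<and>
      coef (V * sign_idem (pT T) n) 0 = 1 / 2 ^ n \<and>
      (\<forall>g\<in>hyp n. restriction_has_value (fus_Phi n l T g) (hook_subspace n l T) x
        (coef (V * sign_idem (om_at T x) n) (Sperm g)))"
    if x: "\<forall>i\<in>{1..n}. \<forall>j\<in>{1..n}. x (ZV i) = x (ZV j)" for x :: "var \<Rightarrow> complex"
  proof -
    let ?D = "generic_points T \<inter> hook_subspace n l T"
    interpret coef_limit_div "poly_reg ?D x" ?D by (rule coef_limit_div_poly_reg)
    interpret fusion n l "poly_reg ?D x" ?D ..
    obtain V where V: "weight_value T V" "regular_value T V" using fusion_value_exists[OF T] by blast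
    have "admissible T (\<lambda>m y. y (ZV m)) (x (ZV 1))"
      unfolding admissible_def
    proof (intro conjI ballI impI)
      fix m assume m: "m \<in> {1..n}"
      \<comment> \<open>The common value of z is taken at index 1; the presence of m guarantees n
        \<ge> 1.\<close>
      then have "1 \<in> {1..n}" by simp
      with x m have "x (ZV m) = x (ZV 1)" by blast
      then show "poly_reg ?D x (\<lambda>y. y (ZV m)) (x (ZV 1))" using poly_reg_var[of ?D x "ZV m"] by metis
    qed (auto simp: generic_points_def hook_subspace_def)
    then have "regA (\<lambda>y. fusR (ual T (\<lambda>m y. y (ZV m)) y) n) V"
      using V(2) unfolding regular_value_def by blast
    then have "regA (\<lambda>y. fusR (al_at T y) n) V" by (simp add: ual_def al_at_def)
    then have "regA (\<lambda>y. fusR (al_at T y) n * sign_idem (om_at T y) n) (V * sign_idem (om_at T x) n)"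
      by (rule regA_mult_sign_idem[rotated]) (auto simp: om_at_def intro!: reg_add reg_const poly_reg_var)
    then have "poly_reg ?D x (\<lambda>y. coef (fusR (al_at T y) n * sign_idem (om_at T y) n) (Sperm g))
        (coef (V * sign_idem (om_at T x) n) (Sperm g))" for g by (simp add: regA_def)
    then show ?thesis
      using V(1) restriction_has_value_fus_Phi[OF T] unfolding weight_value_def by blast
  qed
  show ?thesis
  proof (intro conjI allI impI ballI)
    fix x :: "var \<Rightarrow> complex" and g
    assume "\<forall>i\<in>{1..n}. \<forall>j\<in>{1..n}. x (ZV i) = x (ZV j)" "g \<in> hyp n"
    then show "restriction_regular_at (fus_Phi n l T g) (hook_subspace n l T) x"
      using main unfolding restriction_regular_at_def by blast
  next
    fix act and x :: "var \<Rightarrow> complex" and g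
    assume act: "young_orthogonal_rep n l act" and g: "g \<in> hyp n"
      and x: "(\<forall>i\<in>{1..n}. \<forall>j\<in>{1..n}. x (ZV i) = x (ZV j)) \<and> (\<forall>i\<in>{1..n}. x (WV i) = 0)"
    obtain V where V: "left_weight n (pT T) (cT T) (V * sign_idem (pT T) n)" "right_weight n (pT T) (cT T) (V * sign_idem (pT T) n)"
      "coef (V * sign_idem (pT T) n) 0 = 1 / 2 ^ n"
      "restriction_has_value (fus_Phi n l T g) (hook_subspace n l T) x (coef (V * sign_idem (om_at T x) n) (Sperm g))"
      using main x g by blast
    have "sign_idem (om_at T x) n = sign_idem (pT T) n"
      by (rule sign_idem_cong) (use conjunct2[OF x] in \<open>simp add: om_at_def\<close>)
    then show "restriction_has_value (fus_Phi n l T g) (hook_subspace n l T) x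
        (1 / 2 ^ n * diagonal_element n l act T g)"
      using V(4) weight_element_coef[OF act g T V(1-3)] by simp
  qed
qed

end
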